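(* For each $n$ let $\{x_{ij,n}=x_{ji,n}:1\le i\le j\le n\}$ be independent random variables satisfying Assumption A (stated in the context), with limit functions $g_{2k}$. Let $m_n$ be positive integers with $m_n\le n/2$, $m_n\to\infty$ and $m_n/n\to\alpha>0$. Let $W_n^b$ be the (periodically banded) symmetric $n\times n$ matrix with entries $$y_{ij,n}=\begin{cases}x_{ij,n}&\text{if }|i-j|\le m_n\text{ or }|i-j|\ge n-m_n,\\0&\text{otherwise.}\end{cases}$$ Then the empirical spectral distribution of $W_n^b$ converges weakly almost surely to a symmetric probability measure $\mu_\alpha$ whose moments are determined by $\{g_{2k}\}_{k\ge1}$ and $\alpha=\lim_{n\to\infty}m_n/n$.
   Context: The empirical spectral distribution of an $n\times n$ real symmetric random matrix with eigenvalues $\lambda_1,\dots,\lambda_n$ is $\frac1n\sum_{i=1}^n\delta_{\lambda_i}$. $\mathcal P(k)$ is the set of partitions of $\{1,\dots,k\}$; for a sequence $(c_k)$ and $\sigma\in\mathcal P(k)$, $c_\sigma:=\prod_{V\text{ block of }\sigma}c_{|V|}$. $\|g\|$ is the sup norm. Assumption A. For each $k\ge1$, $\{g_{2k,n}\}_{n\ge1}$ is a sequence of bounded Riemann integrable symmetric functions on $[0,1]^2$, and there is a sequence $t_n\in[0,\infty]$ such that: (i) for each $k\in\mathbb N$, $n\,\mathbb E[x_{ij,n}^{2k}\mathbf 1_{\{|x_{ij,n}|\le t_n\}}]=g_{2k,n}(\frac in,\frac jn)$ for $1\le i\le j\le n$, and $\lim_{n\to\infty}n^{\gamma}\sup_{1\le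 i\le j\le n}\big|\mathbb E[x_{ij,n}^{2k-1}\mathbf 1_{\{|x_{ij,n}|\le t_n\}}]\big|=0$ for any $\gamma<1$; (ii) for each $k\ge1$, $g_{2k,n}$ converges uniformly to a function $g_{2k}$ as $n\to\infty$; (iii) with $M_{2k}=\|g_{2k}\|$ and $M_{2k-1}=0$ for all $k\ge1$, the numbers $\alpha_{2k}=\sum_{\sigma\in\mathcal P(2k)}M_\sigma$ satisfy Carleman's condition $\sum_{k=1}^\infty\alpha_{2k}^{-1/(2k)}=\infty$.
   Formalization: Added hypothesis: almost surely (1/n) times the sum over i,j of y_ij^2 1{|y_ij|>t_n} tends to 0; Assumption A alone leaves entries above t_n unconstrained and the claim then fails (e.g. entries ±10 with probability 1/4 each, t_n=2). It is vacuous if t_n is infinite. *)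

theory Defs
  imports "HOL-Probability.Probability" "Jordan_Normal_Form.Char_Poly"
begin

section \<open>Empirical spectral distribution\<close>

text \<open>
  \<^term>\<open>proots (char_poly A)\<close> is the multiset of real roots of the characteristic polynomial.  For a
  real symmetric \<open>n \<times> n\<close> matrix all roots are real, so it has exactly \<open>n\<close> elements and
  \<open>esd A\<close> is the average of the point masses at the eigenvalues counted with multiplicity.
\<close>

definition esd :: "real mat \<Rightarrow> real measure" where
  "esd A = distr (measure_pmf (pmf_of_multiset (proots (char_poly A)))) borel (\<lambda>x. x)"

section \<open>Riemann integrability on the unit square\<close>

abbreviation unit_square :: "(real \<times> real) set" where
  "unit_square \<equiv> {0..1} \<times> {0..1}"

text \<open>
  The library integral of Henstock and Kurzweil admits arbitrary gauges; restricting it to constant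
  gauges gives the classical Riemann integral.
\<close>

definition riemann_integrable_on :: "('a::euclidean_space \<Rightarrow> real) \<Rightarrow> 'a set \<Rightarrow> bool" where
  "riemann_integrable_on f S \<longleftrightarrow>
     (\<exists>I. \<forall>e>0. \<exists>d>0. \<forall>P. P tagged_division_of S \<and> (\<lambda>z. ball z d) fine P \<longrightarrow>
        \<bar>(\<Sum>(z, K)\<in>P. measure lborel K * f z) - I\<bar> < e)"

section \<open>Assumption A\<close>

definition sup_on_square :: "(real \<times> real \<Rightarrow> real) \<Rightarrow> real" where
  "sup_on_square f = (SUP z\<in>unit_square. \<bar>f z\<bar>)"

text \<open>Throughout, \<open>g k\<close> stands for \<open>g\<^sub>2\<^sub>k\<close> and \<open>gn k n\<close> for \<open>g\<^sub>2\<^sub>k\<^sub>,\<^sub>n\<close>, with \<open>k \<ge> 1\<close>.\<close>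

definition bound_seq :: "(nat \<Rightarrow> real \<times> real \<Rightarrow> real) \<Rightarrow> nat \<Rightarrow> real" where
  "bound_seq g j = (if even j then sup_on_square (g (j div 2)) else 0)"

definition partition_sum :: "(nat \<Rightarrow> real) \<Rightarrow> nat \<Rightarrow> real" where
  "partition_sum c k = (\<Sum>\<sigma> | partition_on {1..k} \<sigma>. \<Prod>V\<in>\<sigma>. c (card V))"

text \<open>
  The series is taken in \<^typ>\<open>ennreal\<close>, where \<open>1 / 0 = \<infinity>\<close>, so that the degenerate case of vanishing
  \<open>\<alpha>\<close> (all \<open>g\<^sub>2\<^sub>k = 0\<close>) satisfies the condition.
\<close>

definition carleman :: "(nat \<Rightarrow> real) \<Rightarrow> bool" where
  "carleman \<alpha> \<longleftrightarrow>
     (\<Sum>k. 1 / ennreal (\<alpha> (2 * Suc k) powr (1 / real (2 * Suc k)))) = \<infinity>"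

text \<open>
  The random variable \<open>x n i j\<close> is \<open>x\<^sub>i\<^sub>j\<^sub>,\<^sub>n\<close>, with indices running from 1.  The truncation level
  \<open>t n\<close> lies in \<open>[0, \<infinity>]\<close>.  Integrability is stated separately because the Bochner integral of a
  non-integrable function is 0.
\<close>

definition trunc_pow :: "ennreal \<Rightarrow> nat \<Rightarrow> real \<Rightarrow> real" where
  "trunc_pow \<tau> p u = u ^ p * of_bool (ennreal \<bar>u\<bar> \<le> \<tau>)"

definition upper_indices :: "nat \<Rightarrow> (nat \<times> nat) set" where
  "upper_indices n = {(i, j). 1 \<le> i \<and> i \<le> j \<and> j \<le> n}"

definition assumption_A ::
  "'a measure \<Rightarrow> (nat \<Rightarrow> nat \<Rightarrow> nat \<Rightarrow> 'a \<Rightarrow> real) \<Rightarrow> (nat \<Rightarrow> ennreal) \<Rightarrow>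
   (nat \<Rightarrow> nat \<Rightarrow> real \<times> real \<Rightarrow> real) \<Rightarrow> (nat \<Rightarrow> real \<times> real \<Rightarrow> real) \<Rightarrow> bool" where
  "assumption_A M x t gn g \<longleftrightarrow>
     (\<forall>k\<ge>1. \<forall>n\<ge>1. bounded (gn k n ` unit_square) \<and>
        riemann_integrable_on (gn k n) unit_square \<and>
        (\<forall>u\<in>{0..1}. \<forall>v\<in>{0..1}. gn k n (u, v) = gn k n (v, u))) \<and>
     (\<forall>p\<ge>1. \<forall>n\<ge>1. \<forall>(i, j)\<in>upper_indices n.
        integrable M (\<lambda>\<omega>. trunc_pow (t n) p (x n i j \<omega>))) \<and>
     (\<forall>k\<ge>1. \<forall>n\<ge>1. \<forall>(i, j)\<in>upper_indices n.
        real n * (\<integral>\<omega>. trunc_pow (t n) (2 * k) (x n i j \<omega>) \<partial>M) = gn k n (real i / real n, real j / real n)) \<and>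
     (\<forall>k\<ge>1. \<forall>\<gamma><1::real.
        (\<lambda>n. real n powr \<gamma> *
           (SUP (i, j)\<in>upper_indices n. \<bar>\<integral>\<omega>. trunc_pow (t n) (2 * k - 1) (x n i j \<omega>) \<partial>M\<bar>)) \<longlonglongrightarrow> 0) \<and>
     (\<forall>k\<ge>1. uniform_limit unit_square (gn k) (g k) sequentially) \<and>
     carleman (partition_sum (bound_seq g))"

section \<open>Independent symmetric arrays and periodic banding\<close>

text \<open>Independence is required for each \<open>n\<close> separately; nothing is assumed across different \<open>n\<close>.\<close>

definition indep_symmetric_array ::
  "'a measure \<Rightarrow> (nat \<Rightarrow> nat \<Rightarrow> nat \<Rightarrow> 'a \<Rightarrow> real) \<Rightarrow> bool" where
  "indep_symmetric_array M x \<longleftrightarrow>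
     (\<forall>n\<ge>1. prob_space.indep_vars M (\<lambda>_. borel) (\<lambda>(i, j). x n i j) (upper_indices n) \<and>
        (\<forall>i\<in>{1..n}. \<forall>j\<in>{1..n}. x n i j = x n j i))"

definition banded ::
  "(nat \<Rightarrow> nat) \<Rightarrow> (nat \<Rightarrow> nat \<Rightarrow> nat \<Rightarrow> 'a \<Rightarrow> real) \<Rightarrow> nat \<Rightarrow> nat \<Rightarrow> nat \<Rightarrow> 'a \<Rightarrow> real" where
  "banded m x n i j \<omega> =
     (if \<bar>int i - int j\<bar> \<le> int (m n) \<or> \<bar>int i - int j\<bar> \<ge> int n - int (m n)
      then x n i j \<omega> else 0)"

text \<open>Library matrices are indexed from 0, hence the shift.\<close>

definition array_mat :: "(nat \<Rightarrow> nat \<Rightarrow> nat \<Rightarrow> 'a \<Rightarrow> real) \<Rightarrow> nat \<Rightarrow> 'a \<Rightarrow> real mat" where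
  "array_mat y n \<omega> = mat n n (\<lambda>(i, j). y n (Suc i) (Suc j) \<omega>)"

text \<open>
  Assumption A constrains only the truncated variables \<open>x 1{|x| \<le> t}\<close>; it says nothing about what lies
  above the truncation level, and without such control the spectral distribution of the
  untruncated matrix need not converge: let the entries be \<open>\<plusminus>1\<close> with probability \<open>1/(2n)\<close> each,
  \<open>\<plusminus>10\<close> with probability \<open>1/4\<close> each, 0 otherwise, and \<open>t n = 2\<close>.  The following is the control
  needed to pass from the truncated to the untruncated matrix.  It holds trivially when \<open>t n = \<infinity>\<close>.
\<close>

definition negligible_tail ::
  "'a measure \<Rightarrow> (nat \<Rightarrow> nat \<Rightarrow> nat \<Rightarrow> 'a \<Rightarrow> real) \<Rightarrow> (nat \<Rightarrow> ennreal) \<Rightarrow> bool" where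
  "negligible_tail M y t \<longleftrightarrow>
     (AE \<omega> in M. (\<lambda>n. (\<Sum>i=1..n. \<Sum>j=1..n. (y n i j \<omega>)\<^sup>2 * of_bool (t n < ennreal \<bar>y n i j \<omega>\<bar>)) / real n)
        \<longlonglongrightarrow> 0)"

text \<open>
  The data \<open>(g\<^sub>2\<^sub>k)\<close>, \<open>k \<ge> 1\<close>, as functions on the unit square: values outside the square and the
  unused entry \<open>k = 0\<close> are forgotten.
\<close>

definition limit_data :: "(nat \<Rightarrow> real \<times> real \<Rightarrow> real) \<Rightarrow> nat \<Rightarrow> real \<times> real \<Rightarrow> real" where
  "limit_data g = restrict (\<lambda>k. restrict (g k) unit_square) {1..}"

end

theory Submission
  imports Defs "Jordan_Normal_Form.Schur_Decomposition"
begin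

text \<open>
  Moment method.  Expand the moments of the spectral distribution of the truncated band matrix over
  closed walks.  In expectation only the walks tracing a tree (every edge then being used an even number
  of times) survive; each coincidence pattern of such walks contributes a homomorphism density of the
  kernels \<open>g (2 * k)\<close> restricted to the limiting band, and these densities converge because Riemann
  integrable kernels are \<open>L\<^sup>1\<close>-limits of step functions.  Four closed walks have
  at most four vertices more than edges, and at most two more if each of them shares an edge with
  another, so the fourth centred moments are summable and the convergence of moments is almost sure.
  The patterns of length \<open>2 * k\<close> inject into the
  partitions of \<open>{1..2 * k}\<close>, so the limiting moments are dominated by those in Carleman's condition and
  determine \<open>\<mu>\<close>; determinacy is Bang's quasi-analyticity argument applied to characteristic functions.
  The truncation is removed by a Hoffman--Wielandt bound on the difference of characteristic functions.
\<close>

subsection \<open>Real symmetric matrices and their spectral distributions\<close>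

lemma real_symmetric_eigenvector:
  fixes A :: "real mat"
  assumes A: "A \<in> carrier_mat n n" and sym: "transpose_mat A = A" and n: "0 < n"
  obtains v e where "eigenvector A v e"
proof -
  let ?C = "map_mat complex_of_real A"
  have C: "?C \<in> carrier_mat n n" using A by simp
  have "degree (char_poly ?C) = n" using degree_monic_char_poly[OF C] by simp
  then have "\<not> constant (poly (char_poly ?C))" using n constant_degree by (metis less_irrefl)
  from fundamental_theorem_of_algebra[OF this] obtain z where z: "poly (char_poly ?C) z = 0" by auto
  then have "eigenvalue ?C z" using eigenvalue_root_char_poly[OF C] by simp
  then obtain v where ev: "eigenvector ?C v z" unfolding eigenvalue_def by auto
  then have v: "v \<in> carrier_vec n" "v \<noteq> 0\<^sub>v n" "?C *\<^sub>v v = z \<cdot>\<^sub>v v"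
    using A by (auto simp: eigenvector_def)
  have Aij: "A $$ (i,j) = A $$ (j,i)" if "i < n" "j < n" for i j
    using sym A that by (metis carrier_matD index_transpose_mat(1))
  have row: "(\<Sum>j<n. complex_of_real (A $$ (i,j)) * v $ j) = z * v $ i" if i: "i < n" for i
  proof -
    have "(?C *\<^sub>v v) $ i = (\<Sum>j<n. complex_of_real (A $$ (i,j)) * v $ j)"
      using i A v(1) by (auto simp: scalar_prod_def lessThan_atLeast0 intro!: sum.cong)
    then show ?thesis using v i by simp
  qed
  define S where "S = (\<Sum>i<n. cnj (v $ i) * (\<Sum>j<n. complex_of_real (A $$ (i,j)) * v $ j))"
  define N where "N = (\<Sum>i<n. (cmod (v $ i))\<^sup>2)"
  have S1: "S = z * complex_of_real N"
    unfolding S_def N_def of_real_sum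
    by (subst sum_distrib_left, intro sum.cong refl, subst row)
      (simp_all add: complex_norm_square mult_ac del: of_real_power)
  have "cnj S = (\<Sum>i<n. \<Sum>j<n. v $ i * (complex_of_real (A $$ (i,j)) * cnj (v $ j)))"
    unfolding S_def by (simp add: sum_distrib_left)
  also have "\<dots> = (\<Sum>j<n. \<Sum>i<n. v $ i * (complex_of_real (A $$ (i,j)) * cnj (v $ j)))"
    by (rule sum.swap)
  also have "\<dots> = S" unfolding S_def
    by (auto simp: sum_distrib_left Aij algebra_simps intro!: sum.cong)
  finally have "cnj S = S" .
  moreover have "N > 0"
  proof -
    obtain i where "i < n" "v $ i \<noteq> 0" using v(1,2) by (metis carrier_vecD eq_vecI index_zero_vec)
    then show ?thesis unfolding N_def by (intro sum_pos2[of _ i]) auto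
  qed
  ultimately have "cnj z = z" using S1 by simp
  then obtain e where e: "z = complex_of_real e" by (metis Reals_cases Reals_cnj_iff)
  have "char_poly ?C = map_poly complex_of_real (char_poly A)"
    by (rule of_real_hom.char_poly_hom[OF A])
  then have "poly (char_poly A) e = 0" using z e by (simp add: of_real_hom.poly_map_poly)
  then have "eigenvalue A e" using eigenvalue_root_char_poly[OF A] by simp
  then show ?thesis using that unfolding eigenvalue_def by auto
qed

lemma orthonormal_extension:
  fixes v :: "real vec"
  assumes v: "v \<in> carrier_vec n" "v \<noteq> 0\<^sub>v n"
  obtains W c where "W \<in> carrier_mat n n" "transpose_mat W * W = 1\<^sub>m n" "c \<noteq> 0" "col W 0 = c \<cdot>\<^sub>v v"
proof -
  interpret cof_vec_space n "TYPE(real)" .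
  define b where "b = basis_completion v"
  define ws where "ws = gram_schmidt n b"
  from basis_completion[OF v, folded b_def]
  have dist_b: "distinct b" and indep: "\<not> lin_dep (set b)" and b: "set b \<subseteq> carrier_vec n"
    and hdb: "hd b = v" and len_b: "length b = n" by auto
  have n: "n \<noteq> 0" using v by (metis carrier_vecD eq_vecI index_zero_vec(2) less_nat_zero_code)
  from hdb len_b n obtain vs where bv: "b = v # vs" by (cases b) auto
  from gram_schmidt_result[OF b dist_b indep refl, folded ws_def]
  have ws: "set ws \<subseteq> carrier_vec n" "corthogonal ws" "length ws = n" by (auto simp: len_b)
  from gram_schmidt_hd[OF v(1), of vs, folded bv] have hdws: "hd ws = v" unfolding ws_def .
  have wsc: "ws ! i \<in> carrier_vec n" if "i < n" for i using ws that by auto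
  have orth: "(scalar_prod (ws ! i) (ws ! j) = 0) = (i \<noteq> j)" if "i < n" "j < n" for i j
    using ws(2,3) that unfolding corthogonal_def by simp
  have pos: "scalar_prod (ws ! i) (ws ! i) > 0" if "i < n" for i
    using orth[OF that that] sum_nonneg[of "{0..<n}" "\<lambda>k. ws ! i $ k * ws ! i $ k"] wsc[OF that]
    by (auto simp: scalar_prod_def less_le)
  define s where "s i = 1 / sqrt (scalar_prod (ws ! i) (ws ! i))" for i
  define W where "W = mat_of_cols n (map (\<lambda>i. s i \<cdot>\<^sub>v ws ! i) [0..<n])"
  have W: "W \<in> carrier_mat n n" unfolding W_def using mat_of_cols_carrier(1)[of n "map (\<lambda>i. s i \<cdot>\<^sub>v ws ! i) [0..<n]"] by simp
  have col: "col W i = s i \<cdot>\<^sub>v ws ! i" if "i < n" for i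
    unfolding W_def using that wsc[OF that] by (simp add: col_mat_of_cols)
  have "transpose_mat W * W = 1\<^sub>m n"
  proof (rule eq_matI)
    fix i j assume "i < dim_row (1\<^sub>m n)" "j < dim_col (1\<^sub>m n)"
    then have ij: "i < n" "j < n" by auto
    have "(transpose_mat W * W) $$ (i,j) = scalar_prod (col W i) (col W j)" using W ij by simp
    also have "\<dots> = s i * s j * scalar_prod (ws ! i) (ws ! j)" using ij wsc[of i] wsc[of j]
      by (simp add: col smult_scalar_prod_distrib[of _ n] scalar_prod_smult_distrib[of _ n])
    also have "\<dots> = (1\<^sub>m n) $$ (i,j)"
      using orth[OF ij] pos[OF ij(1)] ij by (auto simp: s_def)
    finally show "(transpose_mat W * W) $$ (i,j) = (1\<^sub>m n) $$ (i,j)" .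
  qed (use W in auto)
  moreover have "s 0 \<noteq> 0" using pos[of 0] n by (auto simp: s_def)
  moreover have "col W 0 = s 0 \<cdot>\<^sub>v v" using col[of 0] n hdws ws(3)
    by (metis hd_conv_nth length_0_conv neq0_conv)
  ultimately show ?thesis using that W by blast
qed

theorem real_symmetric_diagonalization:
  fixes A :: "real mat"
  assumes "A \<in> carrier_mat n n" and "transpose_mat A = A"
  shows "\<exists>U D. U \<in> carrier_mat n n \<and> D \<in> carrier_mat n n \<and> transpose_mat U * U = 1\<^sub>m n \<and>
    diagonal_mat D \<and> A = U * D * transpose_mat U"
  using assms
proof (induction n arbitrary: A)
  case 0
  show ?case
    by (rule exI[of _ "1\<^sub>m 0"], rule exI[of _ A]) (use 0 in \<open>auto simp: diagonal_mat_def\<close>)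
next
  case (Suc m)
  let ?n = "Suc m"
  note A = Suc.prems(1)
  obtain v e where ev: "eigenvector A v e"
    using real_symmetric_eigenvector[OF Suc.prems] by auto
  then have v: "v \<in> carrier_vec ?n" "v \<noteq> 0\<^sub>v ?n" "A *\<^sub>v v = e \<cdot>\<^sub>v v"
    using A by (auto simp: eigenvector_def)
  obtain W c where W: "W \<in> carrier_mat ?n ?n" "transpose_mat W * W = 1\<^sub>m ?n"
    and c: "c \<noteq> 0" "col W 0 = c \<cdot>\<^sub>v v"
    using orthonormal_extension[OF v(1,2)] by metis
  let ?T = "transpose_mat W"
  have T: "?T \<in> carrier_mat ?n ?n" using W by simp
  have WT: "W * ?T = 1\<^sub>m ?n" by (rule mat_mult_left_right_inverse[OF T W(1) W(2)])
  define A' where "A' = ?T * A * W"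
  have A': "A' \<in> carrier_mat ?n ?n" using A W by (simp add: A'_def)
  have symA': "transpose_mat A' = A'"
  proof -
    have "transpose_mat A' = ?T * transpose_mat (?T * A)" unfolding A'_def
      by (rule transpose_mult[of _ ?n ?n _ ?n]) (use A W in auto)
    also have "transpose_mat (?T * A) = A * W"
      using transpose_mult[OF T A] Suc.prems(2) by simp
    also have "?T * (A * W) = A'" unfolding A'_def
      by (rule assoc_mult_mat[symmetric]) (use A W in auto)
    finally show ?thesis .
  qed
  have cW: "col W 0 \<in> carrier_vec ?n" by (rule col_carrier_vec[OF _ W(1)]) simp
  have col0: "col A' 0 = e \<cdot>\<^sub>v unit_vec ?n 0"
  proof -
    have "col A' 0 = (?T * A) *\<^sub>v col W 0" unfolding A'_def
      by (rule col_mult2[of _ ?n ?n _ ?n]) (use A W in auto)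
    also have "\<dots> = ?T *\<^sub>v (A *\<^sub>v col W 0)"
      by (rule assoc_mult_mat_vec[of _ ?n ?n _ ?n]) (use A W cW in auto)
    also have "A *\<^sub>v col W 0 = e \<cdot>\<^sub>v col W 0"
      using v A c by (simp add: mult_mat_vec smult_smult_assoc mult.commute)
    also have "?T *\<^sub>v (e \<cdot>\<^sub>v col W 0) = e \<cdot>\<^sub>v (?T *\<^sub>v col W 0)"
      by (rule mult_mat_vec[of _ ?n ?n]) (use W cW in auto)
    also have "?T *\<^sub>v col W 0 = col (?T * W) 0"
      by (rule col_mult2[symmetric, of _ ?n ?n _ ?n]) (use W in auto)
    also have "\<dots> = unit_vec ?n 0" by (simp add: W(2))
    finally show ?thesis .
  qed
  have A'0: "A' $$ (i, 0) = (if i = 0 then e else 0)" if "i < ?n" for i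
    using arg_cong[OF col0, of "\<lambda>w. w $ i"] that A' by (auto simp: unit_vec_def)
  have A'0': "A' $$ (0, i) = (if i = 0 then e else 0)" if "i < ?n" for i
    using A'0[OF that] symA' that A' by (metis carrier_matD index_transpose_mat(1) zero_less_Suc)
  define A3 where "A3 = mat m m (\<lambda>(i,j). A' $$ (Suc i, Suc j))"
  have A3: "A3 \<in> carrier_mat m m" by (simp add: A3_def)
  have "transpose_mat A3 = A3"
  proof (rule eq_matI)
    fix i j assume "i < dim_row A3" "j < dim_col A3"
    then show "transpose_mat A3 $$ (i,j) = A3 $$ (i,j)"
      using symA' A' by (auto simp: A3_def) (metis Suc_less_eq carrier_matD index_transpose_mat(1))
  qed (use A3 in auto)
  from Suc.IH[OF A3 this] obtain U D where U: "U \<in> carrier_mat m m" and D: "D \<in> carrier_mat m m"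
    and UU: "transpose_mat U * U = 1\<^sub>m m" and dD: "diagonal_mat D" and A3e: "A3 = U * D * transpose_mat U"
    by blast
  let ?F = "\<lambda>a X. four_block_mat a (0\<^sub>m 1 m) (0\<^sub>m m 1) X :: real mat"
  let ?e = "mat 1 1 (\<lambda>_. e)"
  have F: "?F a X \<in> carrier_mat ?n ?n" if "a \<in> carrier_mat 1 1" "X \<in> carrier_mat m m" for a X
    using that four_block_carrier_mat[of a 1 1 X m m "0\<^sub>m 1 m" "0\<^sub>m m 1"] by simp
  have A'b: "A' = ?F ?e A3"
  proof (rule eq_matI)
    fix i j assume "i < dim_row (?F ?e A3)" "j < dim_col (?F ?e A3)"
    then have "i < ?n" "j < ?n" using A3 by auto
    then show "A' $$ (i,j) = (?F ?e A3) $$ (i,j)"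
      using A'0[of i] A'0'[of j] A3 by (cases i; cases j) (auto simp: A3_def)
  qed (use A' A3 in auto)
  have multF: "?F a X * ?F b Y = ?F (a * b) (X * Y)"
    if "a \<in> carrier_mat 1 1" "X \<in> carrier_mat m m" "b \<in> carrier_mat 1 1" "Y \<in> carrier_mat m m" for a b X Y
    using that by (subst mult_four_block_mat[of _ 1 1 _ m _ m _ _ 1 _ m]) auto
  define V where "V = ?F (1\<^sub>m 1) U"
  have V: "V \<in> carrier_mat ?n ?n" unfolding V_def using U by (intro F) auto
  have tV: "transpose_mat V = ?F (1\<^sub>m 1) (transpose_mat U)"
    unfolding V_def using U by (subst transpose_four_block_mat[of _ 1 1 _ m _ m]) auto
  have E: "?F ?e D \<in> carrier_mat ?n ?n" using D by (intro F) auto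
  have VV: "transpose_mat V * V = 1\<^sub>m ?n"
  proof -
    have "transpose_mat V * V = ?F (1\<^sub>m 1) (1\<^sub>m m)" unfolding tV unfolding V_def
      using U by (subst multF) (auto simp: UU)
    also have "\<dots> = 1\<^sub>m ?n" by (rule eq_matI) auto
    finally show ?thesis .
  qed
  have A'V: "A' = V * ?F ?e D * transpose_mat V"
  proof -
    have "V * ?F ?e D = ?F ?e (U * D)" unfolding V_def using U D by (subst multF) auto
    moreover have "?F ?e (U * D) * transpose_mat V = ?F ?e (U * D * transpose_mat U)"
      unfolding tV using U D by (subst multF) auto
    ultimately show ?thesis by (simp add: A'b A3e)
  qed
  let ?U = "W * V"
  have tU: "transpose_mat ?U = transpose_mat V * ?T" by (rule transpose_mult[OF W(1) V])
  have tVc: "transpose_mat V \<in> carrier_mat ?n ?n" using V by simp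
  have "transpose_mat ?U * ?U = transpose_mat V * (?T * (W * V))" unfolding tU
    by (rule assoc_mult_mat[OF tVc T]) (use W V in auto)
  also have "?T * (W * V) = V"
    using assoc_mult_mat[OF T W(1) V] W(2) V by simp
  finally have UU': "transpose_mat ?U * ?U = 1\<^sub>m ?n" by (simp add: VV)
  have "?U * ?F ?e D * transpose_mat ?U = W * (V * ?F ?e D * transpose_mat V) * ?T"
    unfolding tU using W(1) V E tVc T
    by (simp add: assoc_mult_mat[of _ ?n ?n _ ?n _ ?n])
  also have "\<dots> = W * (?T * A * W) * ?T" by (simp only: A'V[symmetric] A'_def)
  also have "\<dots> = (W * ?T) * A * (W * ?T)"
    using W(1) A T by (simp add: assoc_mult_mat[of _ ?n ?n _ ?n _ ?n])
  also have "\<dots> = A" using A by (simp add: WT)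
  finally have AU: "A = ?U * ?F ?e D * transpose_mat ?U" ..
  have dE: "diagonal_mat (?F ?e D)" unfolding diagonal_mat_def
  proof (intro allI impI)
    fix i j assume "i < dim_row (?F ?e D)" "j < dim_col (?F ?e D)" "i \<noteq> j"
    then show "?F ?e D $$ (i,j) = 0" using D dD
      by (cases i; cases j) (auto simp: diagonal_mat_def)
  qed
  show ?case
    by (intro exI[of _ ?U] exI[of _ "?F ?e D"] conjI UU' AU dE E) (use W V in auto)
qed

lemma proots_prod_linear_list: "proots (\<Prod>a\<leftarrow>as. [:- a, 1:]) = mset (as :: real list)"
proof (induction as)
  case (Cons a as)
  have "(\<Prod>a\<leftarrow>as. [:- a, 1:]) \<noteq> 0" by (auto simp: prod_list_zero_iff)
  then show ?case using Cons by (simp add: proots_mult del: mult_pCons_left)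
qed simp

lemma real_symmetric_spectral_data:
  fixes A :: "real mat"
  assumes A: "A \<in> carrier_mat n n" and sym: "transpose_mat A = A"
  obtains u :: "nat \<Rightarrow> nat \<Rightarrow> real" and d :: "nat \<Rightarrow> real"
  where "\<And>a b. a < n \<Longrightarrow> b < n \<Longrightarrow> A $$ (a, b) = (\<Sum>c<n. d c * (u a c * u b c))"
    and "\<And>c c'. c < n \<Longrightarrow> c' < n \<Longrightarrow> (\<Sum>a<n. u a c * u a c') = of_bool (c = c')"
    and "\<And>a b. a < n \<Longrightarrow> b < n \<Longrightarrow> (\<Sum>c<n. u a c * u b c) = of_bool (a = b)"
    and "proots (char_poly A) = image_mset d (mset_set {..<n})"
proof -
  obtain U D where U: "U \<in> carrier_mat n n" and D: "D \<in> carrier_mat n n"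
    and UU: "transpose_mat U * U = 1\<^sub>m n" and dD: "diagonal_mat D" and AU: "A = U * D * transpose_mat U"
    using real_symmetric_diagonalization[OF A sym] by blast
  have tU: "transpose_mat U \<in> carrier_mat n n" using U by simp
  have UU': "U * transpose_mat U = 1\<^sub>m n" by (rule mat_mult_left_right_inverse[OF tU U UU])
  have prod_ij: "(X * Y) $$ (a, b) = (\<Sum>c<n. X $$ (a, c) * Y $$ (c, b))"
    if "X \<in> carrier_mat n n" "Y \<in> carrier_mat n n" "a < n" "b < n" for X Y :: "real mat" and a b
    using that by (auto simp: scalar_prod_def lessThan_atLeast0 intro!: sum.cong)
  show ?thesis
  proof (rule that[of "\<lambda>c. D $$ (c, c)" "\<lambda>a c. U $$ (a, c)"])
    fix a b assume ab: "a < n" "b < n"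
    have "(U * D) $$ (a, c) = U $$ (a, c) * D $$ (c, c)" if c: "c < n" for c
    proof -
      have "(U * D) $$ (a, c) = (\<Sum>c'<n. U $$ (a, c') * D $$ (c', c))"
        using prod_ij[OF U D ab(1) c] .
      also have "\<dots> = (\<Sum>c'<n. if c' = c then U $$ (a, c) * D $$ (c, c) else 0)"
        using dD D c by (intro sum.cong) (auto simp: diagonal_mat_def)
      finally show ?thesis using c by simp
    qed
    then show "A $$ (a, b) = (\<Sum>c<n. D $$ (c, c) * (U $$ (a, c) * U $$ (b, c)))"
      unfolding AU using ab U D by (subst prod_ij) (auto intro!: sum.cong)
    show "(\<Sum>c<n. U $$ (a, c) * U $$ (b, c)) = of_bool (a = b)"
      using arg_cong[OF UU', of "\<lambda>X. X $$ (a, b)"] prod_ij[OF U tU ab] ab U by simp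
  next
    fix c c' assume cc: "c < n" "c' < n"
    show "(\<Sum>a<n. U $$ (a, c) * U $$ (a, c')) = of_bool (c = c')"
      using arg_cong[OF UU, of "\<lambda>X. X $$ (c, c')"] prod_ij[OF tU U cc] cc U by simp
  next
    have "similar_mat A D" unfolding similar_mat_def
      by (intro exI[of _ U] exI[of _ "transpose_mat U"] similar_mat_witI[of _ _ n])
        (use A U D UU UU' AU in auto)
    then have "char_poly A = char_poly D" by (rule char_poly_similar)
    also have "\<dots> = (\<Prod>a\<leftarrow>diag_mat D. [:- a, 1:])"
      by (rule char_poly_upper_triangular[OF D])
        (use dD D in \<open>auto simp: upper_triangular_def diagonal_mat_def\<close>)
    finally have "proots (char_poly A) = mset (diag_mat D)" by (simp only: proots_prod_linear_list)
    also have "\<dots> = image_mset (\<lambda>c. D $$ (c, c)) (mset_set {..<n})"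
      using D by (simp add: diag_mat_def lessThan_atLeast0)
    finally show "proots (char_poly A) = image_mset (\<lambda>c. D $$ (c, c)) (mset_set {..<n})" .
  qed
qed

lemma real_distribution_esd: "real_distribution (esd A)"
  unfolding esd_def real_distribution_def real_distribution_axioms_def
  by (auto intro!: measure_pmf.prob_space_distr)

lemma esd_integral:
  fixes A :: "real mat" and f :: "real \<Rightarrow> 'b :: {banach, second_countable_topology}"
  assumes "proots (char_poly A) = image_mset d (mset_set {..<n})" and "0 < n"
    and f: "f \<in> borel_measurable borel"
  shows "integrable (esd A) f" and "(\<integral>x. f x \<partial>esd A) = (1 / real n) *\<^sub>R (\<Sum>c<n. f (d c))"
proof -
  have "pmf_of_multiset (proots (char_poly A)) = map_pmf d (pmf_of_set {..<n})"
    using assms by (subst map_pmf_of_set) auto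
  then have esd: "esd A = distr (measure_pmf (map_pmf d (pmf_of_set {..<n}))) borel (\<lambda>x. x)"
    by (simp add: esd_def)
  have ne: "{..<n} \<noteq> {}" using assms(2) by auto
  have fin: "finite (set_pmf (map_pmf d (pmf_of_set {..<n})))" using ne by simp
  show "integrable (esd A) f" unfolding esd
    by (subst integrable_distr_eq) (use f fin in \<open>auto intro: integrable_measure_pmf_finite simp del: integrable_map_pmf_eq\<close>)
  have "(\<integral>x. f x \<partial>esd A) = (\<integral>c. f (d c) \<partial>measure_pmf (pmf_of_set {..<n}))"
    unfolding esd using f by (subst integral_distr) auto
  also have "\<dots> = (\<Sum>c<n. pmf (pmf_of_set {..<n}) c *\<^sub>R f (d c))"
    by (rule integral_measure_pmf) (use ne in \<open>auto simp: set_pmf_of_set\<close>)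
  also have "\<dots> = (1 / real n) *\<^sub>R (\<Sum>c<n. f (d c))"
    unfolding scaleR_sum_right by (intro sum.cong) (use ne in \<open>auto simp: pmf_of_set\<close>)
  finally show "(\<integral>x. f x \<partial>esd A) = (1 / real n) *\<^sub>R (\<Sum>c<n. f (d c))" .
qed

lemma bij_betw_cyclic_succ:
  assumes "0 < k" shows "bij_betw (\<lambda>j. Suc j mod k) {..<k} {..<k}"
proof -
  have "inj_on (\<lambda>j. Suc j mod k) {..<k}"
    by (rule inj_onI) (auto simp: mod_Suc split: if_splits)
  moreover have "(\<lambda>j. Suc j mod k) ` {..<k} \<subseteq> {..<k}" using assms by auto
  ultimately show ?thesis
    unfolding bij_betw_def by (metis card_image card_subset_eq finite_lessThan)
qed

lemma cyclic_const:
  assumes "\<And>j. j < k \<Longrightarrow> c (Suc j mod k) = c j" and "j < k"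
  shows "c j = c (0::nat)"
  using assms(2)
proof (induction j)
  case (Suc j)
  then show ?case using assms(1)[of j] by simp
qed simp

lemma sum_eigenvalue_power:
  fixes A :: "real mat"
  assumes A: "\<And>a b. a < n \<Longrightarrow> b < n \<Longrightarrow> A $$ (a, b) = (\<Sum>c<n. d c * (u a c * u b c))"
    and u: "\<And>c c'. c < n \<Longrightarrow> c' < n \<Longrightarrow> (\<Sum>a<n. u a c * u a c') = of_bool (c = c')"
    and k: "0 < k"
  shows "(\<Sum>c<n. d c ^ k) = (\<Sum>i\<in>{..<k} \<rightarrow>\<^sub>E {..<n}. \<Prod>j<k. A $$ (i j, i (Suc j mod k)))"
proof -
  let ?s = "\<lambda>j. Suc j mod k" and ?W = "{..<k} \<rightarrow>\<^sub>E {..<n}"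
  let ?t = "inv_into {..<k} ?s"
  note s = bij_betw_cyclic_succ[OF k]
  note t = bij_betw_inv_into[OF s]
  have s_lt: "?s j < k" for j using k by simp
  have ts: "?t (?s j) = j" if "j < k" for j
    using s that by (metis bij_betw_inv_into_left lessThan_iff)
  have "(\<Sum>i\<in>?W. \<Prod>j<k. A $$ (i j, i (?s j))) =
      (\<Sum>i\<in>?W. \<Prod>j<k. \<Sum>c<n. d c * (u (i j) c * u (i (?s j)) c))"
    using s_lt by (intro sum.cong prod.cong refl A) (auto simp: PiE_def Pi_def)
  also have "\<dots> = (\<Sum>i\<in>?W. \<Sum>c\<in>?W. \<Prod>j<k. d (c j) * (u (i j) (c j) * u (i (?s j)) (c j)))"
    by (simp add: prod_sum_PiE)
  also have "\<dots> = (\<Sum>c\<in>?W. \<Sum>i\<in>?W. \<Prod>j<k. d (c j) * (u (i j) (c j) * u (i (?s j)) (c j)))"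
    by (rule sum.swap)
  also have "\<dots> = (\<Sum>c\<in>?W. (\<Prod>j<k. d (c j)) * (\<Prod>j<k. of_bool (c j = c (?s j))))"
  proof (rule sum.cong[OF refl])
    fix c assume c: "c \<in> ?W"
    have cn: "c j < n" if "j < k" for j using c that by (auto simp: PiE_def Pi_def)
    have "(\<Prod>j<k. u (i j) (c j) * u (i (?s j)) (c j)) = (\<Prod>j<k. u (i j) (c j) * u (i j) (c (?t j)))" for i
    proof -
      have "(\<Prod>j<k. u (i (?s j)) (c j)) = (\<Prod>j<k. u (i (?s j)) (c (?t (?s j))))"
        by (intro prod.cong) (auto simp: ts)
      also have "\<dots> = (\<Prod>j<k. u (i j) (c (?t j)))"
        by (rule prod.reindex_bij_betw[OF s])
      finally show ?thesis by (simp add: prod.distrib)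
    qed
    then have "(\<Sum>i\<in>?W. \<Prod>j<k. d (c j) * (u (i j) (c j) * u (i (?s j)) (c j))) =
        (\<Prod>j<k. d (c j)) * (\<Sum>i\<in>?W. \<Prod>j<k. u (i j) (c j) * u (i j) (c (?t j)))"
      by (simp only: prod.distrib[of "\<lambda>j. d (c j)"] sum_distrib_left)
    also have "(\<Sum>i\<in>?W. \<Prod>j<k. u (i j) (c j) * u (i j) (c (?t j))) =
        (\<Prod>j<k. \<Sum>a<n. u a (c j) * u a (c (?t j)))"
      by (simp add: prod_sum_PiE)
    also have "\<dots> = (\<Prod>j<k. of_bool (c j = c (?t j)))"
      using t cn by (intro prod.cong refl u) (auto simp: bij_betw_def)
    also have "\<dots> = (\<Prod>j<k. of_bool (c (?s j) = c (?t (?s j))))"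
      by (rule prod.reindex_bij_betw[OF s, symmetric])
    also have "\<dots> = (\<Prod>j<k. of_bool (c j = c (?s j)))"
      by (intro prod.cong) (auto simp: ts)
    finally show "(\<Sum>i\<in>?W. \<Prod>j<k. d (c j) * (u (i j) (c j) * u (i (?s j)) (c j))) =
        (\<Prod>j<k. d (c j)) * (\<Prod>j<k. of_bool (c j = c (?s j)))" .
  qed
  also have "\<dots> = (\<Sum>c\<in>(\<lambda>b. \<lambda>j\<in>{..<k}. b) ` {..<n}. \<Prod>j<k. d (c j))"
  proof (rule sum.mono_neutral_cong_right)
    show "(\<lambda>b. \<lambda>j\<in>{..<k}. b) ` {..<n} \<subseteq> ?W" by (auto simp: PiE_def extensional_def)
    show "\<forall>c\<in>?W - (\<lambda>b. \<lambda>j\<in>{..<k}. b) ` {..<n}.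
        (\<Prod>j<k. d (c j)) * (\<Prod>j<k. of_bool (c j = c (?s j))) = 0"
    proof
      fix c assume c: "c \<in> ?W - (\<lambda>b. \<lambda>j\<in>{..<k}. b) ` {..<n}"
      have "\<exists>j<k. c j \<noteq> c (?s j)"
      proof (rule ccontr)
        assume "\<not> ?thesis"
        then have eq: "c (?s j) = c j" if "j < k" for j using that by metis
        have eq0: "c j = c 0" if "j < k" for j by (rule cyclic_const[of k c j, OF eq that])
        have "c j = (\<lambda>j\<in>{..<k}. c 0) j" for j
          using eq0[of j] c by (cases "j < k") (simp_all add: PiE_def extensional_def)
        then have "c = (\<lambda>j\<in>{..<k}. c 0)" by (rule ext)
        moreover have "c 0 < n" using c k by auto
        ultimately show False using c by blast
      qed
      then show "(\<Prod>j<k. d (c j)) * (\<Prod>j<k. of_bool (c j = c (?s j))) = 0" by auto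
    qed
  qed (auto simp: finite_PiE s_lt)
  also have "\<dots> = (\<Sum>b<n. d b ^ k)"
  proof (subst sum.reindex)
    show "inj_on (\<lambda>b. \<lambda>j\<in>{..<k}. b) {..<n}"
      using k by (intro inj_onI) (metis lessThan_iff restrict_apply')
  qed simp
  finally show ?thesis ..
qed

lemma esd_moment:
  fixes A :: "real mat"
  assumes "A \<in> carrier_mat n n" and "transpose_mat A = A" and "0 < n"
  shows "integrable (esd A) (\<lambda>x. x ^ k)"
    and "0 < k \<Longrightarrow> (\<integral>x. x ^ k \<partial>esd A) =
      (\<Sum>i\<in>{..<k} \<rightarrow>\<^sub>E {..<n}. \<Prod>j<k. A $$ (i j, i (Suc j mod k))) / real n"
proof -
  obtain u d where *: "\<And>a b. a < n \<Longrightarrow> b < n \<Longrightarrow> A $$ (a, b) = (\<Sum>c<n. d c * (u a c * u b c))"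
    "\<And>c c'. c < n \<Longrightarrow> c' < n \<Longrightarrow> (\<Sum>a<n. u a c * u a c') = of_bool (c = c')"
    "proots (char_poly A) = image_mset d (mset_set {..<n})"
    by (rule real_symmetric_spectral_data[OF assms(1,2)]) blast
  show "integrable (esd A) (\<lambda>x. x ^ k)" by (rule esd_integral[OF *(3) assms(3)]) simp
  show "(\<integral>x. x ^ k \<partial>esd A) =
      (\<Sum>i\<in>{..<k} \<rightarrow>\<^sub>E {..<n}. \<Prod>j<k. A $$ (i j, i (Suc j mod k))) / real n" if "0 < k"
    using sum_eigenvalue_power[of n A d u, OF *(1,2) that] esd_integral(2)[OF *(3) assms(3), of "\<lambda>x. x ^ k"]
    by simp
qed

text \<open>
  A weak form of the Hoffman--Wielandt inequality.  If \<open>u\<close>, \<open>v\<close> are orthonormal eigenbases of \<open>A\<close>, \<open>B\<close>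
  with eigenvalues \<open>d\<close>, \<open>e\<close>, then \<open>p i j = (u\<^sub>i \<bullet> v\<^sub>j)\<^sup>2\<close> is doubly stochastic and couples the two
  spectra with transport cost \<open>\<Sum>i j. p i j * (d i - e j)\<^sup>2\<close> equal to the squared Frobenius distance.
\<close>

lemma esd_integral_diff_le:
  fixes A B :: "real mat" and f :: "real \<Rightarrow> 'b :: {banach, second_countable_topology}"
  assumes A: "A \<in> carrier_mat n n" "transpose_mat A = A"
    and B: "B \<in> carrier_mat n n" "transpose_mat B = B"
    and n: "0 < n" and f: "f \<in> borel_measurable borel"
    and L: "0 \<le> L" "\<And>x y. norm (f x - f y) \<le> L * \<bar>x - y\<bar>"
  shows "norm ((\<integral>x. f x \<partial>esd A) - (\<integral>x. f x \<partial>esd B))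
    \<le> L * sqrt ((\<Sum>a<n. \<Sum>b<n. (A $$ (a, b) - B $$ (a, b))\<^sup>2) / real n)"
proof -
  obtain u d where u: "\<And>a b. a < n \<Longrightarrow> b < n \<Longrightarrow> A $$ (a, b) = (\<Sum>c<n. d c * (u a c * u b c))"
    "\<And>c c'. c < n \<Longrightarrow> c' < n \<Longrightarrow> (\<Sum>a<n. u a c * u a c') = of_bool (c = c')"
    "\<And>a b. a < n \<Longrightarrow> b < n \<Longrightarrow> (\<Sum>c<n. u a c * u b c) = of_bool (a = b)"
    "proots (char_poly A) = image_mset d (mset_set {..<n})"
    by (rule real_symmetric_spectral_data[OF A]) blast
  obtain v e where v: "\<And>a b. a < n \<Longrightarrow> b < n \<Longrightarrow> B $$ (a, b) = (\<Sum>c<n. e c * (v a c * v b c))"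
    "\<And>c c'. c < n \<Longrightarrow> c' < n \<Longrightarrow> (\<Sum>a<n. v a c * v a c') = of_bool (c = c')"
    "\<And>a b. a < n \<Longrightarrow> b < n \<Longrightarrow> (\<Sum>c<n. v a c * v b c) = of_bool (a = b)"
    "proots (char_poly B) = image_mset e (mset_set {..<n})"
    by (rule real_symmetric_spectral_data[OF B]) blast
  define q where "q i j = (\<Sum>a<n. u a i * v a j)" for i j
  define p where "p i j = (q i j)\<^sup>2" for i j
  define C where "C a b = A $$ (a, b) - B $$ (a, b)" for a b
  have bilinear: "(\<Sum>i<n. (\<Sum>a<n. w a i * x a) * (\<Sum>a<n. w a i * y a)) = (\<Sum>a<n. x a * y a)"
    if "\<And>a b. a < n \<Longrightarrow> b < n \<Longrightarrow> (\<Sum>c<n. w a c * w b c) = of_bool (a = b)"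
    for w :: "nat \<Rightarrow> nat \<Rightarrow> real" and x y
  proof -
    have "(\<Sum>i<n. (\<Sum>a<n. w a i * x a) * (\<Sum>a<n. w a i * y a)) =
        (\<Sum>i<n. \<Sum>a<n. \<Sum>b<n. x a * y b * (w a i * w b i))"
      by (simp add: sum_product algebra_simps)
    also have "\<dots> = (\<Sum>a<n. \<Sum>b<n. \<Sum>i<n. x a * y b * (w a i * w b i))"
      by (rule trans[OF sum.swap], rule sum.cong[OF refl], rule sum.swap)
    also have "\<dots> = (\<Sum>a<n. \<Sum>b<n. x a * y b * of_bool (a = b))"
      by (intro sum.cong refl) (simp add: that flip: sum_distrib_left)
    also have "\<dots> = (\<Sum>a<n. x a * y a)" by (intro sum.cong refl) (simp add: of_bool_def if_distrib cong: if_cong)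
    finally show ?thesis .
  qed
  have p0: "0 \<le> p i j" for i j by (simp add: p_def)
  have p1: "(\<Sum>i<n. p i j) = 1" if "j < n" for j
    using bilinear[OF u(3), of "\<lambda>a. v a j" "\<lambda>a. v a j"] v(2)[OF that that]
    by (simp add: p_def q_def power2_eq_square)
  have p2: "(\<Sum>j<n. p i j) = 1" if "i < n" for i
    using bilinear[OF v(3), of "\<lambda>a. u a i" "\<lambda>a. u a i"] u(2)[OF that that]
    by (simp add: p_def q_def power2_eq_square mult.commute)
  have Au: "(\<Sum>a<n. u a i * A $$ (a, b)) = d i * u b i" if ib: "i < n" "b < n" for i b
  proof -
    have "(\<Sum>a<n. u a i * A $$ (a, b)) = (\<Sum>a<n. \<Sum>c<n. d c * u b c * (u a i * u a c))"
      using ib by (intro sum.cong refl) (simp add: u(1) sum_distrib_left algebra_simps)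
    also have "\<dots> = (\<Sum>c<n. d c * u b c * (\<Sum>a<n. u a i * u a c))"
      by (subst sum.swap) (simp add: sum_distrib_left)
    also have "\<dots> = (\<Sum>c<n. d c * u b c * of_bool (i = c))" using ib by (intro sum.cong refl) (simp add: u(2))
    also have "\<dots> = d i * u b i" using ib by (simp add: of_bool_def if_distrib cong: if_cong)
    finally show ?thesis .
  qed
  have Bv: "(\<Sum>b<n. B $$ (a, b) * v b j) = e j * v a j" if ja: "j < n" "a < n" for j a
  proof -
    have "(\<Sum>b<n. B $$ (a, b) * v b j) = (\<Sum>b<n. \<Sum>c<n. e c * v a c * (v b c * v b j))"
      using ja by (intro sum.cong refl) (simp add: v(1) sum_distrib_left algebra_simps)
    also have "\<dots> = (\<Sum>c<n. e c * v a c * (\<Sum>b<n. v b c * v b j))"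
      by (subst sum.swap) (simp add: sum_distrib_left)
    also have "\<dots> = (\<Sum>c<n. e c * v a c * of_bool (c = j))" using ja by (intro sum.cong refl) (simp add: v(2))
    also have "\<dots> = e j * v a j" using ja by (simp add: of_bool_def if_distrib cong: if_cong)
    finally show ?thesis .
  qed
  have uCv: "(\<Sum>b<n. v b j * (\<Sum>a<n. u a i * C a b)) = (d i - e j) * q i j" if "i < n" "j < n" for i j
  proof -
    have "(\<Sum>b<n. v b j * (\<Sum>a<n. u a i * C a b)) =
        (\<Sum>b<n. v b j * (\<Sum>a<n. u a i * A $$ (a, b))) - (\<Sum>b<n. v b j * (\<Sum>a<n. u a i * B $$ (a, b)))"
      by (simp add: C_def algebra_simps sum_subtractf)
    also have "(\<Sum>b<n. v b j * (\<Sum>a<n. u a i * A $$ (a, b))) = d i * q i j"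
      unfolding q_def sum_distrib_left[of "d i"] using that by (intro sum.cong refl) (simp add: Au)
    also have "(\<Sum>b<n. v b j * (\<Sum>a<n. u a i * B $$ (a, b))) = (\<Sum>a<n. u a i * (\<Sum>b<n. B $$ (a, b) * v b j))"
      by (simp add: sum_distrib_left, subst sum.swap) (simp add: algebra_simps)
    also have "\<dots> = e j * q i j"
      unfolding q_def sum_distrib_left[of "e j"] using that by (intro sum.cong refl) (simp add: Bv)
    finally show ?thesis by (simp add: algebra_simps)
  qed
  have frob: "(\<Sum>i<n. \<Sum>j<n. p i j * (d i - e j)\<^sup>2) = (\<Sum>a<n. \<Sum>b<n. (C a b)\<^sup>2)"
  proof -
    have "(\<Sum>i<n. \<Sum>j<n. p i j * (d i - e j)\<^sup>2) =
        (\<Sum>i<n. \<Sum>j<n. ((d i - e j) * q i j) * ((d i - e j) * q i j))"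
      by (simp add: p_def power2_eq_square mult_ac)
    also have "\<dots> = (\<Sum>i<n. \<Sum>j<n. (\<Sum>b<n. v b j * (\<Sum>a<n. u a i * C a b)) * (\<Sum>b<n. v b j * (\<Sum>a<n. u a i * C a b)))"
      by (intro sum.cong refl) (simp add: uCv)
    also have "\<dots> = (\<Sum>i<n. \<Sum>b<n. (\<Sum>a<n. u a i * C a b) * (\<Sum>a<n. u a i * C a b))"
      by (simp add: bilinear[OF v(3)])
    also have "\<dots> = (\<Sum>b<n. \<Sum>i<n. (\<Sum>a<n. u a i * C a b) * (\<Sum>a<n. u a i * C a b))"
      by (rule sum.swap)
    also have "\<dots> = (\<Sum>b<n. \<Sum>a<n. C a b * C a b)"
      by (simp add: bilinear[OF u(3)])
    also have "\<dots> = (\<Sum>a<n. \<Sum>b<n. (C a b)\<^sup>2)" by (subst sum.swap) (simp add: power2_eq_square)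
    finally show ?thesis .
  qed
  have "(\<Sum>i<n. f (d i)) - (\<Sum>j<n. f (e j)) = (\<Sum>i<n. \<Sum>j<n. p i j *\<^sub>R (f (d i) - f (e j)))"
  proof -
    have "(\<Sum>i<n. f (d i)) = (\<Sum>i<n. \<Sum>j<n. p i j *\<^sub>R f (d i))"
      by (intro sum.cong refl) (simp add: p2 flip: scaleR_sum_left)
    moreover have "(\<Sum>j<n. f (e j)) = (\<Sum>i<n. \<Sum>j<n. p i j *\<^sub>R f (e j))"
      by (subst sum.swap, intro sum.cong refl) (simp add: p1 flip: scaleR_sum_left)
    ultimately show ?thesis by (simp add: sum_subtractf scaleR_right_diff_distrib)
  qed
  then have "norm ((\<Sum>i<n. f (d i)) - (\<Sum>j<n. f (e j))) \<le> (\<Sum>i<n. \<Sum>j<n. p i j * (L * \<bar>d i - e j\<bar>))"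
    using p0 L(2) by (simp only:, intro sum_norm_le) (simp add: mult_left_mono)
  also have "\<dots> = L * (\<Sum>(i,j)\<in>{..<n}\<times>{..<n}. p i j * \<bar>d i - e j\<bar>)"
    by (simp add: sum.cartesian_product[symmetric] sum_distrib_left algebra_simps)
  also have "(\<Sum>(i,j)\<in>{..<n}\<times>{..<n}. p i j * \<bar>d i - e j\<bar>)
      \<le> sqrt (real n) * sqrt (\<Sum>a<n. \<Sum>b<n. (C a b)\<^sup>2)"
  proof -
    have "(\<Sum>z\<in>{..<n}\<times>{..<n}. \<bar>sqrt (case z of (i,j) \<Rightarrow> p i j)\<bar> * \<bar>case z of (i,j) \<Rightarrow> sqrt (p i j) * (d i - e j)\<bar>)
      \<le> L2_set (\<lambda>z. sqrt (case z of (i,j) \<Rightarrow> p i j)) ({..<n}\<times>{..<n}) *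
        L2_set (\<lambda>z. case z of (i,j) \<Rightarrow> sqrt (p i j) * (d i - e j)) ({..<n}\<times>{..<n})"
      by (rule L2_set_mult_ineq)
    moreover have "(\<Sum>z\<in>{..<n}\<times>{..<n}. \<bar>sqrt (case z of (i,j) \<Rightarrow> p i j)\<bar> * \<bar>case z of (i,j) \<Rightarrow> sqrt (p i j) * (d i - e j)\<bar>)
      = (\<Sum>(i,j)\<in>{..<n}\<times>{..<n}. p i j * \<bar>d i - e j\<bar>)"
      using p0 by (intro sum.cong refl) (auto simp: abs_mult simp flip: mult.assoc)
    moreover have "L2_set (\<lambda>z. sqrt (case z of (i,j) \<Rightarrow> p i j)) ({..<n}\<times>{..<n}) = sqrt (real n)"
    proof -
      have "(\<Sum>z\<in>{..<n}\<times>{..<n}. (sqrt (case z of (i,j) \<Rightarrow> p i j))\<^sup>2) = (\<Sum>(i,j)\<in>{..<n}\<times>{..<n}. p i j)"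
        using p0 by (intro sum.cong) auto
      also have "\<dots> = real n" by (simp add: sum.cartesian_product[symmetric] p2)
      finally show ?thesis by (simp add: L2_set_def)
    qed
    moreover have "L2_set (\<lambda>z. case z of (i,j) \<Rightarrow> sqrt (p i j) * (d i - e j)) ({..<n}\<times>{..<n})
        = sqrt (\<Sum>a<n. \<Sum>b<n. (C a b)\<^sup>2)"
    proof -
      have "(\<Sum>z\<in>{..<n}\<times>{..<n}. (case z of (i,j) \<Rightarrow> sqrt (p i j) * (d i - e j))\<^sup>2) =
          (\<Sum>(i,j)\<in>{..<n}\<times>{..<n}. p i j * (d i - e j)\<^sup>2)"
        using p0 by (intro sum.cong) (auto simp: power_mult_distrib)
      then show ?thesis by (simp add: L2_set_def sum.cartesian_product[symmetric] frob)
    qed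
    ultimately show ?thesis by simp
  qed
  finally have main: "norm ((\<Sum>i<n. f (d i)) - (\<Sum>j<n. f (e j)))
      \<le> L * (sqrt (real n) * sqrt (\<Sum>a<n. \<Sum>b<n. (C a b)\<^sup>2))" using L(1) by (simp add: mult_left_mono)
  have "(\<integral>x. f x \<partial>esd A) - (\<integral>x. f x \<partial>esd B) = (1 / real n) *\<^sub>R ((\<Sum>i<n. f (d i)) - (\<Sum>j<n. f (e j)))"
    by (simp add: esd_integral(2)[OF u(4) n f] esd_integral(2)[OF v(4) n f] scaleR_right_diff_distrib)
  then have "norm ((\<integral>x. f x \<partial>esd A) - (\<integral>x. f x \<partial>esd B)) =
      norm ((\<Sum>i<n. f (d i)) - (\<Sum>j<n. f (e j))) / real n" by simp
  also have "\<dots> \<le> L * (sqrt (real n) * sqrt (\<Sum>a<n. \<Sum>b<n. (C a b)\<^sup>2)) / real n"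
    using main by (rule divide_right_mono) simp
  also have "\<dots> = L * sqrt ((\<Sum>a<n. \<Sum>b<n. (C a b)\<^sup>2) / real n)"
  proof -
    have "sqrt (real n) / real n = 1 / sqrt (real n)"
      using n by (simp add: divide_simps)
    moreover have "L * (sqrt (real n) * S) / real n = L * S * (sqrt (real n) / real n)" for S by simp
    ultimately show ?thesis by (simp only:) (simp add: real_sqrt_divide)
  qed
  finally show ?thesis by (simp add: C_def)
qed

subsection \<open>The moment problem under Carleman's condition\<close>

lemma carleman_inequality_partial:
  fixes a :: "nat \<Rightarrow> real"
  assumes a: "\<And>n. 0 \<le> a n"
  shows "(\<Sum>n<N. (\<Prod>j\<le>n. a j) powr (1 / real (Suc n))) \<le> exp 1 * (\<Sum>j<N. a j)"
proof -
  define c where "c j = real (j + 2) ^ Suc j / real (j + 1) ^ j" for j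
  have c0: "0 < c j" for j by (simp add: c_def)
  have prod_c: "(\<Prod>j\<le>n. c j) = real (n + 2) ^ Suc n" for n
  proof (induction n)
    case 0 show ?case by (simp add: c_def)
  next
    case (Suc n)
    have "(\<Prod>j\<le>Suc n. c j) = real (n + 2) ^ Suc n * c (Suc n)" by (simp add: Suc)
    also have "\<dots> = real (Suc n + 2) ^ Suc (Suc n)"
    proof -
      have "real (Suc n + 1) = real (n + 2)" and ne: "real (n + 2) ^ Suc n \<noteq> 0" by simp_all
      then show ?thesis
        by (simp only: c_def times_divide_eq_right nonzero_mult_div_cancel_left[OF ne])
    qed
    finally show ?case .
  qed
  have ce: "c j / real (Suc j) \<le> exp 1" for j
  proof -
    have "c j / real (Suc j) = (real (j + 2) / real (Suc j)) ^ Suc j"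
      by (simp add: c_def power_divide algebra_simps)
    also have "real (j + 2) / real (Suc j) = 1 + 1 / real (Suc j)" by (simp add: field_simps)
    also have "(1 + 1 / real (Suc j)) ^ Suc j \<le> exp (1 / real (Suc j)) ^ Suc j"
      by (intro power_mono exp_ge_add_one_self) auto
    also have "\<dots> = exp 1" by (simp only: exp_of_nat_mult[symmetric]) simp
    finally show ?thesis .
  qed
  have amgm: "(\<Prod>j\<le>n. a j) powr (1 / real (Suc n)) \<le>
      (\<Sum>j\<le>n. a j * c j * (1 / real (Suc n) - 1 / real (n + 2)))" for n
  proof -
    have "(\<Prod>j\<in>{..n}. a j * c j) powr (1 / card {..n}) \<le> (\<Sum>j\<in>{..n}. a j * c j / card {..n})"
      by (rule arith_geom_mean) (use a c0 in \<open>auto simp: less_imp_le\<close>)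
    then have *: "(\<Prod>j\<le>n. a j * c j) powr (1 / real (Suc n)) \<le> (\<Sum>j\<le>n. a j * c j) / real (Suc n)"
      by (simp add: sum_divide_distrib)
    have "real (n + 2) ^ Suc n = real (n + 2) powr real (Suc n)" by (subst powr_realpow) auto
    then have "(real (n + 2) ^ Suc n) powr (1 / real (Suc n)) = real (n + 2)"
      by (simp only: powr_powr) simp
    then have "(\<Prod>j\<le>n. a j * c j) powr (1 / real (Suc n)) = (\<Prod>j\<le>n. a j) powr (1 / real (Suc n)) * real (n + 2)"
      using a by (simp only: prod.distrib prod_c powr_mult prod_nonneg)
    then have "(\<Prod>j\<le>n. a j) powr (1 / real (Suc n)) * real (n + 2) \<le> (\<Sum>j\<le>n. a j * c j) / real (Suc n)"
      using * by simp
    then have "(\<Prod>j\<le>n. a j) powr (1 / real (Suc n)) \<le> (\<Sum>j\<le>n. a j * c j) / real (Suc n) / real (n + 2)"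
      by (subst pos_le_divide_eq) auto
    also have "\<dots> = (\<Sum>j\<le>n. a j * c j * (1 / real (Suc n) - 1 / real (n + 2)))"
    proof -
      have "S / real (Suc n) / real (n + 2) = S * (1 / real (Suc n) - 1 / real (n + 2))" for S
        by (simp add: field_simps)
      then show ?thesis by (simp only: sum_distrib_right)
    qed
    finally show ?thesis .
  qed
  have "(\<Sum>n<N. (\<Prod>j\<le>n. a j) powr (1 / real (Suc n))) \<le>
      (\<Sum>n<N. \<Sum>j\<le>n. a j * c j * (1 / real (Suc n) - 1 / real (n + 2)))"
    by (intro sum_mono amgm)
  also have "\<dots> = (\<Sum>j<N. a j * c j * (1 / real (Suc j) - 1 / real (N + 1)))"
  proof (induction N)
    case (Suc N)
    have "(\<Sum>j<Suc N. a j * c j * (1 / real (Suc j) - 1 / real (Suc N + 1))) =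
      (\<Sum>j<Suc N. a j * c j * (1 / real (Suc j) - 1 / real (N + 1)) + a j * c j * (1 / real (N + 1) - 1 / real (Suc N + 1)))"
      by (intro sum.cong refl) (simp add: algebra_simps)
    also have "\<dots> = (\<Sum>j<N. a j * c j * (1 / real (Suc j) - 1 / real (N + 1))) +
        (\<Sum>j\<le>N. a j * c j * (1 / real (N + 1) - 1 / real (Suc N + 1)))"
      by (simp add: sum.distrib lessThan_Suc_atMost[symmetric])
    finally show ?case using Suc by (simp add: add.commute)
  qed simp
  also have "\<dots> \<le> (\<Sum>j<N. exp 1 * a j)"
  proof (rule sum_mono)
    fix j
    have "a j * c j * (1 / real (Suc j) - 1 / real (N + 1)) \<le> a j * c j * (1 / real (Suc j))"
      using a[of j] c0[of j] by (intro mult_left_mono) auto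
    also have "\<dots> = a j * (c j / real (Suc j))" by simp
    also have "\<dots> \<le> a j * exp 1" using a ce by (intro mult_left_mono)
    finally show "a j * c j * (1 / real (Suc j) - 1 / real (N + 1)) \<le> exp 1 * a j" by (simp add: mult.commute)
  qed
  finally show ?thesis by (simp add: sum_distrib_left)
qed

lemma summable_geometric_means:
  fixes a :: "nat \<Rightarrow> real"
  assumes a: "\<And>n. 0 \<le> a n" and "summable a"
  shows "summable (\<lambda>n. (\<Prod>j\<le>n. a j) powr (1 / real (Suc n)))"
proof (rule summableI_nonneg_bounded)
  fix N
  have "(\<Sum>n<N. (\<Prod>j\<le>n. a j) powr (1 / real (Suc n))) \<le> exp 1 * (\<Sum>j<N. a j)"
    by (rule carleman_inequality_partial[OF a])
  also have "\<dots> \<le> exp 1 * suminf a"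
    using assms by (intro mult_left_mono sum_le_suminf) auto
  finally show "(\<Sum>n<N. (\<Prod>j\<le>n. a j) powr (1 / real (Suc n))) \<le> exp 1 * suminf a" .
qed simp

lemma sum_exp_le:
  fixes x :: real assumes "0 \<le> x" shows "(\<Sum>i\<le>m. x ^ i / fact i) \<le> exp x"
proof -
  have s: "(\<lambda>i. x ^ i /\<^sub>R fact i) sums exp x" by (rule exp_converges)
  have "(\<Sum>i\<le>m. x ^ i /\<^sub>R fact i) \<le> exp x"
    unfolding sums_unique[OF s] using assms s by (intro sum_le_suminf) (auto simp: sums_iff)
  then show ?thesis by (simp add: divide_inverse mult.commute)
qed

text \<open>
  Bang's elementary proof of the Denjoy--Carleman theorem.  Call a point \<open>t\<close> of level \<open>N\<close> if
  \<open>\<bar>F n t\<bar> \<le> e\<^sup>n\<^sup>-\<^sup>N M n\<close> for all \<open>n\<close> (automatic for \<open>n \<ge> N\<close>).  Taylor expansion to order \<open>N\<close> shows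
  that a step of length \<open>M (N - 1) / (e M N)\<close> loses at most one level, and the steps add up to
  infinity.  The functions \<open>F n\<close> play the role of derivatives only through their Taylor formula.
\<close>

lemma bang_quasi_analytic:
  fixes F :: "nat \<Rightarrow> real \<Rightarrow> complex" and M :: "nat \<Rightarrow> real"
  assumes M0: "\<And>n. 0 < M n"
    and convex: "\<And>n. (M (Suc n))\<^sup>2 \<le> M n * M (Suc (Suc n))"
    and bound: "\<And>n t. norm (F n t) \<le> M n"
    and taylor: "\<And>j m t h. 0 < m \<Longrightarrow>
      norm (F j (t + h) - (\<Sum>i<m. complex_of_real (h ^ i / fact i) * F (i + j) t)) \<le> M (m + j) * \<bar>h\<bar> ^ m / fact m"
    and flat: "\<And>n. F n 0 = 0"
    and div: "\<not> summable (\<lambda>n. M n / M (Suc n))"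
  shows "F 0 t = 0"
proof -
  define r where "r n = M (Suc n) / M n" for n
  have r0: "0 < r n" for n using M0 by (simp add: r_def)
  have "r n \<le> r (Suc n)" for n
    using convex[of n] M0[of n] M0[of "Suc n"] by (simp add: r_def field_simps power2_eq_square)
  then have r_mono: "r m \<le> r n" if "m \<le> n" for m n using that by (rule lift_Suc_mono_le)
  have M_le: "M (i + j) \<le> M j * r n ^ i" if "i + j \<le> Suc n" for i j n
    using that
  proof (induction i)
    case (Suc i)
    have "M (Suc i + j) = M (i + j) * r (i + j)" using M0[of "i + j"] by (simp add: r_def)
    also have "\<dots> \<le> M j * r n ^ i * r n"
      using Suc r0 M0 by (intro mult_mono Suc.IH r_mono) (auto simp: less_imp_le)
    finally show ?case by (simp add: mult_ac)
  qed simp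
  define P where "P N t \<longleftrightarrow> (\<forall>n. norm (F n t) \<le> exp (real n - real N) * M n)" for N t
  have step: "P N (t + h)" if P: "P (Suc N) t" and h: "\<bar>h\<bar> \<le> M N / (exp 1 * M (Suc N))" for N t h
    unfolding P_def
  proof
    fix j
    show "norm (F j (t + h)) \<le> exp (real j - real N) * M j"
    proof (cases "j \<le> N")
      case False
      then have "1 * M j \<le> exp (real j - real N) * M j" using M0[of j] by (intro mult_right_mono) auto
      then show ?thesis using bound[of j "t + h"] by simp
    next
      case True
      define m where "m = Suc N - j"
      have m: "0 < m" "m + j = Suc N" using True by (auto simp: m_def)
      define y where "y = exp 1 * \<bar>h\<bar> * r N"
      have y0: "0 \<le> y" using r0[of N] by (simp add: y_def)
      have y1: "y \<le> 1"
        using h M0[of N] M0[of "Suc N"] by (simp add: y_def r_def field_simps)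
      let ?E = "exp (real j - real (Suc N)) * M j"
      have E0: "0 \<le> ?E" using M0[of j] by simp
      have pw: "exp (real (i + j) - real (Suc N)) * M (i + j) * (\<bar>h\<bar> ^ i / fact i) \<le> ?E * (y ^ i / fact i)"
        if "i \<le> m" for i
      proof -
        have "exp (real (i + j) - real (Suc N)) * M (i + j) * (\<bar>h\<bar> ^ i / fact i) \<le>
            exp (real (i + j) - real (Suc N)) * (M j * r N ^ i) * (\<bar>h\<bar> ^ i / fact i)"
          using that m by (intro mult_left_mono mult_right_mono M_le) auto
        also have "\<dots> = ?E * (y ^ i / fact i)"
        proof -
          have "exp (real (i + j) - real (Suc N)) = exp (real j - real (Suc N)) * exp 1 ^ i"
            by (simp add: exp_diff exp_add field_simps flip: exp_of_nat_mult)
          then show ?thesis by (simp only:) (simp add: y_def power_mult_distrib mult_ac)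
        qed
        finally show ?thesis .
      qed
      have "norm (F j (t + h)) \<le> norm (\<Sum>i<m. complex_of_real (h ^ i / fact i) * F (i + j) t) + M (m + j) * \<bar>h\<bar> ^ m / fact m"
        using taylor[OF m(1), of j t h] norm_triangle_sub[of "F j (t + h)" "(\<Sum>i<m. complex_of_real (h ^ i / fact i) * F (i + j) t)"]
        by linarith
      also have "norm (\<Sum>i<m. complex_of_real (h ^ i / fact i) * F (i + j) t) \<le> (\<Sum>i<m. ?E * (y ^ i / fact i))"
      proof (rule sum_norm_le)
        fix i assume "i \<in> {..<m}"
        then have im: "i \<le> m" by simp
        have "norm (complex_of_real (h ^ i / fact i) * F (i + j) t) = norm (F (i + j) t) * (\<bar>h\<bar> ^ i / fact i)"
          by (simp add: norm_mult norm_divide norm_power power_abs del: of_real_power of_real_divide)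
        also have "\<dots> \<le> exp (real (i + j) - real (Suc N)) * M (i + j) * (\<bar>h\<bar> ^ i / fact i)"
          by (intro mult_right_mono P[unfolded P_def, rule_format]) auto
        also have "\<dots> \<le> ?E * (y ^ i / fact i)" by (rule pw[OF im])
        finally show "norm (complex_of_real (h ^ i / fact i) * F (i + j) t) \<le> ?E * (y ^ i / fact i)" .
      qed
      also have "M (m + j) * \<bar>h\<bar> ^ m / fact m \<le> ?E * (y ^ m / fact m)"
        using pw[of m] m(2) by simp
      also have "(\<Sum>i<m. ?E * (y ^ i / fact i)) + ?E * (y ^ m / fact m) = ?E * (\<Sum>i\<le>m. y ^ i / fact i)"
        by (simp add: sum_distrib_left distrib_left lessThan_Suc_atMost[symmetric])
      also have "\<dots> \<le> ?E * exp 1"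
      proof (rule mult_left_mono[OF _ E0])
        have "(\<Sum>i\<le>m. y ^ i / fact i) \<le> exp y" by (rule sum_exp_le[OF y0])
        also have "\<dots> \<le> exp 1" using y1 by simp
        finally show "(\<Sum>i\<le>m. y ^ i / fact i) \<le> exp 1" .
      qed
      also have "\<dots> = exp (real j - real N) * M j" by (simp add: exp_diff exp_add field_simps)
      finally show ?thesis by simp
    qed
  qed
  have chain: "P N (t + h)" if "P (N + d) t" "\<bar>h\<bar> \<le> (\<Sum>n<d. M (N + n) / (exp 1 * M (Suc (N + n))))" for N d t h
    using that
  proof (induction d arbitrary: t h)
    case (Suc d)
    let ?\<rho> = "M (N + d) / (exp 1 * M (Suc (N + d)))" and ?S = "\<Sum>n<d. M (N + n) / (exp 1 * M (Suc (N + n)))"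
    have \<rho>0: "0 \<le> ?\<rho>" and S0: "0 \<le> ?S" using M0 by (auto intro!: sum_nonneg simp: less_imp_le)
    have "\<bar>h\<bar> \<le> ?S + ?\<rho>" using Suc.prems(2) by simp
    then obtain h1 h2 where h: "h = h1 + h2" "\<bar>h1\<bar> \<le> ?\<rho>" "\<bar>h2\<bar> \<le> ?S"
    proof (cases "\<bar>h\<bar> \<le> ?\<rho>")
      case True then show ?thesis using that[of h 0] S0 by simp
    next
      case False
      then show ?thesis using that[of "sgn h * ?\<rho>" "h - sgn h * ?\<rho>"] \<open>\<bar>h\<bar> \<le> ?S + ?\<rho>\<close> \<rho>0
        by (cases "h > 0"; cases "h = 0") auto
    qed
    have "P (N + d) (t + h1)" using Suc.prems(1) h(2) by (intro step) auto
    then have "P N (t + h1 + h2)" by (rule Suc.IH) (fact h(3))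
    then show ?case by (simp add: h(1) add.assoc)
  qed simp
  have PN: "P N t" for N
  proof -
    have P0: "P K 0" for K using flat M0 by (simp add: P_def less_imp_le)
    have "\<not> summable (\<lambda>n. M (n + N) / M (Suc (n + N)))"
      using div summable_iff_shift[of "\<lambda>n. M n / M (Suc n)" N] by simp
    then have "\<not> (\<forall>d. (\<Sum>n<d. M (n + N) / M (Suc (n + N))) \<le> exp 1 * \<bar>t\<bar>)"
      using M0 by (metis (no_types, lifting) summableI_nonneg_bounded divide_nonneg_nonneg less_imp_le)
    then obtain d where "exp 1 * \<bar>t\<bar> < (\<Sum>n<d. M (n + N) / M (Suc (n + N)))"
      by (auto simp: not_le)
    then have "\<bar>t\<bar> \<le> (\<Sum>n<d. M (n + N) / M (Suc (n + N))) / exp 1"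
      by (simp add: field_simps)
    also have "\<dots> = (\<Sum>n<d. M (N + n) / (exp 1 * M (Suc (N + n))))"
      by (simp add: sum_divide_distrib add.commute mult.commute)
    finally show ?thesis using chain[OF P0, of t N d] by simp
  qed
  have "norm (F 0 t) \<le> exp (- real N) * M 0" for N using PN[of N, unfolded P_def, rule_format, of 0] by simp
  moreover have "(\<lambda>N. exp (- real N) * M 0) \<longlonglongrightarrow> 0" by real_asymp
  ultimately have "norm (F 0 t) \<le> 0" by (intro LIMSEQ_le_const[OF \<open>(\<lambda>N. exp (- real N) * M 0) \<longlonglongrightarrow> 0\<close>]) blast
  then show ?thesis by simp
qed

lemma integrable_abs_power:
  fixes \<mu> :: "real measure"
  assumes "integrable \<mu> (\<lambda>x. x ^ n)"
  shows "integrable \<mu> (\<lambda>x. \<bar>x\<bar> ^ n)"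
  using integrable_abs[OF assms] by (simp add: power_abs)

lemma abs_moment_log_convex:
  fixes \<mu> \<nu> :: "real measure"
  assumes \<mu>: "\<And>n. integrable \<mu> (\<lambda>x. x ^ n)" and \<nu>: "\<And>n. integrable \<nu> (\<lambda>x. x ^ n)"
  defines "M \<equiv> \<lambda>n. (\<integral>x. \<bar>x\<bar> ^ n \<partial>\<mu>) + (\<integral>x. \<bar>x\<bar> ^ n \<partial>\<nu>)"
  assumes pos: "0 < M (Suc (Suc n))"
  shows "(M (Suc n))\<^sup>2 \<le> M n * M (Suc (Suc n))"
proof -
  note i = integrable_abs_power[OF \<mu>] integrable_abs_power[OF \<nu>]
  have quad: "0 \<le> s\<^sup>2 * M (Suc (Suc n)) - 2 * s * M (Suc n) + M n" for s
  proof -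
    have "s\<^sup>2 * (\<integral>x. \<bar>x\<bar> ^ Suc (Suc n) \<partial>\<xi>) - 2 * s * (\<integral>x. \<bar>x\<bar> ^ Suc n \<partial>\<xi>) + (\<integral>x. \<bar>x\<bar> ^ n \<partial>\<xi>) \<ge> 0"
      if i: "\<And>n. integrable \<xi> (\<lambda>x. \<bar>x\<bar> ^ n)" for \<xi> :: "real measure"
    proof -
      have "0 \<le> (\<integral>x. \<bar>x\<bar> ^ n * (s * \<bar>x\<bar> - 1)\<^sup>2 \<partial>\<xi>)" by simp
      also have "(\<lambda>x. \<bar>x\<bar> ^ n * (s * \<bar>x\<bar> - 1)\<^sup>2) =
          (\<lambda>x. s\<^sup>2 * \<bar>x\<bar> ^ Suc (Suc n) - 2 * s * \<bar>x\<bar> ^ Suc n + \<bar>x\<bar> ^ n)"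
        by (rule ext) (simp only: power2_eq_square power_Suc, simp add: algebra_simps)
      also have "(\<integral>x. s\<^sup>2 * \<bar>x\<bar> ^ Suc (Suc n) - 2 * s * \<bar>x\<bar> ^ Suc n + \<bar>x\<bar> ^ n \<partial>\<xi>) =
         s\<^sup>2 * (\<integral>x. \<bar>x\<bar> ^ Suc (Suc n) \<partial>\<xi>) - 2 * s * (\<integral>x. \<bar>x\<bar> ^ Suc n \<partial>\<xi>) + (\<integral>x. \<bar>x\<bar> ^ n \<partial>\<xi>)"
        by (simp only: Bochner_Integration.integral_add Bochner_Integration.integral_diff
            Bochner_Integration.integrable_diff integrable_mult_right integral_mult_right_zero i)
      finally show ?thesis .
    qed
    from this[of \<mu>, OF i(1)] this[of \<nu>, OF i(2)] show ?thesis
      by (simp add: M_def algebra_simps)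
  qed
  let ?s = "M (Suc n) / M (Suc (Suc n))"
  have "?s\<^sup>2 * M (Suc (Suc n)) - 2 * ?s * M (Suc n) + M n = M n - (M (Suc n))\<^sup>2 / M (Suc (Suc n))"
    using pos by (simp add: power2_eq_square field_simps)
  then have "(M (Suc n))\<^sup>2 / M (Suc (Suc n)) \<le> M n" using quad[of ?s] by simp
  then show ?thesis using pos by (simp add: pos_divide_le_eq)
qed

lemma char_eq_of_zero_moment:
  assumes "real_distribution \<mu>" and "integrable \<mu> (\<lambda>x. x ^ (2 * k))" and "(\<integral>x. x ^ (2 * k) \<partial>\<mu>) = 0" and "0 < k"
  shows "char \<mu> t = 1"
proof -
  interpret real_distribution \<mu> by fact
  have "AE x in \<mu>. x ^ (2 * k) = 0"
    using assms(2,3) by (subst (asm) integral_nonneg_eq_0_iff_AE) auto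
  then have "AE x in \<mu>. iexp (t * x) = 1"
  proof eventually_elim
    case (elim x)
    then show ?case using assms(4) by simp
  qed
  then have "char \<mu> t = (CLINT x|\<mu>. 1)" unfolding char_def by (intro integral_cong_AE) auto
  then show ?thesis using prob_space by simp
qed

theorem carleman_moment_unique:
  assumes \<mu>: "real_distribution \<mu>" "\<And>n. integrable \<mu> (\<lambda>x. x ^ n)"
    and \<nu>: "real_distribution \<nu>" "\<And>n. integrable \<nu> (\<lambda>x. x ^ n)"
    and eq: "\<And>n. (\<integral>x. x ^ n \<partial>\<mu>) = (\<integral>x. x ^ n \<partial>\<nu>)"
    and carl: "carleman (\<lambda>n. \<integral>x. x ^ n \<partial>\<mu>)"
  shows "\<mu> = \<nu>"
proof (rule Levy_uniqueness[OF \<mu>(1) \<nu>(1)], rule ext)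
  fix t
  interpret \<mu>: real_distribution \<mu> by fact
  interpret \<nu>: real_distribution \<nu> by fact
  define M where "M n = (\<integral>x. \<bar>x\<bar> ^ n \<partial>\<mu>) + (\<integral>x. \<bar>x\<bar> ^ n \<partial>\<nu>)" for n
  have M_even: "M (2 * k) = 2 * (\<integral>x. x ^ (2 * k) \<partial>\<mu>)" for k
    using eq[of "2 * k"] by (simp add: M_def power_even_abs)
  note ia = integrable_abs_power[OF \<mu>(2)] integrable_abs_power[OF \<nu>(2)]
  show "char \<mu> t = char \<nu> t"
  proof (cases "\<exists>k>0. (\<integral>x. x ^ (2 * k) \<partial>\<mu>) = 0")
    case True
    then show ?thesis
      using char_eq_of_zero_moment[OF \<mu>(1) \<mu>(2)] char_eq_of_zero_moment[OF \<nu>(1) \<nu>(2)] eq by metis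
  next
    case False
    have even_pos: "0 < (\<integral>x. x ^ (2 * k) \<partial>\<mu>)" for k
    proof (cases "k = 0")
      case True then show ?thesis using \<mu>.prob_space by simp
    next
      case k: False
      have "0 \<le> (\<integral>x. x ^ (2 * k) \<partial>\<mu>)" by simp
      with False k show ?thesis by (metis less_le neq0_conv)
    qed
    have Mpos: "0 < M n" for n
    proof -
      have "0 \<le> (\<integral>x. \<bar>x\<bar> ^ n \<partial>\<mu>)" "0 \<le> (\<integral>x. \<bar>x\<bar> ^ n \<partial>\<nu>)" by simp_all
      moreover have "(\<integral>x. \<bar>x\<bar> ^ n \<partial>\<mu>) \<noteq> 0"
      proof
        assume "(\<integral>x. \<bar>x\<bar> ^ n \<partial>\<mu>) = 0"
        then have "AE x in \<mu>. \<bar>x\<bar> ^ n = 0"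
          using ia(1)[of n] by (subst (asm) integral_nonneg_eq_0_iff_AE) auto
        then have "AE x in \<mu>. x ^ (2 * n) = 0" by eventually_elim auto
        then have "(\<integral>x. x ^ (2 * n) \<partial>\<mu>) = (\<integral>x. 0 \<partial>\<mu>)" by (intro integral_cong_AE) auto
        then show False using even_pos[of n] by simp
      qed
      ultimately show ?thesis unfolding M_def by linarith
    qed
    define F where "F n t = (CLINT x|\<mu>. (\<i> * complex_of_real x) ^ n * iexp (t * x)) -
        (CLINT x|\<nu>. (\<i> * complex_of_real x) ^ n * iexp (t * x))" for n t
    have int: "integrable \<xi> (\<lambda>x. (\<i> * complex_of_real x) ^ n * iexp (t * x))"
      if "real_distribution \<xi>" "\<And>n. integrable \<xi> (\<lambda>x. \<bar>x\<bar> ^ n)" for \<xi> n t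
    proof -
      interpret real_distribution \<xi> by fact
      show ?thesis
        by (rule Bochner_Integration.integrable_bound[OF that(2)[of n]])
          (auto simp: norm_mult norm_power)
    qed
    note int' = int[OF \<mu>(1) ia(1)] int[OF \<nu>(1) ia(2)]
    have "F 0 t = 0"
    proof (rule bang_quasi_analytic[where M = M])
      show "0 < M n" for n by (rule Mpos)
      show "(M (Suc n))\<^sup>2 \<le> M n * M (Suc (Suc n))" for n
        using abs_moment_log_convex[OF \<mu>(2) \<nu>(2), of n] Mpos[of "Suc (Suc n)"] by (simp add: M_def)
      have bd: "norm (CLINT x|\<xi>. (\<i> * complex_of_real x) ^ n * iexp (t * x)) \<le> (\<integral>x. \<bar>x\<bar> ^ n \<partial>\<xi>)"
        if "real_distribution \<xi>" "\<And>n. integrable \<xi> (\<lambda>x. \<bar>x\<bar> ^ n)" for \<xi> n t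
        by (rule order_trans[OF integral_norm_bound]) (simp add: norm_mult norm_power)
      show "norm (F n t) \<le> M n" for n t
        unfolding F_def M_def
        by (rule order_trans[OF norm_triangle_ineq4 add_mono[OF bd[OF \<mu>(1) ia(1)] bd[OF \<nu>(1) ia(2)]]])
      show "F n 0 = 0" for n
      proof -
        have "(CLINT x|\<xi>. (\<i> * complex_of_real x) ^ n * iexp (0 * x)) = \<i> ^ n * complex_of_real (\<integral>x. x ^ n \<partial>\<xi>)"
          for \<xi> :: "real measure"
          by (simp add: power_mult_distrib flip: of_real_power)
        then show ?thesis by (simp add: F_def eq del: of_real_power)
      qed
      show "norm (F j (t + h) - (\<Sum>i<m. complex_of_real (h ^ i / fact i) * F (i + j) t)) \<le> M (m + j) * \<bar>h\<bar> ^ m / fact m"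
        if m: "0 < m" for j m t h
      proof -
        let ?G = "\<lambda>\<xi> n t. CLINT x|\<xi>. (\<i> * complex_of_real x) ^ n * iexp (t * x)"
        have one: "norm (?G \<xi> j (t + h) - (\<Sum>i<m. complex_of_real (h ^ i / fact i) * ?G \<xi> (i + j) t))
            \<le> (\<integral>x. \<bar>x\<bar> ^ (m + j) \<partial>\<xi>) * \<bar>h\<bar> ^ m / fact m"
          if \<xi>: "real_distribution \<xi>" "\<And>n. integrable \<xi> (\<lambda>x. \<bar>x\<bar> ^ n)" for \<xi>
        proof -
          interpret real_distribution \<xi> by fact
          let ?d = "\<lambda>x. (\<i> * complex_of_real x) ^ j * iexp ((t + h) * x) -
            (\<Sum>i<m. complex_of_real (h ^ i / fact i) * ((\<i> * complex_of_real x) ^ (i + j) * iexp (t * x)))"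
          have "?G \<xi> j (t + h) - (\<Sum>i<m. complex_of_real (h ^ i / fact i) * ?G \<xi> (i + j) t) = (CLINT x|\<xi>. ?d x)"
          proof -
            have i2: "integrable \<xi> (\<lambda>x. \<Sum>i<m. complex_of_real (h ^ i / fact i) * ((\<i> * complex_of_real x) ^ (i + j) * iexp (t * x)))"
              by (intro Bochner_Integration.integrable_sum integrable_mult_right int[OF \<xi>])
            have "(CLINT x|\<xi>. ?d x) = ?G \<xi> j (t + h) -
                (CLINT x|\<xi>. (\<Sum>i<m. complex_of_real (h ^ i / fact i) * ((\<i> * complex_of_real x) ^ (i + j) * iexp (t * x))))"
              by (rule Bochner_Integration.integral_diff[OF int[OF \<xi>] i2])
            also have "(CLINT x|\<xi>. (\<Sum>i<m. complex_of_real (h ^ i / fact i) * ((\<i> * complex_of_real x) ^ (i + j) * iexp (t * x)))) =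
                (\<Sum>i<m. CLINT x|\<xi>. complex_of_real (h ^ i / fact i) * ((\<i> * complex_of_real x) ^ (i + j) * iexp (t * x)))"
              by (intro Bochner_Integration.integral_sum integrable_mult_right int[OF \<xi>])
            finally show ?thesis by (simp only: integral_mult_right_zero)
          qed
          then have "norm (?G \<xi> j (t + h) - (\<Sum>i<m. complex_of_real (h ^ i / fact i) * ?G \<xi> (i + j) t)) \<le>
              (\<integral>x. norm (?d x) \<partial>\<xi>)" by (simp only: integral_norm_bound)
          also have "\<dots> \<le> (\<integral>x. \<bar>x\<bar> ^ (m + j) * \<bar>h\<bar> ^ m / fact m \<partial>\<xi>)"
          proof (rule integral_mono')
            show "integrable \<xi> (\<lambda>x. \<bar>x\<bar> ^ (m + j) * \<bar>h\<bar> ^ m / fact m)" using \<xi>(2) by simp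
            fix x
            have "?d x = (\<i> * complex_of_real x) ^ j * iexp (t * x) *
                (iexp (h * x) - (\<Sum>i<m. (\<i> * complex_of_real (h * x)) ^ i / fact i))"
            proof -
              have "iexp ((t + h) * x) = iexp (t * x) * iexp (h * x)"
                by (simp add: exp_add[symmetric] algebra_simps)
              moreover have "complex_of_real (h ^ i / fact i) * ((\<i> * complex_of_real x) ^ (i + j) * E) =
                  (\<i> * complex_of_real x) ^ j * E * ((\<i> * complex_of_real (h * x)) ^ i / fact i)" for i E
                by (simp add: power_add power_mult_distrib mult_ac)
              ultimately show ?thesis by (simp only: right_diff_distrib sum_distrib_left mult.assoc)
            qed
            then have "norm (?d x) = \<bar>x\<bar> ^ j * norm (iexp (h * x) - (\<Sum>i<m. (\<i> * complex_of_real (h * x)) ^ i / fact i))"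
              by (simp only:) (simp add: norm_mult norm_power del: of_real_mult)
            also have "\<dots> \<le> \<bar>x\<bar> ^ j * (\<bar>h * x\<bar> ^ m / fact m)"
              using iexp_approx1[of "h * x" "m - 1"] m
              by (intro mult_left_mono) (auto simp: lessThan_Suc_atMost[symmetric])
            finally show "norm (?d x) \<le> \<bar>x\<bar> ^ (m + j) * \<bar>h\<bar> ^ m / fact m"
              by (simp add: abs_mult power_mult_distrib power_add mult_ac)
          qed simp
          also have "\<dots> = (\<integral>x. \<bar>x\<bar> ^ (m + j) \<partial>\<xi>) * \<bar>h\<bar> ^ m / fact m" by simp
          finally show ?thesis .
        qed
        have "F j (t + h) - (\<Sum>i<m. complex_of_real (h ^ i / fact i) * F (i + j) t) =
          (?G \<mu> j (t + h) - (\<Sum>i<m. complex_of_real (h ^ i / fact i) * ?G \<mu> (i + j) t)) -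
          (?G \<nu> j (t + h) - (\<Sum>i<m. complex_of_real (h ^ i / fact i) * ?G \<nu> (i + j) t))"
          by (simp only: F_def right_diff_distrib sum_subtractf) simp
        then have "norm (F j (t + h) - (\<Sum>i<m. complex_of_real (h ^ i / fact i) * F (i + j) t)) \<le> (\<integral>x. \<bar>x\<bar> ^ (m + j) \<partial>\<mu>) * \<bar>h\<bar> ^ m / fact m + (\<integral>x. \<bar>x\<bar> ^ (m + j) \<partial>\<nu>) * \<bar>h\<bar> ^ m / fact m"
          by (simp only:) (rule order_trans[OF norm_triangle_ineq4 add_mono[OF one[OF \<mu>(1) ia(1)] one[OF \<nu>(1) ia(2)]]])
        also have "\<dots> = M (m + j) * \<bar>h\<bar> ^ m / fact m"
          by (simp add: M_def distrib_right add_divide_distrib)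
        finally show ?thesis .
      qed
      show "\<not> summable (\<lambda>n. M n / M (Suc n))"
      proof
        assume "summable (\<lambda>n. M n / M (Suc n))"
        then have "summable (\<lambda>n. (\<Prod>j\<le>n. M j / M (Suc j)) powr (1 / real (Suc n)))"
          using Mpos by (intro summable_geometric_means) (auto simp: less_imp_le)
        moreover have "(\<Prod>j\<le>n. M j / M (Suc j)) = M 0 / M (Suc n)" for n
          using Mpos by (induction n) (simp_all add: less_imp_neq[THEN not_sym])
        ultimately have "summable (\<lambda>n. (M 0 / M (Suc n)) powr (1 / real (Suc n)))" by (simp only:)
        then have "summable ((\<lambda>n. (M 0 / M (Suc n)) powr (1 / real (Suc n))) \<circ> (\<lambda>k. 2 * k + 1))"
          by (intro summable_reindex) (auto simp: inj_on_def)
        moreover have "M 0 / M (Suc (2 * k + 1)) = 1 / (\<integral>x. x ^ (2 * Suc k) \<partial>\<mu>)" for k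
          using M_even[of "Suc k"] M_even[of 0] \<mu>.prob_space by simp
        ultimately have "summable (\<lambda>k. (1 / (\<integral>x. x ^ (2 * Suc k) \<partial>\<mu>)) powr (1 / real (2 * Suc k)))"
          by (simp add: o_def)
        then have "(\<Sum>k. ennreal ((1 / (\<integral>x. x ^ (2 * Suc k) \<partial>\<mu>)) powr (1 / real (2 * Suc k)))) \<noteq> \<infinity>"
          unfolding infinity_ennreal_def by (rule ennreal_suminf_neq_top) simp
        moreover have "ennreal ((1 / (\<integral>x. x ^ (2 * Suc k) \<partial>\<mu>)) powr (1 / real (2 * Suc k))) =
            1 / ennreal ((\<integral>x. x ^ (2 * Suc k) \<partial>\<mu>) powr (1 / real (2 * Suc k)))" for k
        proof -
          have "ennreal ((1 / y) powr a) = 1 / ennreal (y powr a)" if "0 < y" for y a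
            using divide_ennreal[of 1 "y powr a"] that by (simp add: powr_divide)
          then show ?thesis using even_pos[of "Suc k"] .
        qed
        ultimately show False using carl unfolding carleman_def by simp
      qed
    qed
    then show ?thesis by (simp add: F_def char_def)
  qed
qed

lemma carleman_mono:
  assumes "carleman \<alpha>" and "\<And>k. 0 < k \<Longrightarrow> 0 \<le> c (2 * k)" and "\<And>k. 0 < k \<Longrightarrow> c (2 * k) \<le> \<alpha> (2 * k)"
  shows "carleman c"
proof -
  have inv: "1 / ennreal b \<le> 1 / ennreal a" if "0 \<le> a" "a \<le> b" for a b
  proof (cases "a = 0")
    case False
    then show ?thesis
      using that divide_ennreal[of 1 a] divide_ennreal[of 1 b] by (auto simp: ennreal_leI frac_le)
  qed simp
  have "(\<Sum>k. 1 / ennreal (\<alpha> (2 * Suc k) powr (1 / real (2 * Suc k)))) \<le>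
      (\<Sum>k. 1 / ennreal (c (2 * Suc k) powr (1 / real (2 * Suc k))))"
  proof (intro suminf_le inv powr_mono2)
    show "0 \<le> c (2 * Suc k)" "c (2 * Suc k) \<le> \<alpha> (2 * Suc k)" for k
      by (rule assms(2) assms(3), simp)+
  qed auto
  then show ?thesis using assms(1) by (simp add: carleman_def top_unique)
qed

lemma weak_limit_moments:
  assumes \<mu>: "\<And>n. real_distribution (\<mu> n)" and \<nu>: "real_distribution \<nu>" and conv: "weak_conv_m \<mu> \<nu>"
    and int: "\<And>n k. integrable (\<mu> n) (\<lambda>x. x ^ k)"
    and mom: "\<And>k. (\<lambda>n. \<integral>x. x ^ k \<partial>\<mu> n) \<longlonglongrightarrow> c k"
  shows "integrable \<nu> (\<lambda>x. x ^ k)" and "(\<integral>x. x ^ k \<partial>\<nu>) = c k"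
proof -
  interpret \<mu>: real_distribution "\<mu> n" for n by (rule \<mu>)
  interpret \<nu>: real_distribution \<nu> by (rule \<nu>)
  have bounded: "\<exists>C. \<forall>n. (\<integral>x. x ^ k \<partial>\<mu> n) \<le> C" for k
    using Bseq_bdd_above[OF convergent_imp_Bseq[OF convergentI[OF mom[of k]]]]
    by (auto simp: bdd_above_def)
  define T where "T R x = max (-R) (min R x)" for R x :: real
  have T_cont: "isCont (\<lambda>x. T R x ^ k) x" for R k x unfolding T_def by (intro continuous_intros)
  have T_abs: "\<bar>T R x\<bar> \<le> R" "\<bar>T R x\<bar> \<le> \<bar>x\<bar>" if "0 \<le> R" for R x using that by (auto simp: T_def)
  have T_le: "\<bar>T R x ^ k\<bar> \<le> \<bar>x\<bar> ^ k" "norm (T R x ^ k) \<le> R ^ k" if "0 \<le> R" for R x k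
    using T_abs[OF that] by (auto simp: power_abs intro!: power_mono)
  have T_meas: "(\<lambda>x. T R x ^ k) \<in> borel_measurable borel" for R k
    unfolding T_def by measurable
  have T_int: "integrable \<xi> (\<lambda>x. T R x ^ k)" if "real_distribution \<xi>" "0 \<le> R" for \<xi> R k
  proof -
    interpret real_distribution \<xi> by fact
    show ?thesis by (rule integrable_const_bound[of _ "R ^ k"]) (use T_le(2) that T_meas in auto)
  qed
  have T_conv: "(\<lambda>n. \<integral>x. T R x ^ k \<partial>\<mu> n) \<longlonglongrightarrow> (\<integral>x. T R x ^ k \<partial>\<nu>)" if "0 \<le> R" for R k
    using \<mu> \<nu> conv by (rule weak_conv_imp_integral_bdd_continuous_conv[of _ _ _ "R ^ k"])
      (use T_cont T_le(2) that in auto)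
  have T_lim: "(\<lambda>R. T (real R) x ^ k) \<longlonglongrightarrow> x ^ k" for x k
  proof (rule tendsto_eventually)
    show "\<forall>\<^sub>F R in sequentially. T (real R) x ^ k = x ^ k"
      using eventually_ge_at_top[of "nat \<lceil>\<bar>x\<bar>\<rceil>"]
    proof eventually_elim
      case (elim R)
      then have "\<bar>x\<bar> \<le> real R" by linarith
      then have "T (real R) x = x" by (auto simp: T_def)
      then show ?case by simp
    qed
  qed
  have even_int: "integrable \<nu> (\<lambda>x. x ^ (2 * k))" for k
  proof -
    obtain C where C: "\<And>n. (\<integral>x. x ^ (2 * k) \<partial>\<mu> n) \<le> C" using bounded[of "2 * k"] by blast
    have TC: "(\<integral>x. T (real R) x ^ (2 * k) \<partial>\<nu>) \<le> C" for R
    proof (rule LIMSEQ_le_const2[OF T_conv])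
      show "\<exists>N. \<forall>n\<ge>N. (\<integral>x. T (real R) x ^ (2 * k) \<partial>\<mu> n) \<le> C"
      proof (intro exI allI impI)
        fix n
        have "(\<integral>x. T (real R) x ^ (2 * k) \<partial>\<mu> n) \<le> (\<integral>x. x ^ (2 * k) \<partial>\<mu> n)"
          using T_le(1)[of "real R" _ "2 * k"]
          by (intro integral_mono T_int[OF \<mu>] int) (auto simp: power_even_abs abs_le_iff)
        then show "(\<integral>x. T (real R) x ^ (2 * k) \<partial>\<mu> n) \<le> C" using C[of n] by simp
      qed
    qed simp
    have incr: "incseq (\<lambda>R. T (real R) x ^ (2 * k))" for x
    proof (rule incseq_SucI)
      fix R
      have "\<bar>T (real R) x\<bar> \<le> \<bar>T (real (Suc R)) x\<bar>" by (auto simp: T_def)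
      then have "\<bar>T (real R) x\<bar> ^ (2 * k) \<le> \<bar>T (real (Suc R)) x\<bar> ^ (2 * k)" by (intro power_mono) auto
      then show "T (real R) x ^ (2 * k) \<le> T (real (Suc R)) x ^ (2 * k)" by (simp add: power_even_abs)
    qed
    have inc: "incseq (\<lambda>R. \<integral>x. T (real R) x ^ (2 * k) \<partial>\<nu>)"
      using incr by (intro incseq_SucI integral_mono T_int[OF \<nu>]) (auto simp: incseq_Suc_iff)
    have "\<exists>L. (\<lambda>R. \<integral>x. T (real R) x ^ (2 * k) \<partial>\<nu>) \<longlonglongrightarrow> L"
    proof (rule incseq_convergent[OF inc])
      show "\<forall>R. (\<integral>x. T (real R) x ^ (2 * k) \<partial>\<nu>) \<le> C" using TC by blast
    qed (rule exI)
    then obtain L where L: "(\<lambda>R. \<integral>x. T (real R) x ^ (2 * k) \<partial>\<nu>) \<longlonglongrightarrow> L" ..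

    show ?thesis
    proof (rule integrable_monotone_convergence[where f = "\<lambda>R x. T (real R) x ^ (2 * k)"])
      show "AE x in \<nu>. mono (\<lambda>R. T (real R) x ^ (2 * k))" using incr by auto
      show "AE x in \<nu>. (\<lambda>R. T (real R) x ^ (2 * k)) \<longlonglongrightarrow> x ^ (2 * k)" using T_lim by auto
      show "integrable \<nu> (\<lambda>x. T (real R) x ^ (2 * k))" for R by (rule T_int[OF \<nu>]) simp
    qed (use L in simp_all)
  qed
  have ab: "\<bar>x\<bar> ^ k \<le> x ^ (2 * k) + 1" for x :: real and k
  proof (cases "\<bar>x\<bar> \<le> 1")
    case True
    then have "\<bar>x\<bar> ^ k \<le> 1" by (simp add: power_le_one)
    then show ?thesis by (simp add: add_increasing)
  next
    case False
    then have "\<bar>x\<bar> ^ k \<le> \<bar>x\<bar> ^ (2 * k)" by (intro power_increasing) auto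
    then show ?thesis by (simp add: power_even_abs)
  qed
  show int\<nu>: "integrable \<nu> (\<lambda>x. x ^ k)" for k
    by (rule Bochner_Integration.integrable_bound[of _ "\<lambda>x. x ^ (2 * k) + 1"])
      (use even_int ab in \<open>auto simp: power_abs add_increasing\<close>)
  have T_err: "\<bar>(\<integral>x. x ^ k \<partial>\<xi>) - (\<integral>x. T R x ^ k \<partial>\<xi>)\<bar> \<le> 2 * (\<integral>x. x ^ (2 * (k + 1)) \<partial>\<xi>) / R"
    if \<xi>: "real_distribution \<xi>" "\<And>k. integrable \<xi> (\<lambda>x. x ^ k)" and R: "1 \<le> R" for \<xi> R k
  proof -
    have "(\<integral>x. x ^ k \<partial>\<xi>) - (\<integral>x. T R x ^ k \<partial>\<xi>) = (\<integral>x. x ^ k - T R x ^ k \<partial>\<xi>)"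
      using \<xi> T_int[OF \<xi>(1), of R k] R by simp
    also have "\<bar>\<dots>\<bar> \<le> (\<integral>x. 2 * x ^ (2 * (k + 1)) / R \<partial>\<xi>)"
    proof (rule order_trans[OF integral_abs_bound integral_mono'])
      show "integrable \<xi> (\<lambda>x. 2 * x ^ (2 * (k + 1)) / R)" using \<xi>(2)[of "2 * (k + 1)"] by simp
      fix x
      show "\<bar>x ^ k - T R x ^ k\<bar> \<le> 2 * x ^ (2 * (k + 1)) / R"
      proof (cases "\<bar>x\<bar> \<le> R")
        case True
        then have "T R x = x" by (auto simp: T_def)
        moreover have "0 \<le> 2 * x ^ (2 * (k + 1)) / R"
          using R by (intro divide_nonneg_nonneg mult_nonneg_nonneg zero_le_even_power) auto
        ultimately show ?thesis by (simp only: diff_self abs_zero)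
      next
        case False
        have "\<bar>x ^ k - T R x ^ k\<bar> \<le> 2 * \<bar>x\<bar> ^ k"
          using T_le(1)[OF order_trans[OF zero_le_one R], of x k] abs_triangle_ineq4[of "x ^ k" "T R x ^ k"]
            power_abs[of x k] by linarith
        also have "\<bar>x\<bar> ^ k * R \<le> \<bar>x\<bar> ^ k * \<bar>x\<bar> ^ (k + 2)"
        proof (rule mult_left_mono)
          have "R \<le> \<bar>x\<bar> ^ 1" using False by simp
          also have "\<dots> \<le> \<bar>x\<bar> ^ (k + 2)" using False R by (intro power_increasing) auto
          finally show "R \<le> \<bar>x\<bar> ^ (k + 2)" .
        qed simp
        then have "\<bar>x\<bar> ^ k \<le> \<bar>x\<bar> ^ (k + (k + 2)) / R" using R by (simp add: pos_le_divide_eq power_add mult_ac)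
        then have "2 * \<bar>x\<bar> ^ k \<le> 2 * x ^ (2 * (k + 1)) / R"
        proof -
          have n: "k + (k + 2) = 2 * (k + 1)" by simp
          have "\<bar>x\<bar> ^ (k + (k + 2)) = x ^ (2 * (k + 1))" unfolding n by (rule power_even_abs) simp
          then have "\<bar>x\<bar> ^ k \<le> x ^ (2 * (k + 1)) / R"
            using \<open>\<bar>x\<bar> ^ k \<le> \<bar>x\<bar> ^ (k + (k + 2)) / R\<close> by metis
          then have "2 * \<bar>x\<bar> ^ k \<le> 2 * (x ^ (2 * (k + 1)) / R)" by (rule mult_left_mono) simp
          then show ?thesis by (simp only: times_divide_eq_right)
        qed
        finally show ?thesis .
      qed
      show "0 \<le> 2 * x ^ (2 * (k + 1)) / R"
        using R by (intro divide_nonneg_nonneg mult_nonneg_nonneg zero_le_even_power) auto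
    qed
    also have "\<dots> = 2 * (\<integral>x. x ^ (2 * (k + 1)) \<partial>\<xi>) / R" by simp
    finally show ?thesis .
  qed
  show "(\<integral>x. x ^ k \<partial>\<nu>) = c k"
  proof -
    obtain C where C: "\<And>n. (\<integral>x. x ^ (2 * (k + 1)) \<partial>\<mu> n) \<le> C" using bounded[of "2 * (k + 1)"] by blast
    define D where "D = 2 * C + 2 * (\<integral>x. x ^ (2 * (k + 1)) \<partial>\<nu>)"
    have est: "\<bar>c k - (\<integral>x. x ^ k \<partial>\<nu>)\<bar> \<le> D / R" if R: "1 \<le> R" for R
    proof -
      have "(\<lambda>n. \<bar>(\<integral>x. x ^ k \<partial>\<mu> n) - (\<integral>x. T R x ^ k \<partial>\<mu> n)\<bar>) \<longlonglongrightarrow> \<bar>c k - (\<integral>x. T R x ^ k \<partial>\<nu>)\<bar>"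
        using R by (intro tendsto_intros mom T_conv) auto
      then have "\<bar>c k - (\<integral>x. T R x ^ k \<partial>\<nu>)\<bar> \<le> 2 * C / R"
      proof (rule LIMSEQ_le_const2, intro exI allI impI)
        fix n
        have "2 * (\<integral>x. x ^ (2 * (k + 1)) \<partial>\<mu> n) / R \<le> 2 * C / R"
          using C[of n] R by (intro divide_right_mono) auto
        then show "\<bar>(\<integral>x. x ^ k \<partial>\<mu> n) - (\<integral>x. T R x ^ k \<partial>\<mu> n)\<bar> \<le> 2 * C / R"
          using T_err[OF \<mu> int R, where k1 = k] by (rule order_trans[rotated])
      qed
      moreover have "\<bar>(\<integral>x. x ^ k \<partial>\<nu>) - (\<integral>x. T R x ^ k \<partial>\<nu>)\<bar> \<le> 2 * (\<integral>x. x ^ (2 * (k + 1)) \<partial>\<nu>) / R"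
        by (rule T_err[OF \<nu> int\<nu> R])
      ultimately show ?thesis by (simp add: D_def add_divide_distrib)
    qed
    have "(\<lambda>R. D / real R) \<longlonglongrightarrow> 0" by real_asymp
    then have "\<bar>c k - (\<integral>x. x ^ k \<partial>\<nu>)\<bar> \<le> 0"
      by (rule LIMSEQ_le_const) (use est in \<open>auto intro!: exI[of _ 1]\<close>)
    then show ?thesis by simp
  qed
qed

lemma tight_of_second_moments:
  assumes \<mu>: "\<And>n. real_distribution (\<mu> n)" and int: "\<And>n. integrable (\<mu> n) (\<lambda>x. x ^ 2)"
    and C: "\<And>n. (\<integral>x. x ^ 2 \<partial>\<mu> n) \<le> C"
  shows "tight \<mu>"
  unfolding tight_def
proof (intro conjI allI impI)
  fix \<epsilon> :: real assume \<epsilon>: "0 < \<epsilon>"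
  define R where "R = sqrt (\<bar>C\<bar> / \<epsilon> + 1)"
  have R0: "0 < R" and R2: "R ^ 2 = \<bar>C\<bar> / \<epsilon> + 1" using \<epsilon> by (auto simp: R_def add_nonneg_pos)
  have "measure (\<mu> n) {-R<..R} > 1 - \<epsilon>" for n
  proof -
    interpret real_distribution "\<mu> n" by (rule \<mu>)
    have "measure (\<mu> n) (UNIV - {-R<..R}) = (\<integral>x. indicator (UNIV - {-R<..R}) x \<partial>\<mu> n)" by simp
    also have "\<dots> \<le> (\<integral>x. x ^ 2 / R ^ 2 \<partial>\<mu> n)"
    proof (rule integral_mono)
      show "integrable (\<mu> n) (\<lambda>x. x ^ 2 / R ^ 2)" using int[of n] by simp
      show "indicator (UNIV - {-R<..R}) x \<le> x ^ 2 / R ^ 2" for x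
        using R0 abs_le_square_iff[of R x] by (auto simp: indicator_def)
    qed (intro integrable_real_indicator, auto simp: less_top[symmetric])
    also have "\<dots> = (\<integral>x. x ^ 2 \<partial>\<mu> n) / R ^ 2" by simp
    also have "\<dots> \<le> \<bar>C\<bar> / R ^ 2" using C[of n] by (intro divide_right_mono) auto
    also have "\<dots> < \<epsilon>" unfolding R2 using \<epsilon> by (simp add: field_simps add_nonneg_pos)
    finally show ?thesis using prob_compl[of "{-R<..R}"] by simp
  qed
  then show "\<exists>a b. a < b \<and> (\<forall>n. measure (\<mu> n) {a<..b} > 1 - \<epsilon>)"
    using R0 by (intro exI[of _ "-R"] exI[of _ R]) auto
qed (rule \<mu>)

theorem method_of_moments:
  assumes \<mu>: "\<And>n. real_distribution (\<mu> n)" and int: "\<And>n k. integrable (\<mu> n) (\<lambda>x. x ^ k)"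
    and mom: "\<And>k. (\<lambda>n. \<integral>x. x ^ k \<partial>\<mu> n) \<longlonglongrightarrow> c k"
    and carl: "carleman c"
  obtains \<nu> where "real_distribution \<nu>" "\<And>k. integrable \<nu> (\<lambda>x. x ^ k)"
    "\<And>k. (\<integral>x. x ^ k \<partial>\<nu>) = c k" "weak_conv_m \<mu> \<nu>"
proof -
  obtain C where "\<And>n. (\<integral>x. x ^ 2 \<partial>\<mu> n) \<le> C"
    using Bseq_bdd_above[OF convergent_imp_Bseq[OF convergentI[OF mom[of 2]]]]
    by (auto simp: bdd_above_def)
  then have tight: "tight \<mu>" by (intro tight_of_second_moments \<mu> int)
  have lim: "integrable \<nu> (\<lambda>x. x ^ k)" "(\<integral>x. x ^ k \<partial>\<nu>) = c k"
    if s: "strict_mono s" and \<nu>: "real_distribution \<nu>" and w: "weak_conv_m (\<mu> \<circ> s) \<nu>" for s \<nu> k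
    using weak_limit_moments[of "\<mu> \<circ> s" \<nu> c k] \<mu> \<nu> w int LIMSEQ_subseq_LIMSEQ[OF mom s]
    by (auto simp: o_def)
  have id: "strict_mono (id :: nat \<Rightarrow> nat)" by (simp add: strict_mono_def)
  obtain r \<nu> where r: "strict_mono (r :: nat \<Rightarrow> nat)" and \<nu>: "real_distribution \<nu>" and w: "weak_conv_m (\<mu> \<circ> r) \<nu>"
    using tight_imp_convergent_subsubsequence[OF tight id] by auto
  note \<nu>_mom = lim[OF r \<nu> w]
  have "weak_conv_m \<mu> \<nu>"
  proof (rule tight_subseq_weak_converge[OF \<mu> \<nu> tight])
    fix s \<xi> assume s: "strict_mono s" and \<xi>: "real_distribution \<xi>" and w': "weak_conv_m (\<mu> \<circ> s) \<xi>"
    have "\<nu> = \<xi>"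
      by (rule carleman_moment_unique[OF \<nu> \<nu>_mom(1) \<xi> lim(1)[OF s \<xi> w']])
        (simp_all add: \<nu>_mom lim(2)[OF s \<xi> w'] carl)
    then show "weak_conv_m (\<mu> \<circ> s) \<nu>" using w' by simp
  qed
  then show ?thesis using that \<nu> \<nu>_mom by blast
qed

subsection \<open>Walks and their edges\<close>

abbreviation walk_edges :: "(nat \<Rightarrow> 'v) \<Rightarrow> nat \<Rightarrow> 'v set set" where
  "walk_edges w m \<equiv> (\<lambda>t. {w t, w (Suc t)}) ` {..<m}"

definition tree_walk :: "(nat \<Rightarrow> 'v) \<Rightarrow> nat \<Rightarrow> bool" where
  "tree_walk w m \<longleftrightarrow> card (w ` {..m}) = Suc (card (walk_edges w m))"

lemma walk_edges_subset: "e \<in> walk_edges w m \<Longrightarrow> e \<subseteq> w ` {..m}"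
  by auto

lemma walk_edges_Suc: "walk_edges w (Suc m) = insert {w m, w (Suc m)} (walk_edges w m)"
  by (auto simp: lessThan_Suc)

lemma walk_new_vertices:
  assumes "w 0 \<in> A"
  shows "card (w ` {..m} - A) \<le> card {e \<in> walk_edges w m. \<not> e \<subseteq> A}"
proof (induction m)
  case 0 show ?case using assms by simp
next
  case (Suc m)
  let ?E = "\<lambda>m. {e \<in> walk_edges w m. \<not> e \<subseteq> A}"
  have fin: "finite (?E m)" for m by simp
  have sub: "?E m \<subseteq> ?E (Suc m)" by auto
  show ?case
  proof (cases "w (Suc m) \<in> A \<union> w ` {..m}")
    case True
    then have "w ` {..Suc m} - A = w ` {..m} - A" by (auto simp: atMost_Suc)
    then show ?thesis using Suc card_mono[OF fin sub] by simp
  next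
    case False
    then have "w ` {..Suc m} - A = insert (w (Suc m)) (w ` {..m} - A)" by (auto simp: atMost_Suc)
    then have "card (w ` {..Suc m} - A) = Suc (card (w ` {..m} - A))" using False by simp
    moreover have sub': "insert {w m, w (Suc m)} (?E m) \<subseteq> ?E (Suc m)" using False by (auto simp: lessThan_Suc)
    moreover have new: "{w m, w (Suc m)} \<notin> ?E m" using False walk_edges_subset[of "{w m, w (Suc m)}" w m] by auto
    ultimately have "Suc (card (?E m)) \<le> card (?E (Suc m))"
      using card_mono[OF fin sub'] unfolding card_insert_disjoint[OF fin new] by simp
    then show ?thesis using Suc \<open>card (w ` {..Suc m} - A) = Suc (card (w ` {..m} - A))\<close> by linarith
  qed
qed

lemma tree_walk_step:
  "card (w ` {..Suc m}) + card (walk_edges w m) \<le> card (w ` {..m}) + card (walk_edges w (Suc m))"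
  "w (Suc m) \<in> w ` {..m} \<Longrightarrow> {w m, w (Suc m)} \<notin> walk_edges w m \<Longrightarrow>
    card (w ` {..Suc m}) + card (walk_edges w m) < card (w ` {..m}) + card (walk_edges w (Suc m))"
proof -
  have new: "{w m, w (Suc m)} \<notin> walk_edges w m" if "w (Suc m) \<notin> w ` {..m}"
    using that walk_edges_subset[of "{w m, w (Suc m)}" w m] by auto
  have fin: "finite (walk_edges w m)" by simp
  have V: "w ` {..Suc m} = insert (w (Suc m)) (w ` {..m})" by (auto simp: atMost_Suc)
  show "card (w ` {..Suc m}) + card (walk_edges w m) \<le> card (w ` {..m}) + card (walk_edges w (Suc m))"
    using new fin by (cases "w (Suc m) \<in> w ` {..m}")
      (simp_all add: V walk_edges_Suc insert_absorb card_insert_if)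
  show "card (w ` {..Suc m}) + card (walk_edges w m) < card (w ` {..m}) + card (walk_edges w (Suc m))"
    if "w (Suc m) \<in> w ` {..m}" "{w m, w (Suc m)} \<notin> walk_edges w m"
    using that fin by (simp add: V walk_edges_Suc insert_absorb)
qed

lemma card_walk_vertices: "card (w ` {..m}) \<le> Suc (card (walk_edges w m))"
proof (induction m)
  case (Suc m)
  then show ?case using tree_walk_step(1)[of w m] by linarith
qed simp

lemma tree_walk_SucD:
  assumes "tree_walk w (Suc m)"
  shows "tree_walk w m"
    and "{w m, w (Suc m)} \<notin> walk_edges w m \<Longrightarrow> w (Suc m) \<notin> w ` {..m}"
    and "{w m, w (Suc m)} \<in> walk_edges w m \<or> w (Suc m) \<notin> w ` {..m}"
proof -
  show *: "tree_walk w m"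
    using assms tree_walk_step(1)[of w m] card_walk_vertices[of w m] by (simp add: tree_walk_def)
  show "w (Suc m) \<notin> w ` {..m}" if "{w m, w (Suc m)} \<notin> walk_edges w m"
    using assms * that tree_walk_step(2)[of w m] by (fastforce simp: tree_walk_def)
  then show "{w m, w (Suc m)} \<in> walk_edges w m \<or> w (Suc m) \<notin> w ` {..m}" by blast
qed

lemma tree_walk_le: "tree_walk w m \<Longrightarrow> m' \<le> m \<Longrightarrow> tree_walk w m'"
  by (induction m) (auto simp: le_Suc_eq intro: tree_walk_SucD(1))

text \<open>Deleting an edge of a tree splits its vertices into two parts; \<open>S\<close> is one of them.\<close>

lemma tree_walk_cut:
  assumes "tree_walk w m" and "e \<in> walk_edges w m"
  shows "\<exists>S. \<forall>t<m. {w t, w (Suc t)} = e \<longleftrightarrow> (w t \<in> S) \<noteq> (w (Suc t) \<in> S)"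
  using assms
proof (induction m arbitrary: e)
  case (Suc m)
  note tw = tree_walk_SucD[OF Suc.prems(1)]
  show ?case
  proof (cases "{w m, w (Suc m)} \<in> walk_edges w m")
    case True
    then obtain s where s: "s < m" "{w m, w (Suc m)} = {w s, w (Suc s)}" by auto
    have e: "e \<in> walk_edges w m" using Suc.prems(2) unfolding walk_edges_Suc insert_absorb[OF True] .
    then obtain S where S: "\<And>t. t < m \<Longrightarrow> {w t, w (Suc t)} = e \<longleftrightarrow> (w t \<in> S) \<noteq> (w (Suc t) \<in> S)"
      using Suc.IH[OF tw(1) e] by (elim exE) (rule that, simp)
    have "(w m \<in> S) \<noteq> (w (Suc m) \<in> S) \<longleftrightarrow> (w s \<in> S) \<noteq> (w (Suc s) \<in> S)"
      using s(2) by (auto simp: doubleton_eq_iff)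
    then have "{w m, w (Suc m)} = e \<longleftrightarrow> (w m \<in> S) \<noteq> (w (Suc m) \<in> S)" using S[OF s(1)] s(2) by simp
    then show ?thesis using S by (intro exI[of _ S] allI impI, elim less_SucE) simp_all
  next
    case False
    have new: "w (Suc m) \<notin> w ` {..m}" by (rule tw(2)[OF False])
    show ?thesis
    proof (cases "e = {w m, w (Suc m)}")
      case True
      have "{w t, w (Suc t)} \<noteq> e" if "t < m" for t using that False True by auto
      moreover have "w t \<noteq> w (Suc m)" "w (Suc t) \<noteq> w (Suc m)" if "t < m" for t
      proof -
        have "w t \<in> w ` {..m}" "w (Suc t) \<in> w ` {..m}" using that by (auto intro!: imageI)
        then show "w t \<noteq> w (Suc m)" "w (Suc t) \<noteq> w (Suc m)" using new by metis+
      qed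
      moreover have "w m \<noteq> w (Suc m)" using new by (metis atMost_iff imageI order_refl)
      ultimately show ?thesis
        using True by (intro exI[of _ "{w (Suc m)}"] allI impI, elim less_SucE) simp_all
    next
      case False
      then have e: "e \<in> walk_edges w m" using Suc.prems(2) unfolding walk_edges_Suc by (auto simp only: insert_iff)
      then obtain S where S: "\<And>t. t < m \<Longrightarrow> {w t, w (Suc t)} = e \<longleftrightarrow> (w t \<in> S) \<noteq> (w (Suc t) \<in> S)"
        using Suc.IH[OF tw(1) e] by (elim exE) (rule that, simp)
      define S' where "S' = (if w m \<in> S then insert (w (Suc m)) S else S - {w (Suc m)})"
      have "w t \<in> S' \<longleftrightarrow> w t \<in> S" if "t \<le> m" for t
      proof -
        have "w t \<noteq> w (Suc m)" using new that by (metis atMost_iff imageI)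
        then show ?thesis by (simp add: S'_def)
      qed
      moreover have "w (Suc m) \<in> S' \<longleftrightarrow> w m \<in> S" by (simp add: S'_def)
      ultimately show ?thesis
        using S False[symmetric] by (intro exI[of _ S'] allI impI, elim less_SucE) simp_all
    qed
  qed
qed simp

lemma even_crossings:
  "even (card {t. t < m \<and> (w t \<in> S) \<noteq> (w (Suc t) \<in> S)}) \<longleftrightarrow> ((w 0 \<in> S) = (w m \<in> S))"
proof (induction m)
  case (Suc m)
  let ?C = "\<lambda>m. {t. t < m \<and> (w t \<in> S) \<noteq> (w (Suc t) \<in> S)}"
  have fin: "finite (?C m)" by simp
  have "?C (Suc m) = (if (w m \<in> S) \<noteq> (w (Suc m) \<in> S) then insert m (?C m) else ?C m)"
    by (auto simp: less_Suc_eq)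
  then have "card (?C (Suc m)) = card (?C m) + of_bool ((w m \<in> S) \<noteq> (w (Suc m) \<in> S))"
    using fin by (simp add: card_insert_if)
  then show ?case using Suc by auto
qed simp

lemma tree_walk_closed:
  assumes "tree_walk w m" and "w m = w 0" and "t < m"
  shows "w t \<noteq> w (Suc t)" and "even (card {s. s < m \<and> {w s, w (Suc s)} = {w t, w (Suc t)}})"
proof -
  let ?e = "{w t, w (Suc t)}"
  have "?e \<in> walk_edges w m" using assms(3) by (intro image_eqI[of _ _ t]) auto
  from tree_walk_cut[OF assms(1) this] obtain S
    where S: "\<forall>s<m. {w s, w (Suc s)} = ?e \<longleftrightarrow> (w s \<in> S) \<noteq> (w (Suc s) \<in> S)" ..
  note S = S[rule_format]
  show "w t \<noteq> w (Suc t)" using S[OF assms(3)] by auto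
  have "{s. s < m \<and> {w s, w (Suc s)} = ?e} = {s. s < m \<and> (w s \<in> S) \<noteq> (w (Suc s) \<in> S)}"
    by (intro Collect_cong conj_cong refl S)
  then show "even (card {s. s < m \<and> {w s, w (Suc s)} = ?e})" using even_crossings[of m w S] assms(2) by simp
qed

subsection \<open>Closed walks indexed by residues\<close>

definition cedge :: "nat \<Rightarrow> (nat \<Rightarrow> 'v) \<Rightarrow> nat \<Rightarrow> 'v set" where
  "cedge k i j = {i j, i (Suc j mod k)}"

definition cedges :: "nat \<Rightarrow> (nat \<Rightarrow> 'v) \<Rightarrow> 'v set set" where
  "cedges k i = cedge k i ` {..<k}"

definition edge_mult :: "nat \<Rightarrow> (nat \<Rightarrow> 'v) \<Rightarrow> 'v set \<Rightarrow> nat" where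
  "edge_mult k i e = card {j. j < k \<and> cedge k i j = e}"

definition ctree :: "nat \<Rightarrow> (nat \<Rightarrow> 'v) \<Rightarrow> bool" where
  "ctree k i \<longleftrightarrow> card (i ` {..<k}) = Suc (card (cedges k i))"

lemma finite_cedges [simp]: "finite (cedges k i)"
  by (simp add: cedges_def)

lemma cedges_subset: "0 < k \<Longrightarrow> e \<in> cedges k i \<Longrightarrow> e \<subseteq> i ` {..<k}"
  by (auto simp: cedges_def cedge_def)

lemma unroll_closed_walk:
  assumes "j0 < k"
  shows "(\<lambda>t. i ((j0 + t) mod k)) ` {..k} = i ` {..<k}"
    and "walk_edges (\<lambda>t. i ((j0 + t) mod k)) k = cedges k i"
proof -
  have surj: "\<exists>t<k. (j0 + t) mod k = j" if "j < k" for j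
  proof (cases "j0 \<le> j")
    case True then show ?thesis using that by (intro exI[of _ "j - j0"]) auto
  next
    case False
    then have "j0 + (j + k - j0) = j + k" using assms by simp
    then show ?thesis using that False assms
      by (intro exI[of _ "j + k - j0"]) (auto simp del: add_diff_inverse add_diff_inverse_nat)
  qed
  have k: "0 < k" using assms by simp
  show "(\<lambda>t. i ((j0 + t) mod k)) ` {..k} = i ` {..<k}"
  proof (intro equalityI subsetI)
    fix x assume "x \<in> i ` {..<k}"
    then obtain j where j: "j < k" "x = i j" by auto
    with surj obtain t where "t < k" "(j0 + t) mod k = j" by blast
    then show "x \<in> (\<lambda>t. i ((j0 + t) mod k)) ` {..k}" using j by force
  qed (use k in auto)
  have e: "{i ((j0 + t) mod k), i (Suc (j0 + t) mod k)} = cedge k i ((j0 + t) mod k)" for t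
    by (simp add: cedge_def mod_Suc_eq)
  show "walk_edges (\<lambda>t. i ((j0 + t) mod k)) k = cedges k i"
  proof (intro equalityI subsetI)
    fix x assume "x \<in> cedges k i"
    then obtain j where j: "j < k" "x = cedge k i j" by (auto simp: cedges_def)
    with surj obtain t where "t < k" "(j0 + t) mod k = j" by blast
    then show "x \<in> walk_edges (\<lambda>t. i ((j0 + t) mod k)) k" using j e[of t] by (auto simp: image_iff)
  qed (use k in \<open>auto simp: e cedges_def\<close>)
qed

lemma closed_walk_new_vertices:
  assumes "j0 < k" and "i j0 \<in> A"
  shows "card (i ` {..<k} - A) \<le> card {e \<in> cedges k i. \<not> e \<subseteq> A}"
  using walk_new_vertices[of "\<lambda>t. i ((j0 + t) mod k)" A k] assms unroll_closed_walk[OF assms(1), of i] by simp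

lemma card_closed_walk_vertices: "0 < k \<Longrightarrow> card (i ` {..<k}) \<le> Suc (card (cedges k i))"
  using card_walk_vertices[of "\<lambda>t. i (t mod k)" k] unroll_closed_walk[of 0 k i] by simp

lemma ctree_tree_walk: "0 < k \<Longrightarrow> ctree k i \<longleftrightarrow> tree_walk (\<lambda>t. i (t mod k)) k"
  using unroll_closed_walk[of 0 k i] by (simp add: ctree_def tree_walk_def)

lemma ctree_even:
  assumes "ctree k i" and "e \<in> cedges k i"
  shows "even (edge_mult k i e)" and "\<exists>a b. a \<noteq> b \<and> e = {a, b}" and "2 \<le> edge_mult k i e"
proof -
  obtain j where j: "j < k" "e = cedge k i j" using assms by (auto simp: cedges_def)
  then have k: "0 < k" by simp
  let ?w = "\<lambda>t. i (t mod k)"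
  have w: "{?w t, ?w (Suc t)} = cedge k i t" if "t < k" for t using that by (simp add: cedge_def)
  have tw: "tree_walk ?w k" using assms k by (simp add: ctree_tree_walk)
  have "{s. s < k \<and> {?w s, ?w (Suc s)} = {?w j, ?w (Suc j)}} = {s. s < k \<and> cedge k i s = e}"
  proof (rule Collect_cong)
    fix s
    show "(s < k \<and> {?w s, ?w (Suc s)} = {?w j, ?w (Suc j)}) = (s < k \<and> cedge k i s = e)"
      using w[of s] w[OF j(1)] j(2) by metis
  qed
  then show ev: "even (edge_mult k i e)"
    using tree_walk_closed(2)[OF tw _ j(1)] by (simp add: edge_mult_def)
  have "?w j \<noteq> ?w (Suc j)" using tree_walk_closed(1)[OF tw _ j(1)] by simp
  then show "\<exists>a b. a \<noteq> b \<and> e = {a, b}" using j w by blast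
  have "0 < edge_mult k i e" unfolding edge_mult_def using j by (auto simp: card_gt_0_iff)
  with ev show "2 \<le> edge_mult k i e" by (metis One_nat_def Suc_leI even_plus_one_iff le_neq_implies_less numeral_2_eq_2 odd_one)
qed

lemma add_closed_walk:
  assumes fin: "finite A" "finite F" and F: "\<And>f. f \<in> F \<Longrightarrow> f \<subseteq> A" and k: "0 < k"
    and card: "card A \<le> card F + c"
  shows "i ` {..<k} \<inter> A \<noteq> {} \<Longrightarrow> card (A \<union> i ` {..<k}) \<le> card (F \<union> cedges k i) + c"
    and "card (A \<union> i ` {..<k}) \<le> card (F \<union> cedges k i) + Suc c"
proof -
  have touch: "card (A \<union> i ` {..<k}) \<le> card (F \<union> cedges k i) + c"
    if "finite A" "\<And>f. f \<in> F \<Longrightarrow> f \<subseteq> A" "card A \<le> card F + c" and meet: "i ` {..<k} \<inter> A \<noteq> {}" for A c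
  proof -
    obtain j0 where j0: "j0 < k" "i j0 \<in> A" using meet by auto
    let ?N = "{e \<in> cedges k i. \<not> e \<subseteq> A}"
    have "A \<union> i ` {..<k} = A \<union> (i ` {..<k} - A)" by auto
    then have "card (A \<union> i ` {..<k}) = card A + card (i ` {..<k} - A)"
      using that(1) card_Un_disjoint[of A "i ` {..<k} - A"] by auto
    also have "\<dots> \<le> card F + c + card ?N" using closed_walk_new_vertices[of j0 k i A, OF j0] that(3) by simp
    also have "card F + card ?N = card (F \<union> ?N)"
      using that(2) fin(2) by (intro card_Un_disjoint[symmetric]) auto
    then have "card F + c + card ?N = card (F \<union> ?N) + c" by simp
    also have "card (F \<union> ?N) \<le> card (F \<union> cedges k i)" using fin(2) by (intro card_mono) auto
    finally show ?thesis by simp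
  qed
  show "i ` {..<k} \<inter> A \<noteq> {} \<Longrightarrow> card (A \<union> i ` {..<k}) \<le> card (F \<union> cedges k i) + c"
    by (rule touch) (use assms in auto)
  have "card (insert (i 0) A \<union> i ` {..<k}) \<le> card (F \<union> cedges k i) + Suc c"
  proof (rule touch)
    show "card (insert (i 0) A) \<le> card F + Suc c" using card fin(1) by (simp add: card_insert_if)
    show "i ` {..<k} \<inter> insert (i 0) A \<noteq> {}" using k by auto
  qed (use fin F in auto)
  moreover have "insert (i 0) A \<union> i ` {..<k} = A \<union> i ` {..<k}" using k by auto
  ultimately show "card (A \<union> i ` {..<k}) \<le> card (F \<union> cedges k i) + Suc c" by simp
qed

lemma card_four_walks_of_chain:
  assumes k: "0 < k" and ab: "cedges k a \<inter> cedges k b \<noteq> {}"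
    and d: "cedges k d \<inter> (cedges k a \<union> cedges k b \<union> cedges k c) \<noteq> {}"
  shows "card (a ` {..<k} \<union> b ` {..<k} \<union> c ` {..<k} \<union> d ` {..<k})
    \<le> card (cedges k a \<union> cedges k b \<union> cedges k c \<union> cedges k d) + 2"
proof -
  have ne: "e \<noteq> {}" if "e \<in> cedges k i" for e and i :: "nat \<Rightarrow> 'a" using that by (auto simp: cedges_def cedge_def)
  note sub = cedges_subset[OF k]
  have 1: "card (a ` {..<k}) \<le> card (cedges k a) + 1" using card_closed_walk_vertices[OF k, of a] by simp
  obtain e where e: "e \<in> cedges k a" "e \<in> cedges k b" using ab by blast
  have 2: "card (a ` {..<k} \<union> b ` {..<k}) \<le> card (cedges k a \<union> cedges k b) + 1"
  proof (rule add_closed_walk(1)[OF _ _ _ k 1])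
    show "b ` {..<k} \<inter> a ` {..<k} \<noteq> {}" using sub[OF e(1)] sub[OF e(2)] ne[OF e(1)] by blast
  qed (use sub in simp_all)
  have 3: "card (a ` {..<k} \<union> b ` {..<k} \<union> c ` {..<k}) \<le> card (cedges k a \<union> cedges k b \<union> cedges k c) + 2"
  proof -
    have "f \<subseteq> a ` {..<k} \<union> b ` {..<k}" if "f \<in> cedges k a \<union> cedges k b" for f
      using that sub[of f a] sub[of f b] by blast
    from add_closed_walk(2)[OF _ _ this k 2, of c] show ?thesis by simp
  qed
  obtain f where f: "f \<in> cedges k d" "f \<in> cedges k a \<union> cedges k b \<union> cedges k c" using d by blast
  have "f \<subseteq> d ` {..<k}" "f \<subseteq> a ` {..<k} \<union> b ` {..<k} \<union> c ` {..<k}" "f \<noteq> {}"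
    subgoal by (rule sub[OF f(1)])
    subgoal
      using f(2)
    proof (elim UnE)
      assume "f \<in> cedges k a" from sub[OF this] show ?thesis by blast
    next
      assume "f \<in> cedges k b" from sub[OF this] show ?thesis by blast
    next
      assume "f \<in> cedges k c" from sub[OF this] show ?thesis by blast
    qed
    subgoal by (rule ne[OF f(1)])
    done
  then have touch: "d ` {..<k} \<inter> (a ` {..<k} \<union> b ` {..<k} \<union> c ` {..<k}) \<noteq> {}"
    by (metis Int_greatest subset_empty)
  show ?thesis
  proof (rule add_closed_walk(1)[OF _ _ _ k 3 touch])
    show "f \<subseteq> a ` {..<k} \<union> b ` {..<k} \<union> c ` {..<k}"
      if "f \<in> cedges k a \<union> cedges k b \<union> cedges k c" for f
      using that sub[of f a] sub[of f b] sub[of f c] by blast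
  qed simp_all
qed

lemma card_four_walks_of_shared_edges:
  fixes f :: "nat \<Rightarrow> nat \<Rightarrow> 'v"
  assumes k: "0 < k"
    and share: "\<And>r. r < 4 \<Longrightarrow> \<exists>s<4. s \<noteq> r \<and> cedges k (f r) \<inter> cedges k (f s) \<noteq> {}"
  shows "card (\<Union>r<4. f r ` {..<k}) \<le> card (\<Union>r<4. cedges k (f r)) + (2::nat)"
proof -
  have four: "{..<4::nat} = {0, 1, 2, 3}" by auto
  have U: "(\<Union>r<4. g r) = g 0 \<union> g 1 \<union> g 2 \<union> g 3" "(\<Union>r<4. g r) = g 0 \<union> g 2 \<union> g 1 \<union> g 3"
    "(\<Union>r<4. g r) = g 0 \<union> g 3 \<union> g 1 \<union> g 2" for g :: "nat \<Rightarrow> 'b set"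
    unfolding four by blast+
  have conn: "\<exists>s\<in>{0,1,2,3}. s \<noteq> r \<and> cedges k (f r) \<inter> cedges k (f s) \<noteq> {}" if "r < 4" for r :: nat
    using share[OF that] four by blast
  from conn[of 0] consider "cedges k (f 0) \<inter> cedges k (f 1) \<noteq> {}"
    | "cedges k (f 0) \<inter> cedges k (f 2) \<noteq> {}" | "cedges k (f 0) \<inter> cedges k (f 3) \<noteq> {}" by auto
  then show ?thesis
  proof cases
    case 1
    have "cedges k (f 3) \<inter> (cedges k (f 0) \<union> cedges k (f 1) \<union> cedges k (f 2)) \<noteq> {}" using conn[of 3] by auto
    from card_four_walks_of_chain[OF k 1 this] show ?thesis unfolding U(1) .
  next
    case 2
    have "cedges k (f 3) \<inter> (cedges k (f 0) \<union> cedges k (f 2) \<union> cedges k (f 1)) \<noteq> {}" using conn[of 3] by auto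
    from card_four_walks_of_chain[OF k 2 this] show ?thesis unfolding U(2) .
  next
    case 3
    have "cedges k (f 2) \<inter> (cedges k (f 0) \<union> cedges k (f 3) \<union> cedges k (f 1)) \<noteq> {}" using conn[of 2] by auto
    from card_four_walks_of_chain[OF k 3 this] show ?thesis unfolding U(3) .
  qed
qed

lemma sum_power_le_by_image_size:
  fixes V :: "'x \<Rightarrow> nat set" and l :: "'x \<Rightarrow> nat"
  assumes I: "finite I" and n: "0 < n"
    and V: "\<And>x. x \<in> I \<Longrightarrow> V x \<subseteq> {..<n}" "\<And>x. x \<in> I \<Longrightarrow> card (V x) \<le> K"
    and l: "\<And>x. x \<in> I \<Longrightarrow> card (V x) \<le> l x + c"
    and C: "\<And>S. finite S \<Longrightarrow> card S \<le> K \<Longrightarrow> card {x \<in> I. V x = S} \<le> C"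
    and \<gamma>: "0 \<le> \<gamma>" "\<gamma> \<le> 1"
  shows "(\<Sum>x\<in>I. (real n powr - \<gamma>) ^ l x) \<le> real C * real (Suc K) * real n powr (real c + (1 - \<gamma>) * real K)"
proof -
  let ?B = "real n powr (real c + (1 - \<gamma>) * real K)"
  let ?q = "1 / real n"
  let ?T = "{S. S \<subseteq> {..<n} \<and> card S \<le> K}"
  have finT: "finite ?T" by simp
  have each: "(real n powr - \<gamma>) ^ l x \<le> ?B * ?q ^ card (V x)" if x: "x \<in> I" for x
  proof -
    have "\<gamma> * real (card (V x)) \<le> \<gamma> * (real (l x) + real c)"
      using l[OF x] \<gamma> by (intro mult_left_mono) auto
    moreover have "\<gamma> * real c \<le> 1 * real c" using \<gamma> by (intro mult_right_mono) auto
    moreover have "(1 - \<gamma>) * real (card (V x)) \<le> (1 - \<gamma>) * real K"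
      using V(2)[OF x] \<gamma> by (intro mult_left_mono) auto
    ultimately have "- \<gamma> * real (l x) \<le> real c + (1 - \<gamma>) * real K - real (card (V x))"
      by (simp add: algebra_simps)
    then have "real n powr (- \<gamma> * real (l x)) \<le> real n powr (real c + (1 - \<gamma>) * real K - real (card (V x)))"
      using n by (intro powr_mono) auto
    moreover have "(real n powr - \<gamma>) ^ l x = real n powr (- \<gamma> * real (l x))"
      using n by (subst powr_realpow[symmetric]) (auto simp: powr_powr)
    ultimately show ?thesis using n
      by (simp add: powr_diff powr_realpow power_one_over divide_inverse power_inverse)
  qed
  have "(\<Sum>x\<in>I. ?q ^ card (V x)) = (\<Sum>S\<in>?T. \<Sum>x\<in>{x\<in>I. V x = S}. ?q ^ card (V x))"
    using V by (intro sum.group[symmetric] I finT) auto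
  also have "\<dots> = (\<Sum>S\<in>?T. real (card {x\<in>I. V x = S}) * ?q ^ card S)"
    by (intro sum.cong) auto
  also have "\<dots> \<le> (\<Sum>S\<in>?T. real C * ?q ^ card S)"
    using C finite_subset[of _ "{..<n}"] by (intro sum_mono mult_right_mono) auto
  also have "\<dots> = real C * (\<Sum>S\<in>?T. ?q ^ card S)" by (simp add: sum_distrib_left)
  finally have 1: "(\<Sum>x\<in>I. ?q ^ card (V x)) \<le> real C * (\<Sum>S\<in>?T. ?q ^ card S)" .
  have "(\<Sum>S\<in>?T. ?q ^ card S) = (\<Sum>v\<le>K. \<Sum>S\<in>{S\<in>?T. card S = v}. ?q ^ card S)"
    by (intro sum.group[symmetric] finT) auto
  also have "\<dots> = (\<Sum>v\<le>K. real (n choose v) * ?q ^ v)"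
  proof (intro sum.cong refl)
    fix v assume "v \<in> {..K}"
    then have "{S\<in>?T. card S = v} = {S. S \<subseteq> {..<n} \<and> card S = v}" by auto
    then show "(\<Sum>S\<in>{S\<in>?T. card S = v}. ?q ^ card S) = real (n choose v) * ?q ^ v"
      using n_subsets[of "{..<n}" v] by simp
  qed
  also have "\<dots> \<le> (\<Sum>v\<le>K. 1)"
  proof (rule sum_mono)
    fix v
    have "n choose v \<le> n ^ v" using binomial_le_pow[of v n] by (cases "v \<le> n") (auto simp: binomial_eq_0)
    then have "real (n choose v) \<le> real n ^ v" by (metis of_nat_le_iff of_nat_power)
    then show "real (n choose v) * ?q ^ v \<le> 1" using n by (simp add: power_one_over divide_simps)
  qed
  also have "\<dots> = real (Suc K)" by simp
  finally have 2: "(\<Sum>S\<in>?T. ?q ^ card S) \<le> real (Suc K)" .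
  have "(\<Sum>x\<in>I. (real n powr - \<gamma>) ^ l x) \<le> (\<Sum>x\<in>I. ?B * ?q ^ card (V x))"
    by (intro sum_mono each)
  also have "\<dots> = ?B * (\<Sum>x\<in>I. ?q ^ card (V x))" by (simp add: sum_distrib_left)
  also have "\<dots> \<le> ?B * (real C * real (Suc K))"
    by (intro mult_left_mono order_trans[OF 1] 2) auto
  finally show ?thesis by (simp add: mult_ac)
qed

subsection \<open>Joint moments along a family of edges\<close>

definition joint :: "('e \<Rightarrow> nat \<Rightarrow> real) \<Rightarrow> ('j \<Rightarrow> 'e) \<Rightarrow> 'j set \<Rightarrow> real" where
  "joint \<mu> \<epsilon> J = (\<Prod>e\<in>\<epsilon> ` J. \<mu> e (card {j \<in> J. \<epsilon> j = e}))"

lemma abs_joint_le: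
  assumes "finite J" and "\<And>e p. e \<in> \<epsilon> ` J \<Longrightarrow> 1 \<le> p \<Longrightarrow> p \<le> card J \<Longrightarrow> \<bar>\<mu> e p\<bar> \<le> \<delta>"
  shows "\<bar>joint \<mu> \<epsilon> J\<bar> \<le> \<delta> ^ card (\<epsilon> ` J)"
proof -
  have "\<bar>joint \<mu> \<epsilon> J\<bar> = (\<Prod>e\<in>\<epsilon> ` J. \<bar>\<mu> e (card {j \<in> J. \<epsilon> j = e})\<bar>)"
    by (simp add: joint_def abs_prod)
  also have "\<dots> \<le> (\<Prod>e\<in>\<epsilon> ` J. \<delta>)"
  proof (rule prod_mono, intro conjI assms(2))
    fix e assume "e \<in> \<epsilon> ` J"
    then show "1 \<le> card {j \<in> J. \<epsilon> j = e}" using assms(1) by (auto simp: Suc_le_eq card_gt_0_iff)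
  qed (use assms(1) in \<open>auto intro: card_mono\<close>)
  finally show ?thesis by simp
qed

lemma joint_Un:
  assumes "finite J" "finite J'" and disj: "\<epsilon> ` J \<inter> \<epsilon> ` J' = {}"
  shows "joint \<mu> \<epsilon> (J \<union> J') = joint \<mu> \<epsilon> J * joint \<mu> \<epsilon> J'"
proof -
  have "joint \<mu> \<epsilon> (J \<union> J') = (\<Prod>e\<in>\<epsilon> ` J. \<mu> e (card {j \<in> J \<union> J'. \<epsilon> j = e})) *
      (\<Prod>e\<in>\<epsilon> ` J'. \<mu> e (card {j \<in> J \<union> J'. \<epsilon> j = e}))"
    unfolding joint_def image_Un using assms by (intro prod.union_disjoint) auto
  also have "(\<Prod>e\<in>\<epsilon> ` J. \<mu> e (card {j \<in> J \<union> J'. \<epsilon> j = e})) = joint \<mu> \<epsilon> J"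
    unfolding joint_def
  proof (intro prod.cong refl arg_cong2[of _ _ _ _ \<mu>] arg_cong[of _ _ card])
    fix e assume "e \<in> \<epsilon> ` J"
    then show "{j \<in> J \<union> J'. \<epsilon> j = e} = {j \<in> J. \<epsilon> j = e}" using disj by blast
  qed
  also have "(\<Prod>e\<in>\<epsilon> ` J'. \<mu> e (card {j \<in> J \<union> J'. \<epsilon> j = e})) = joint \<mu> \<epsilon> J'"
    unfolding joint_def
  proof (intro prod.cong refl arg_cong2[of _ _ _ _ \<mu>] arg_cong[of _ _ card])
    fix e assume "e \<in> \<epsilon> ` J'"
    then show "{j \<in> J \<union> J'. \<epsilon> j = e} = {j \<in> J'. \<epsilon> j = e}" using disj by blast
  qed
  finally show ?thesis .
qed

lemma (in prob_space) expectation_prod_edges: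
  fixes Z :: "'e \<Rightarrow> 'a \<Rightarrow> real"
  assumes indep: "indep_vars (\<lambda>_. borel) Z E" and int: "\<And>e p. e \<in> E \<Longrightarrow> integrable M (\<lambda>\<omega>. Z e \<omega> ^ p)"
    and J: "finite J" "\<epsilon> ` J \<subseteq> E"
  shows "integrable M (\<lambda>\<omega>. \<Prod>j\<in>J. Z (\<epsilon> j) \<omega>)"
    and "expectation (\<lambda>\<omega>. \<Prod>j\<in>J. Z (\<epsilon> j) \<omega>) = joint (\<lambda>e p. expectation (\<lambda>\<omega>. Z e \<omega> ^ p)) \<epsilon> J"
proof -
  let ?m = "\<lambda>e. card {j \<in> J. \<epsilon> j = e}"
  have eq: "(\<Prod>j\<in>J. Z (\<epsilon> j) \<omega>) = (\<Prod>e\<in>\<epsilon> ` J. Z e \<omega> ^ ?m e)" for \<omega>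
  proof -
    have "(\<Prod>j\<in>J. Z (\<epsilon> j) \<omega>) = (\<Prod>e\<in>\<epsilon> ` J. \<Prod>j\<in>{j\<in>J. \<epsilon> j = e}. Z (\<epsilon> j) \<omega>)"
      by (rule prod.image_gen[OF J(1)])
    also have "\<dots> = (\<Prod>e\<in>\<epsilon> ` J. Z e \<omega> ^ ?m e)" by (intro prod.cong refl) simp
    finally show ?thesis .
  qed
  have ind: "indep_vars (\<lambda>_. borel) (\<lambda>e \<omega>. Z e \<omega> ^ ?m e) (\<epsilon> ` J)"
    by (rule indep_vars_compose2[OF indep_vars_subset[OF indep J(2)]]) simp
  have int': "integrable M (\<lambda>\<omega>. Z e \<omega> ^ ?m e)" if "e \<in> \<epsilon> ` J" for e using int J(2) that by blast
  show "integrable M (\<lambda>\<omega>. \<Prod>j\<in>J. Z (\<epsilon> j) \<omega>)"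
    unfolding eq by (rule indep_vars_integrable[OF _ ind int']) (use J(1) in auto)
  show "expectation (\<lambda>\<omega>. \<Prod>j\<in>J. Z (\<epsilon> j) \<omega>) = joint (\<lambda>e p. expectation (\<lambda>\<omega>. Z e \<omega> ^ p)) \<epsilon> J"
    unfolding eq joint_def by (rule indep_vars_lebesgue_integral[OF _ ind int']) (use J(1) in auto)
qed

lemma prod_add_Pow:
  fixes a b :: "'r \<Rightarrow> real"
  assumes "finite R"
  shows "(\<Prod>r\<in>R. a r + b r) = (\<Sum>S\<in>Pow R. (\<Prod>r\<in>S. a r) * (\<Prod>r\<in>R - S. b r))"
  using assms
proof (induction R)
  case (insert x R)
  have fin: "finite S" if "S \<subseteq> R" for S using insert(1) that finite_subset by blast
  have inj: "inj_on (insert x) (Pow R)"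
    using insert(2) by (intro inj_onI) (metis PowD insert_ident subsetD)
  have "(\<Sum>S\<in>Pow (insert x R). (\<Prod>r\<in>S. a r) * (\<Prod>r\<in>insert x R - S. b r)) =
      (\<Sum>S\<in>Pow R. (\<Prod>r\<in>S. a r) * (\<Prod>r\<in>insert x R - S. b r)) +
      (\<Sum>S\<in>Pow R. (\<Prod>r\<in>insert x S. a r) * (\<Prod>r\<in>insert x R - insert x S. b r))"
    unfolding Pow_insert using insert(1,2)
    by (subst sum.union_disjoint) (auto simp: sum.reindex[OF inj])
  also have "(\<Sum>S\<in>Pow R. (\<Prod>r\<in>S. a r) * (\<Prod>r\<in>insert x R - S. b r)) =
      (\<Sum>S\<in>Pow R. b x * ((\<Prod>r\<in>S. a r) * (\<Prod>r\<in>R - S. b r)))"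
  proof (intro sum.cong refl)
    fix S assume "S \<in> Pow R"
    then have "insert x R - S = insert x (R - S)" "x \<notin> R - S" using insert(2) by auto
    then show "(\<Prod>r\<in>S. a r) * (\<Prod>r\<in>insert x R - S. b r) = b x * ((\<Prod>r\<in>S. a r) * (\<Prod>r\<in>R - S. b r))"
      using insert(1) by simp
  qed
  also have "(\<Sum>S\<in>Pow R. (\<Prod>r\<in>insert x S. a r) * (\<Prod>r\<in>insert x R - insert x S. b r)) =
      (\<Sum>S\<in>Pow R. a x * ((\<Prod>r\<in>S. a r) * (\<Prod>r\<in>R - S. b r)))"
  proof (intro sum.cong refl)
    fix S assume S: "S \<in> Pow R"
    then have "insert x R - insert x S = R - S" "x \<notin> S" using insert(2) by auto
    then show "(\<Prod>r\<in>insert x S. a r) * (\<Prod>r\<in>insert x R - insert x S. b r) = a x * ((\<Prod>r\<in>S. a r) * (\<Prod>r\<in>R - S. b r))"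
      using fin S by simp
  qed
  finally show ?case using insert by (simp add: distrib_right sum_distrib_left sum.distrib)
qed simp

definition centered_joint :: "('e \<Rightarrow> nat \<Rightarrow> real) \<Rightarrow> (nat \<times> nat \<Rightarrow> 'e) \<Rightarrow> nat \<Rightarrow> nat set \<Rightarrow> real" where
  "centered_joint \<mu> \<epsilon> k R =
    (\<Sum>S\<in>Pow R. joint \<mu> \<epsilon> (S \<times> {..<k}) * (\<Prod>r\<in>R - S. - joint \<mu> \<epsilon> ({r} \<times> {..<k})))"

lemma centered_joint_eq_0:
  assumes R: "finite R" "r0 \<in> R"
    and isol: "\<epsilon> ` ({r0} \<times> {..<k}) \<inter> \<epsilon> ` ((R - {r0}) \<times> {..<k}) = {}"
  shows "centered_joint \<mu> \<epsilon> k R = 0"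
proof -
  define R' where "R' = R - {r0}"
  have R': "R = insert r0 R'" "r0 \<notin> R'" "finite R'" using R by (auto simp: R'_def)
  let ?c = "\<lambda>r. joint \<mu> \<epsilon> ({r} \<times> {..<k})" and ?f = "\<lambda>S. joint \<mu> \<epsilon> (S \<times> {..<k})"
  let ?t = "\<lambda>S. ?f S * (\<Prod>r\<in>R - S. - ?c r)"
  have inj: "inj_on (insert r0) (Pow R')" using R'(2) by (intro inj_onI) (metis PowD insert_ident subsetD)
  have "centered_joint \<mu> \<epsilon> k R = (\<Sum>S\<in>Pow R' \<union> insert r0 ` Pow R'. ?t S)"
    unfolding centered_joint_def R'(1) Pow_insert ..
  also have "\<dots> = (\<Sum>S\<in>Pow R'. ?t S) + (\<Sum>S\<in>insert r0 ` Pow R'. ?t S)"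
    using R' by (intro sum.union_disjoint) auto
  also have "\<dots> = (\<Sum>S\<in>Pow R'. ?t S + ?t (insert r0 S))"
    by (simp add: sum.reindex[OF inj] sum.distrib)
  also have "\<dots> = 0"
  proof (intro sum.neutral ballI)
    fix S assume S: "S \<in> Pow R'"
    then have "R - S = insert r0 (R' - S)" "R - insert r0 S = R' - S" "r0 \<notin> R' - S" "finite S"
      using R' finite_subset by auto
    moreover have "?f (insert r0 S) = ?c r0 * ?f S"
    proof -
      have "insert r0 S \<times> {..<k} = {r0} \<times> {..<k} \<union> S \<times> {..<k}" by auto
      moreover have "\<epsilon> ` ({r0} \<times> {..<k}) \<inter> \<epsilon> ` (S \<times> {..<k}) = {}"
      proof -
        have "\<epsilon> ` (S \<times> {..<k}) \<subseteq> \<epsilon> ` ((R - {r0}) \<times> {..<k})" using S by (intro image_mono) (auto simp: R'_def)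
        then show ?thesis using isol by blast
      qed
      ultimately show ?thesis using \<open>finite S\<close> by (simp add: joint_Un)
    qed
    ultimately show "?t S + ?t (insert r0 S) = 0" using R'(3) by simp
  qed
  finally show ?thesis .
qed

lemma abs_centered_joint_le:
  assumes R: "finite R" and \<delta>: "0 \<le> \<delta>" "\<delta> \<le> 1"
    and \<mu>: "\<And>e p. e \<in> \<epsilon> ` (R \<times> {..<k}) \<Longrightarrow> 1 \<le> p \<Longrightarrow> p \<le> card R * k \<Longrightarrow> \<bar>\<mu> e p\<bar> \<le> \<delta>"
  shows "\<bar>centered_joint \<mu> \<epsilon> k R\<bar> \<le> 2 ^ card R * \<delta> ^ card (\<epsilon> ` (R \<times> {..<k}))"
proof -
  let ?E = "\<lambda>S. \<epsilon> ` (S \<times> {..<k})"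
  have bound: "\<bar>joint \<mu> \<epsilon> (S \<times> {..<k})\<bar> \<le> \<delta> ^ card (?E S)" if S: "S \<subseteq> R" for S
  proof (rule abs_joint_le)
    show "finite (S \<times> {..<k})" using S R finite_subset by auto
    fix e p assume e: "e \<in> ?E S" and p: "1 \<le> p" "p \<le> card (S \<times> {..<k})"
    have "card (S \<times> {..<k}) \<le> card R * k"
      using S R by (simp add: card_cartesian_product card_mono)
    then show "\<bar>\<mu> e p\<bar> \<le> \<delta>" using e p S by (intro \<mu>) auto
  qed
  have tbound: "\<bar>joint \<mu> \<epsilon> (S \<times> {..<k}) * (\<Prod>r\<in>R - S. - joint \<mu> \<epsilon> ({r} \<times> {..<k}))\<bar> \<le> \<delta> ^ card (?E R)"
    if S: "S \<in> Pow R" for S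
  proof -
    have fS: "finite S" using S R finite_subset by auto
    have "\<bar>joint \<mu> \<epsilon> (S \<times> {..<k}) * (\<Prod>r\<in>R - S. - joint \<mu> \<epsilon> ({r} \<times> {..<k}))\<bar> =
       \<bar>joint \<mu> \<epsilon> (S \<times> {..<k})\<bar> * (\<Prod>r\<in>R - S. \<bar>joint \<mu> \<epsilon> ({r} \<times> {..<k})\<bar>)"
      by (simp add: abs_mult abs_prod)
    also have "\<dots> \<le> \<delta> ^ card (?E S) * (\<Prod>r\<in>R - S. \<delta> ^ card (?E {r}))"
      using S \<delta> by (intro mult_mono prod_mono bound conjI prod_nonneg) auto
    also have "\<dots> = \<delta> ^ (card (?E S) + (\<Sum>r\<in>R - S. card (?E {r})))"
      by (simp add: power_add power_sum)
    also have "\<dots> \<le> \<delta> ^ card (?E R)"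
    proof (rule power_decreasing)
      have "?E R = ?E S \<union> (\<Union>r\<in>R - S. ?E {r})" using S by (auto simp: image_iff)
      also have "card \<dots> \<le> card (?E S) + card (\<Union>r\<in>R - S. ?E {r})" by (rule card_Un_le)
      also have "card (\<Union>r\<in>R - S. ?E {r}) \<le> (\<Sum>r\<in>R - S. card (?E {r}))" using R by (intro card_UN_le) auto
      finally show "card (?E R) \<le> card (?E S) + (\<Sum>r\<in>R - S. card (?E {r}))" by simp
    qed (use \<delta> in auto)
    finally show ?thesis .
  qed
  have "\<bar>centered_joint \<mu> \<epsilon> k R\<bar> \<le> (\<Sum>S\<in>Pow R. \<delta> ^ card (?E R))"
    unfolding centered_joint_def by (rule order_trans[OF sum_abs sum_mono[OF tbound]])
  then show ?thesis using R by (simp add: card_Pow)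
qed

lemma (in prob_space) expectation_centered_prod:
  fixes Z :: "'e \<Rightarrow> 'a \<Rightarrow> real"
  assumes indep: "indep_vars (\<lambda>_. borel) Z E" and int: "\<And>e p. e \<in> E \<Longrightarrow> integrable M (\<lambda>\<omega>. Z e \<omega> ^ p)"
    and R: "finite R" "\<epsilon> ` (R \<times> {..<k}) \<subseteq> E"
  defines "\<mu> \<equiv> \<lambda>e p. expectation (\<lambda>\<omega>. Z e \<omega> ^ p)"
  shows "integrable M (\<lambda>\<omega>. \<Prod>r\<in>R. (\<Prod>j<k. Z (\<epsilon> (r, j)) \<omega>) - joint \<mu> \<epsilon> ({r} \<times> {..<k}))"
    and "expectation (\<lambda>\<omega>. \<Prod>r\<in>R. (\<Prod>j<k. Z (\<epsilon> (r, j)) \<omega>) - joint \<mu> \<epsilon> ({r} \<times> {..<k})) = centered_joint \<mu> \<epsilon> k R"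
proof -
  let ?c = "\<lambda>r. joint \<mu> \<epsilon> ({r} \<times> {..<k})"
  have eq: "(\<Prod>r\<in>R. (\<Prod>j<k. Z (\<epsilon> (r, j)) \<omega>) - ?c r) =
      (\<Sum>S\<in>Pow R. (\<Prod>x\<in>S \<times> {..<k}. Z (\<epsilon> x) \<omega>) * (\<Prod>r\<in>R - S. - ?c r))" for \<omega>
    using prod_add_Pow[OF R(1), of "\<lambda>r. \<Prod>j<k. Z (\<epsilon> (r, j)) \<omega>" "\<lambda>r. - ?c r"]
    by (simp add: prod.cartesian_product)
  have *: "integrable M (\<lambda>\<omega>. \<Prod>x\<in>S \<times> {..<k}. Z (\<epsilon> x) \<omega>)"
    "expectation (\<lambda>\<omega>. \<Prod>x\<in>S \<times> {..<k}. Z (\<epsilon> x) \<omega>) = joint \<mu> \<epsilon> (S \<times> {..<k})" if "S \<in> Pow R" for S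
    unfolding \<mu>_def using that R finite_subset[of S R]
    by (intro expectation_prod_edges[OF indep int]; force)+
  show "integrable M (\<lambda>\<omega>. \<Prod>r\<in>R. (\<Prod>j<k. Z (\<epsilon> (r, j)) \<omega>) - ?c r)"
    unfolding eq by (intro Bochner_Integration.integrable_sum integrable_mult_left *)
  show "expectation (\<lambda>\<omega>. \<Prod>r\<in>R. (\<Prod>j<k. Z (\<epsilon> (r, j)) \<omega>) - ?c r) = centered_joint \<mu> \<epsilon> k R"
    unfolding eq centered_joint_def
    by (subst Bochner_Integration.integral_sum) (auto intro!: integrable_mult_left * sum.cong simp: *)
qed

lemma (in prob_space) AE_tendsto_zero_of_fourth_moments:
  assumes meas: "\<And>n. Y n \<in> borel_measurable M"
    and bound: "\<forall>\<^sub>F n in sequentially. integrable M (\<lambda>\<omega>. Y n \<omega> ^ 4) \<and>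
      expectation (\<lambda>\<omega>. Y n \<omega> ^ 4) \<le> C * real n powr (- 3 / 2)"
  shows "AE \<omega> in M. (\<lambda>n. Y n \<omega>) \<longlonglongrightarrow> 0"
proof -
  obtain N where N: "\<And>n. N \<le> n \<Longrightarrow> integrable M (\<lambda>\<omega>. Y n \<omega> ^ 4)"
      "\<And>n. N \<le> n \<Longrightarrow> expectation (\<lambda>\<omega>. Y n \<omega> ^ 4) \<le> C * real n powr (- 3 / 2)"
    using bound unfolding eventually_sequentially by blast
  note meas[measurable]
  have "(\<integral>\<^sup>+\<omega>. (\<Sum>n. ennreal (Y (n + N) \<omega> ^ 4)) \<partial>M) = (\<Sum>n. \<integral>\<^sup>+\<omega>. ennreal (Y (n + N) \<omega> ^ 4) \<partial>M)"
    by (rule nn_integral_suminf) simp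
  also have "\<dots> = (\<Sum>n. ennreal (expectation (\<lambda>\<omega>. Y (n + N) \<omega> ^ 4)))"
    using N(1) by (intro suminf_cong nn_integral_eq_integral) auto
  also have "\<dots> \<noteq> \<infinity>"
    unfolding infinity_ennreal_def
  proof (rule ennreal_suminf_neq_top)
    have "summable (\<lambda>n. C * real (n + N) powr (- 3 / 2))"
      by (intro summable_mult summable_ignore_initial_segment[of "\<lambda>n. real n powr (- 3 / 2)"])
        (simp add: summable_real_powr_iff)
    then show "summable (\<lambda>n. expectation (\<lambda>\<omega>. Y (n + N) \<omega> ^ 4))"
    proof (rule summable_comparison_test')
      show "norm (expectation (\<lambda>\<omega>. Y (n + N) \<omega> ^ 4)) \<le> C * real (n + N) powr (- 3 / 2)" for n
        using N(2)[of "n + N"] by simp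
    qed
  qed simp
  finally have "AE \<omega> in M. (\<Sum>n. ennreal (Y (n + N) \<omega> ^ 4)) \<noteq> \<infinity>"
    by (intro nn_integral_PInf_AE) auto
  then show ?thesis
  proof eventually_elim
    case (elim \<omega>)
    then have "summable (\<lambda>n. Y (n + N) \<omega> ^ 4)"
      unfolding infinity_ennreal_def by (intro summable_suminf_not_top) auto
    then have "(\<lambda>n. Y (n + N) \<omega> ^ 4) \<longlonglongrightarrow> 0" by (rule summable_LIMSEQ_zero)
    then have "(\<lambda>n. Y (n + N) \<omega>) \<longlonglongrightarrow> 0" by simp
    then show ?case by (rule LIMSEQ_offset)
  qed
qed

abbreviation walks :: "nat \<Rightarrow> nat \<Rightarrow> (nat \<Rightarrow> nat) set" where
  "walks k n \<equiv> {..<k} \<rightarrow>\<^sub>E {..<n}"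

definition pairs :: "nat \<Rightarrow> nat set set" where
  "pairs n = {{a, b} | a b. a < n \<and> b < n}"

definition closed_walk_sum :: "(nat set \<Rightarrow> 'a \<Rightarrow> real) \<Rightarrow> nat \<Rightarrow> nat \<Rightarrow> 'a \<Rightarrow> real" where
  "closed_walk_sum Z k n \<omega> = (\<Sum>i\<in>walks k n. \<Prod>j<k. Z (cedge k i j) \<omega>)"

lemma cedge_pairs: "i \<in> walks k n \<Longrightarrow> j < k \<Longrightarrow> cedge k i j \<in> pairs n"
  unfolding cedge_def pairs_def by (rule CollectI, rule exI, rule exI, rule conjI[OF refl]) (auto simp: PiE_def Pi_def)

lemma walk_image: "i \<in> walks k n \<Longrightarrow> i ` {..<k} \<subseteq> {..<n}"
  by (auto simp: PiE_def Pi_def)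

lemma joint_cedge: "joint \<mu> (cedge k i) {..<k} = (\<Prod>e\<in>cedges k i. \<mu> e (edge_mult k i e))"
  by (simp add: joint_def cedges_def edge_mult_def)

lemma joint_slice: "joint \<mu> \<epsilon> ({r} \<times> J) = joint \<mu> (\<lambda>j. \<epsilon> (r, j)) J"
proof -
  have "{x \<in> {r} \<times> J. \<epsilon> x = e} = Pair r ` {j \<in> J. \<epsilon> (r, j) = e}" for e by auto
  then have "card {x \<in> {r} \<times> J. \<epsilon> x = e} = card {j \<in> J. \<epsilon> (r, j) = e}" for e
    by (simp add: card_image inj_on_def)
  moreover have "\<epsilon> ` ({r} \<times> J) = (\<lambda>j. \<epsilon> (r, j)) ` J" by auto
  ultimately show ?thesis by (simp add: joint_def)
qed

locale sparse_symmetric = prob_space M for M :: "'a measure" +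
  fixes Z :: "nat set \<Rightarrow> 'a \<Rightarrow> real" and n k :: nat and \<gamma> :: real
  assumes indep: "indep_vars (\<lambda>_. borel) Z (pairs n)"
    and int: "\<And>e p. e \<in> pairs n \<Longrightarrow> integrable M (\<lambda>\<omega>. Z e \<omega> ^ p)"
    and n: "0 < n" and k: "0 < k" and \<gamma>: "0 \<le> \<gamma>" "\<gamma> \<le> 1"
    and small: "\<And>e p. e \<in> pairs n \<Longrightarrow> 1 \<le> p \<Longrightarrow> p \<le> 4 * k \<Longrightarrow> \<bar>expectation (\<lambda>\<omega>. Z e \<omega> ^ p)\<bar> \<le> real n powr - \<gamma>"
begin

abbreviation mom :: "nat set \<Rightarrow> nat \<Rightarrow> real" where
  "mom e p \<equiv> expectation (\<lambda>\<omega>. Z e \<omega> ^ p)"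

abbreviation "\<delta> \<equiv> real n powr - \<gamma>"

lemma \<delta>: "0 \<le> \<delta>" "\<delta> \<le> 1"
  using n \<gamma> powr_mono[of "- \<gamma>" 0 "real n"] by auto

lemma finite_walks: "finite (walks k n)"
  by (intro finite_PiE) auto

lemma expectation_walk:
  assumes "i \<in> walks k n"
  shows "integrable M (\<lambda>\<omega>. \<Prod>j<k. Z (cedge k i j) \<omega>)"
    and "expectation (\<lambda>\<omega>. \<Prod>j<k. Z (cedge k i j) \<omega>) = (\<Prod>e\<in>cedges k i. mom e (edge_mult k i e))"
proof -
  have *: "cedge k i ` {..<k} \<subseteq> pairs n" using cedge_pairs[OF assms] by auto
  show "integrable M (\<lambda>\<omega>. \<Prod>j<k. Z (cedge k i j) \<omega>)"
    by (rule expectation_prod_edges(1)[OF indep int _ *]) auto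
  show "expectation (\<lambda>\<omega>. \<Prod>j<k. Z (cedge k i j) \<omega>) = (\<Prod>e\<in>cedges k i. mom e (edge_mult k i e))"
    using expectation_prod_edges(2)[OF indep int _ *] by (simp add: joint_cedge)
qed

lemma expectation_closed_walk_sum:
  "expectation (closed_walk_sum Z k n) = (\<Sum>i\<in>walks k n. \<Prod>e\<in>cedges k i. mom e (edge_mult k i e))"
  unfolding closed_walk_sum_def
  by (subst Bochner_Integration.integral_sum) (simp_all add: expectation_walk)

lemma non_tree_walks_negligible:
  "\<bar>expectation (closed_walk_sum Z k n) - (\<Sum>i\<in>{i \<in> walks k n. ctree k i}. \<Prod>e\<in>cedges k i. mom e (edge_mult k i e))\<bar>
    \<le> real (k ^ k) * real (Suc k) * real n powr ((1 - \<gamma>) * real k)"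
proof -
  let ?w = "\<lambda>i. \<Prod>e\<in>cedges k i. mom e (edge_mult k i e)" and ?N = "{i \<in> walks k n. \<not> ctree k i}"
  have "(\<Sum>i\<in>walks k n. ?w i) = (\<Sum>i\<in>{i \<in> walks k n. ctree k i} \<union> ?N. ?w i)"
    by (intro sum.cong) auto
  also have "\<dots> = (\<Sum>i\<in>{i \<in> walks k n. ctree k i}. ?w i) + (\<Sum>i\<in>?N. ?w i)"
    using finite_walks by (intro sum.union_disjoint) auto
  finally have "\<bar>expectation (closed_walk_sum Z k n) - (\<Sum>i\<in>{i \<in> walks k n. ctree k i}. ?w i)\<bar> = \<bar>\<Sum>i\<in>?N. ?w i\<bar>"
    by (simp add: expectation_closed_walk_sum)
  also have "\<dots> \<le> (\<Sum>i\<in>?N. \<delta> ^ card (cedges k i))"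
  proof (rule order_trans[OF sum_abs sum_mono])
    fix i assume i: "i \<in> ?N"
    have "\<bar>joint mom (cedge k i) {..<k}\<bar> \<le> \<delta> ^ card (cedge k i ` {..<k})"
      using cedge_pairs[of i k n] i by (intro abs_joint_le small) auto
    then show "\<bar>?w i\<bar> \<le> \<delta> ^ card (cedges k i)" by (simp add: joint_cedge cedges_def[symmetric])
  qed
  also have "\<dots> \<le> real (k ^ k) * real (Suc k) * real n powr (real 0 + (1 - \<gamma>) * real k)"
  proof (rule sum_power_le_by_image_size[where V = "\<lambda>i. i ` {..<k}"])
    show "finite ?N" using finite_walks by simp
    show "i ` {..<k} \<subseteq> {..<n}" if "i \<in> ?N" for i using that walk_image[of i k n] by simp
    show "card (i ` {..<k}) \<le> k" for i :: "nat \<Rightarrow> nat" using card_image_le[of "{..<k}" i] by simp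
    show "card (i ` {..<k}) \<le> card (cedges k i) + 0" if "i \<in> ?N" for i
      using that card_closed_walk_vertices[OF k, of i] by (simp add: ctree_def)
    show "card {i \<in> ?N. i ` {..<k} = S} \<le> k ^ k" if S: "finite S" "card S \<le> k" for S
    proof -
      have "{i \<in> ?N. i ` {..<k} = S} \<subseteq> {..<k} \<rightarrow>\<^sub>E S" by (auto simp: PiE_def)
      then have "card {i \<in> ?N. i ` {..<k} = S} \<le> card ({..<k} \<rightarrow>\<^sub>E S)"
        using S by (intro card_mono finite_PiE) auto
      also have "\<dots> = card S ^ k" by (simp add: card_funcsetE)
      also have "\<dots> \<le> k ^ k" using S by (intro power_mono) auto
      finally show ?thesis .
    qed
  qed (use n \<gamma> in auto)
  finally show ?thesis by simp
qed

lemma fourth_moment_closed_walk_sum: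
  shows "integrable M (\<lambda>\<omega>. (closed_walk_sum Z k n \<omega> - expectation (closed_walk_sum Z k n)) ^ 4)"
    and "expectation (\<lambda>\<omega>. (closed_walk_sum Z k n \<omega> - expectation (closed_walk_sum Z k n)) ^ 4)
      \<le> 16 * (real (((4 * k) ^ k) ^ 4) * real (Suc (4 * k)) * real n powr (2 + (1 - \<gamma>) * real (4 * k)))"
proof -
  let ?F = "{..<4::nat} \<rightarrow>\<^sub>E walks k n"
  define \<epsilon> where "\<epsilon> f = (\<lambda>(r, j). cedge k (f r) j)" for f :: "nat \<Rightarrow> nat \<Rightarrow> nat"
  let ?X = "\<lambda>f \<omega>. \<Prod>r<4. (\<Prod>j<k. Z (\<epsilon> f (r, j)) \<omega>) - joint mom (\<epsilon> f) ({r} \<times> {..<k})"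
  have finF: "finite ?F" using finite_walks by (intro finite_PiE) auto
  have \<epsilon>E: "\<epsilon> f ` (R \<times> {..<k}) = (\<Union>r\<in>R. cedges k (f r))" for f R
    by (auto simp: \<epsilon>_def cedges_def image_iff)
  have \<epsilon>_pairs: "\<epsilon> f ` ({..<4} \<times> {..<k}) \<subseteq> pairs n" if f: "f \<in> ?F" for f
  proof -
    have "cedge k (f r) j \<in> pairs n" if "r < 4" "j < k" for r j
      using cedge_pairs[of "f r" k n j] f that by (auto simp: PiE_def Pi_def)
    then show ?thesis by (auto simp: \<epsilon>_def)
  qed
  have expand: "(closed_walk_sum Z k n \<omega> - expectation (closed_walk_sum Z k n)) ^ 4 = (\<Sum>f\<in>?F. ?X f \<omega>)" for \<omega>
  proof -
    let ?d = "\<lambda>i. (\<Prod>j<k. Z (cedge k i j) \<omega>) - joint mom (cedge k i) {..<k}"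
    have "closed_walk_sum Z k n \<omega> - expectation (closed_walk_sum Z k n) = (\<Sum>i\<in>walks k n. ?d i)"
      by (simp add: expectation_closed_walk_sum joint_cedge closed_walk_sum_def sum_subtractf)
    then have "(closed_walk_sum Z k n \<omega> - expectation (closed_walk_sum Z k n)) ^ 4 = (\<Prod>r<4::nat. \<Sum>i\<in>walks k n. ?d i)"
      by simp
    also have "\<dots> = (\<Sum>f\<in>?F. \<Prod>r<4. ?d (f r))"
      using finite_walks by (subst prod_sum_PiE) auto
    finally show ?thesis by (simp add: joint_slice \<epsilon>_def)
  qed
  note cen = expectation_centered_prod[OF indep int finite_lessThan \<epsilon>_pairs]
  show "integrable M (\<lambda>\<omega>. (closed_walk_sum Z k n \<omega> - expectation (closed_walk_sum Z k n)) ^ 4)"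
    unfolding expand using cen(1) by (intro Bochner_Integration.integrable_sum)
  define G where "G = {f \<in> ?F. \<forall>r<4. \<exists>s<4. s \<noteq> r \<and> cedges k (f r) \<inter> cedges k (f s) \<noteq> {}}"
  have finG: "finite G" using finF by (simp add: G_def)
  have "expectation (\<lambda>\<omega>. (closed_walk_sum Z k n \<omega> - expectation (closed_walk_sum Z k n)) ^ 4) =
      (\<Sum>f\<in>?F. centered_joint mom (\<epsilon> f) k {..<4})"
    unfolding expand using cen by (subst Bochner_Integration.integral_sum) (auto intro!: sum.cong)
  also have "\<dots> = (\<Sum>f\<in>G. centered_joint mom (\<epsilon> f) k {..<4})"
  proof (rule sum.mono_neutral_right[OF finF])
    show "\<forall>f\<in>?F - G. centered_joint mom (\<epsilon> f) k {..<4} = 0"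
    proof
      fix f assume "f \<in> ?F - G"
      then obtain r where r: "r < 4" "\<And>s. s < 4 \<Longrightarrow> s \<noteq> r \<Longrightarrow> cedges k (f r) \<inter> cedges k (f s) = {}"
        unfolding G_def by blast
      show "centered_joint mom (\<epsilon> f) k {..<4} = 0"
      proof (rule centered_joint_eq_0[of _ r])
        show "\<epsilon> f ` ({r} \<times> {..<k}) \<inter> \<epsilon> f ` (({..<4} - {r}) \<times> {..<k}) = {}"
          by (simp add: \<epsilon>E Int_UN_distrib r(2))
      qed (use r in auto)
    qed
  qed (auto simp: G_def)
  also have "\<dots> \<le> (\<Sum>f\<in>G. 16 * \<delta> ^ card (\<Union>r<4. cedges k (f r)))"
  proof (rule sum_mono)
    fix f assume "f \<in> G"
    then have f: "f \<in> ?F" by (simp add: G_def)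
    have "\<bar>centered_joint mom (\<epsilon> f) k {..<4}\<bar> \<le> 2 ^ card {..<4::nat} * \<delta> ^ card (\<epsilon> f ` ({..<4} \<times> {..<k}))"
      by (rule abs_centered_joint_le[OF _ \<delta>]) (use \<epsilon>_pairs[OF f] small in auto)
    then show "centered_joint mom (\<epsilon> f) k {..<4} \<le> 16 * \<delta> ^ card (\<Union>r<4. cedges k (f r))"
      unfolding \<epsilon>E by simp
  qed
  also have "\<dots> = 16 * (\<Sum>f\<in>G. \<delta> ^ card (\<Union>r<4. cedges k (f r)))" by (simp add: sum_distrib_left)
  also have "(\<Sum>f\<in>G. \<delta> ^ card (\<Union>r<4. cedges k (f r))) \<le>
      real (((4 * k) ^ k) ^ 4) * real (Suc (4 * k)) * real n powr (real 2 + (1 - \<gamma>) * real (4 * k))"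
  proof (rule sum_power_le_by_image_size[where V = "\<lambda>f. \<Union>r<4. f r ` {..<k}"])
    show "finite G" by (rule finG)
    show "(\<Union>r<4. f r ` {..<k}) \<subseteq> {..<n}" if "f \<in> G" for f
      using that walk_image[of "f _" k n] by (fastforce simp: G_def PiE_def Pi_def)
    show "card (\<Union>r<4. f r ` {..<k}) \<le> 4 * k" for f :: "nat \<Rightarrow> nat \<Rightarrow> nat"
    proof -
      have "card (\<Union>r<4. f r ` {..<k}) \<le> (\<Sum>r<4. card (f r ` {..<k}))" by (rule card_UN_le) simp
      also have "\<dots> \<le> (\<Sum>r<4::nat. k)" by (intro sum_mono) (metis card_image_le card_lessThan finite_lessThan)
      finally show ?thesis by simp
    qed
    show "card (\<Union>r<4. f r ` {..<k}) \<le> card (\<Union>r<4. cedges k (f r)) + 2" if "f \<in> G" for f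
      by (rule card_four_walks_of_shared_edges[OF k]) (use that in \<open>simp add: G_def\<close>)
    show "card {f \<in> G. (\<Union>r<4. f r ` {..<k}) = S} \<le> ((4 * k) ^ k) ^ 4" if S: "finite S" "card S \<le> 4 * k" for S
    proof -
      have "{f \<in> G. (\<Union>r<4. f r ` {..<k}) = S} \<subseteq> {..<4} \<rightarrow>\<^sub>E ({..<k} \<rightarrow>\<^sub>E S)"
      proof
        fix f assume f: "f \<in> {f \<in> G. (\<Union>r<4. f r ` {..<k}) = S}"
        have "f r \<in> {..<k} \<rightarrow>\<^sub>E S" if "r < 4" for r
          using f that by (auto simp: G_def PiE_def Pi_def)
        then show "f \<in> {..<4} \<rightarrow>\<^sub>E ({..<k} \<rightarrow>\<^sub>E S)" using f by (auto simp: G_def PiE_def)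
      qed
      then have "card {f \<in> G. (\<Union>r<4. f r ` {..<k}) = S} \<le> card ({..<4::nat} \<rightarrow>\<^sub>E ({..<k} \<rightarrow>\<^sub>E S))"
        using S by (intro card_mono finite_PiE) auto
      also have "\<dots> = (card S ^ k) ^ 4" by (simp add: card_funcsetE)
      also have "\<dots> \<le> ((4 * k) ^ k) ^ 4" using S by (intro power_mono) auto
      finally show ?thesis .
    qed
  qed (use n \<gamma> in auto)
  finally show "expectation (\<lambda>\<omega>. (closed_walk_sum Z k n \<omega> - expectation (closed_walk_sum Z k n)) ^ 4)
      \<le> 16 * (real (((4 * k) ^ k) ^ 4) * real (Suc (4 * k)) * real n powr (2 + (1 - \<gamma>) * real (4 * k)))"
    by simp
qed

end

subsection \<open>Homomorphism densities\<close>

definition dens :: "nat \<Rightarrow> nat set \<Rightarrow> nat set set \<Rightarrow> (nat set \<Rightarrow> nat \<Rightarrow> nat \<Rightarrow> real) \<Rightarrow> real" where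
  "dens n V E f = (\<Sum>q\<in>V \<rightarrow>\<^sub>E {..<n}. \<Prod>e\<in>E. f e (q (Min e)) (q (Max e))) / real n ^ card V"

definition simple_graph :: "nat set \<Rightarrow> nat set set \<Rightarrow> bool" where
  "simple_graph V E \<longleftrightarrow> finite V \<and> (\<forall>e\<in>E. \<exists>a\<in>V. \<exists>b\<in>V. a \<noteq> b \<and> e = {a, b})"

definition mean_abs :: "nat \<Rightarrow> (nat \<Rightarrow> nat \<Rightarrow> real) \<Rightarrow> real" where
  "mean_abs n F = (\<Sum>a<n. \<Sum>b<n. \<bar>F a b\<bar>) / (real n)\<^sup>2"

lemma simple_graphD:
  assumes "simple_graph V E"
  shows "finite V" "finite E" "e \<in> E \<Longrightarrow> Min e \<in> V" "e \<in> E \<Longrightarrow> Max e \<in> V" "e \<in> E \<Longrightarrow> Min e \<noteq> Max e"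
proof -
  show V: "finite V" using assms by (simp add: simple_graph_def)
  have "E \<subseteq> Pow V" using assms by (auto simp: simple_graph_def)
  then show "finite E" using V finite_subset by blast
  have "Min e \<in> V \<and> Max e \<in> V \<and> Min e \<noteq> Max e" if e: "e \<in> E"
  proof -
    obtain a b where ab: "a \<in> V" "b \<in> V" "a \<noteq> b" "e = {a, b}" using assms e unfolding simple_graph_def by blast
    then have "Min e = min a b" "Max e = max a b" by auto
    then show ?thesis using ab by (auto simp: min_def max_def)
  qed
  then show "e \<in> E \<Longrightarrow> Min e \<in> V" "e \<in> E \<Longrightarrow> Max e \<in> V" "e \<in> E \<Longrightarrow> Min e \<noteq> Max e" by auto
qed

lemma sum_PiE_two_coordinates:
  fixes F :: "nat \<Rightarrow> nat \<Rightarrow> real"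
  assumes V: "finite V" "a \<in> V" "b \<in> V" "a \<noteq> b"
  shows "(\<Sum>q\<in>V \<rightarrow>\<^sub>E {..<n}. F (q a) (q b)) = real n ^ (card V - 2) * (\<Sum>x<n. \<Sum>y<n. F x y)"
proof -
  have count: "(\<Sum>q\<in>V \<rightarrow>\<^sub>E {..<n}. of_bool (q a = x) * of_bool (q b = y)) = real n ^ (card V - 2)"
    if xy: "x < n" "y < n" for x y
  proof -
    define \<phi> where "\<phi> v z = (if v = a then of_bool (z = x) else if v = b then of_bool (z = y) else 1 :: real)" for v z
    have "(\<Prod>v\<in>V. \<phi> v (q v)) = of_bool (q a = x) * of_bool (q b = y)" for q
    proof -
      have "(\<Prod>v\<in>V. \<phi> v (q v)) = \<phi> a (q a) * (\<phi> b (q b) * (\<Prod>v\<in>V - {a} - {b}. \<phi> v (q v)))"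
        using V by (subst prod.remove[of V a], simp, simp, subst prod.remove[of "V - {a}" b]) auto
      also have "(\<Prod>v\<in>V - {a} - {b}. \<phi> v (q v)) = 1" by (intro prod.neutral) (auto simp: \<phi>_def)
      finally show ?thesis using V(4) by (simp add: \<phi>_def)
    qed
    then have "(\<Sum>q\<in>V \<rightarrow>\<^sub>E {..<n}. of_bool (q a = x) * of_bool (q b = y)) = (\<Sum>q\<in>V \<rightarrow>\<^sub>E {..<n}. \<Prod>v\<in>V. \<phi> v (q v))"
      by simp
    also have "\<dots> = (\<Prod>v\<in>V. \<Sum>z<n. \<phi> v z)" using V(1) by (simp add: prod_sum_PiE)
    also have "\<dots> = (\<Sum>z<n. \<phi> a z) * ((\<Sum>z<n. \<phi> b z) * (\<Prod>v\<in>V - {a} - {b}. \<Sum>z<n. \<phi> v z))"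
      using V by (subst prod.remove[of V a], simp, simp, subst prod.remove[of "V - {a}" b]) auto
    also have "(\<Sum>z<n. \<phi> a z) = 1" using xy by (simp add: \<phi>_def of_bool_def)
    also have "(\<Sum>z<n. \<phi> b z) = 1" using xy V(4) by (simp add: \<phi>_def of_bool_def)
    also have "(\<Prod>v\<in>V - {a} - {b}. \<Sum>z<n. \<phi> v z) = (\<Prod>v\<in>V - {a} - {b}. real n)"
      by (intro prod.cong) (auto simp: \<phi>_def)
    also have "\<dots> = real n ^ (card V - 2)" using V by (simp add: card_Diff_singleton numeral_2_eq_2)
    finally show ?thesis by simp
  qed
  have "(\<Sum>q\<in>V \<rightarrow>\<^sub>E {..<n}. F (q a) (q b)) =
      (\<Sum>q\<in>V \<rightarrow>\<^sub>E {..<n}. \<Sum>x<n. \<Sum>y<n. F x y * (of_bool (q a = x) * of_bool (q b = y)))"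
  proof (rule sum.cong[OF refl])
    fix q assume "q \<in> V \<rightarrow>\<^sub>E {..<n}"
    then have "q a < n" "q b < n" using V by (auto simp: PiE_def Pi_def)
    note lt = this
    have "(\<Sum>y<n. F x y * (of_bool (q a = x) * of_bool (q b = y))) = (if q a = x then F x (q b) else 0)" for x
    proof -
      have "(\<Sum>y<n. F x y * (of_bool (q a = x) * of_bool (q b = y))) =
          (\<Sum>y<n. if q b = y then F x y * of_bool (q a = x) else 0)"
        by (intro sum.cong) auto
      then show ?thesis using lt by simp
    qed
    then show "F (q a) (q b) = (\<Sum>x<n. \<Sum>y<n. F x y * (of_bool (q a = x) * of_bool (q b = y)))"
      using lt by simp
  qed
  also have "\<dots> = (\<Sum>x<n. \<Sum>y<n. \<Sum>q\<in>V \<rightarrow>\<^sub>E {..<n}. F x y * (of_bool (q a = x) * of_bool (q b = y)))"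
    by (rule trans[OF sum.swap], rule sum.cong[OF refl], rule sum.swap)
  also have "\<dots> = (\<Sum>x<n. \<Sum>y<n. F x y * real n ^ (card V - 2))"
    by (intro sum.cong refl) (simp add: count flip: sum_distrib_left)
  also have "\<dots> = real n ^ (card V - 2) * (\<Sum>x<n. \<Sum>y<n. F x y)"
    by (simp add: sum_distrib_left sum_distrib_right mult.commute)
  finally show ?thesis .
qed

lemma mean_over_PiE:
  assumes "finite V" "a \<in> V" "b \<in> V" "a \<noteq> b" "0 < n"
  shows "(\<Sum>q\<in>V \<rightarrow>\<^sub>E {..<n}. \<bar>F (q a) (q b)\<bar>) / real n ^ card V = mean_abs n F"
proof -
  have "card {a, b} \<le> card V" using assms by (intro card_mono) auto
  then have "card V = (card V - 2) + 2" using assms(4) by simp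
  then have "real n ^ card V = real n ^ (card V - 2) * (real n)\<^sup>2" by (metis power_add)
  then show ?thesis
    using assms sum_PiE_two_coordinates[of V a b "\<lambda>x y. \<bar>F x y\<bar>" n] by (simp add: mean_abs_def)
qed

lemma abs_prod_diff_le:
  fixes u v :: "'e \<Rightarrow> real"
  assumes "finite E" and C: "1 \<le> C" and "\<And>e. e \<in> E \<Longrightarrow> \<bar>u e\<bar> \<le> C" "\<And>e. e \<in> E \<Longrightarrow> \<bar>v e\<bar> \<le> C"
  shows "\<bar>(\<Prod>e\<in>E. u e) - (\<Prod>e\<in>E. v e)\<bar> \<le> C ^ card E * (\<Sum>e\<in>E. \<bar>u e - v e\<bar>)"
  using assms(1,3,4)
proof (induction E)
  case (insert x E)
  have pu: "\<bar>\<Prod>e\<in>E. v e\<bar> \<le> C ^ card E"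
    using insert.prems insert.hyps prod_mono[of E "\<lambda>e. \<bar>v e\<bar>" "\<lambda>_. C"] by (auto simp: abs_prod)
  let ?D = "\<bar>(\<Prod>e\<in>E. u e) - (\<Prod>e\<in>E. v e)\<bar>" and ?S = "\<Sum>e\<in>E. \<bar>u e - v e\<bar>"
  have IH: "?D \<le> C ^ card E * ?S" using insert by auto
  have "u x * (\<Prod>e\<in>E. u e) - v x * (\<Prod>e\<in>E. v e) = u x * ((\<Prod>e\<in>E. u e) - (\<Prod>e\<in>E. v e)) + (u x - v x) * (\<Prod>e\<in>E. v e)"
    by (simp add: algebra_simps)
  also have "\<bar>\<dots>\<bar> \<le> \<bar>u x\<bar> * ?D + \<bar>u x - v x\<bar> * \<bar>\<Prod>e\<in>E. v e\<bar>"
    by (rule order_trans[OF abs_triangle_ineq]) (simp add: abs_mult)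
  also have "\<dots> \<le> C * (C ^ card E * ?S) + \<bar>u x - v x\<bar> * C ^ card E"
    using insert.prems C IH pu by (intro add_mono mult_mono) auto
  also have "\<dots> \<le> C * (C ^ card E * ?S) + \<bar>u x - v x\<bar> * (C * C ^ card E)"
    using C by (intro add_left_mono mult_left_mono) auto
  also have "\<dots> = C ^ card (insert x E) * (\<Sum>e\<in>insert x E. \<bar>u e - v e\<bar>)"
    using insert by (simp add: algebra_simps)
  finally show ?case using insert by simp
qed simp

lemma dens_diff_le:
  assumes G: "simple_graph V E" and n: "0 < n" and C: "1 \<le> C"
    and f: "\<And>e a b. e \<in> E \<Longrightarrow> a < n \<Longrightarrow> b < n \<Longrightarrow> \<bar>f e a b\<bar> \<le> C"
    and f': "\<And>e a b. e \<in> E \<Longrightarrow> a < n \<Longrightarrow> b < n \<Longrightarrow> \<bar>f' e a b\<bar> \<le> C"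
  shows "\<bar>dens n V E f - dens n V E f'\<bar> \<le> C ^ card E * (\<Sum>e\<in>E. mean_abs n (\<lambda>a b. f e a b - f' e a b))"
proof -
  note G = simple_graphD[OF G]
  let ?Q = "V \<rightarrow>\<^sub>E {..<n}"
  let ?d = "\<lambda>e q. \<bar>f e (q (Min e)) (q (Max e)) - f' e (q (Min e)) (q (Max e))\<bar>"
  have q_lt: "q v < n" if "q \<in> ?Q" "v \<in> V" for q v using that by (auto simp: PiE_def Pi_def)
  have "\<bar>(\<Sum>q\<in>?Q. \<Prod>e\<in>E. f e (q (Min e)) (q (Max e))) - (\<Sum>q\<in>?Q. \<Prod>e\<in>E. f' e (q (Min e)) (q (Max e)))\<bar> \<le>
     (\<Sum>q\<in>?Q. \<bar>(\<Prod>e\<in>E. f e (q (Min e)) (q (Max e))) - (\<Prod>e\<in>E. f' e (q (Min e)) (q (Max e)))\<bar>)"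
    unfolding sum_subtractf[symmetric] by (rule sum_abs)
  also have "\<dots> \<le> (\<Sum>q\<in>?Q. C ^ card E * (\<Sum>e\<in>E. ?d e q))"
    using G q_lt by (intro sum_mono abs_prod_diff_le C f f') auto
  also have "\<dots> = C ^ card E * (\<Sum>e\<in>E. \<Sum>q\<in>?Q. ?d e q)"
    by (subst sum.swap) (simp add: sum_distrib_left)
  finally have "\<bar>dens n V E f - dens n V E f'\<bar> \<le> C ^ card E * (\<Sum>e\<in>E. \<Sum>q\<in>?Q. ?d e q) / real n ^ card V"
    unfolding dens_def diff_divide_distrib[symmetric] abs_divide by (simp add: divide_right_mono)
  also have "\<dots> = C ^ card E * (\<Sum>e\<in>E. (\<Sum>q\<in>?Q. ?d e q) / real n ^ card V)"
    by (simp only: sum_divide_distrib[symmetric] times_divide_eq_right)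
  also have "\<dots> = C ^ card E * (\<Sum>e\<in>E. mean_abs n (\<lambda>a b. f e a b - f' e a b))"
  proof -
    have "(\<Sum>q\<in>?Q. ?d e q) / real n ^ card V = mean_abs n (\<lambda>a b. f e a b - f' e a b)" if "e \<in> E" for e
      by (rule mean_over_PiE) (use G that n in auto)
    then show ?thesis by simp
  qed
  finally show ?thesis .
qed

lemma abs_dens_le:
  assumes G: "simple_graph V E" and n: "0 < n"
    and f: "\<And>e a b. e \<in> E \<Longrightarrow> a < n \<Longrightarrow> b < n \<Longrightarrow> \<bar>f e a b\<bar> \<le> B e"
  shows "\<bar>dens n V E f\<bar> \<le> (\<Prod>e\<in>E. B e)"
proof -
  note G = simple_graphD[OF G]
  have "\<bar>\<Sum>q\<in>V \<rightarrow>\<^sub>E {..<n}. \<Prod>e\<in>E. f e (q (Min e)) (q (Max e))\<bar> \<le> (\<Sum>q\<in>V \<rightarrow>\<^sub>E {..<n}. \<Prod>e\<in>E. B e)"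
  proof (rule order_trans[OF sum_abs sum_mono])
    fix q assume "q \<in> V \<rightarrow>\<^sub>E {..<n}"
    then have "\<bar>f e (q (Min e)) (q (Max e))\<bar> \<le> B e" if "e \<in> E" for e
      using G that by (intro f) (auto simp: PiE_def Pi_def)
    then show "\<bar>\<Prod>e\<in>E. f e (q (Min e)) (q (Max e))\<bar> \<le> (\<Prod>e\<in>E. B e)"
      unfolding abs_prod by (intro prod_mono) auto
  qed
  also have "\<dots> = real n ^ card V * (\<Prod>e\<in>E. B e)" using G(1) by (simp add: card_funcsetE)
  finally show ?thesis using n by (simp add: dens_def abs_divide divide_le_eq mult.commute)
qed

lemma mean_abs_triangle:
  "mean_abs n (\<lambda>a b. F a b - H a b) \<le> mean_abs n (\<lambda>a b. F a b - G a b) + mean_abs n (\<lambda>a b. G a b - H a b)"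
  unfolding mean_abs_def add_divide_distrib[symmetric] sum.distrib[symmetric]
  by (intro divide_right_mono sum_mono) auto

lemma mean_abs_le:
  assumes "\<And>a b. a < n \<Longrightarrow> b < n \<Longrightarrow> \<bar>F a b\<bar> \<le> c" "0 \<le> c"
  shows "mean_abs n F \<le> c"
proof -
  have "(\<Sum>a<n. \<Sum>b<n. \<bar>F a b\<bar>) \<le> (\<Sum>a<n. \<Sum>b<n. c)" by (intro sum_mono assms(1)) auto
  also have "\<dots> = (real n)\<^sup>2 * c" by (simp add: power2_eq_square)
  finally show ?thesis using assms(2) by (cases "n = 0") (auto simp: mean_abs_def divide_le_eq mult.commute)
qed

lemma mean_abs_nonneg: "0 \<le> mean_abs n F"
  by (auto simp: mean_abs_def intro!: divide_nonneg_nonneg sum_nonneg)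

lemma mean_abs_mult_diff_le:
  assumes "\<And>a b. a < n \<Longrightarrow> b < n \<Longrightarrow> \<bar>G a b\<bar> \<le> D" "\<And>a b. a < n \<Longrightarrow> b < n \<Longrightarrow> \<bar>F' a b\<bar> \<le> C"
  shows "mean_abs n (\<lambda>a b. F a b * G a b - F' a b * G' a b) \<le>
    D * mean_abs n (\<lambda>a b. F a b - F' a b) + C * mean_abs n (\<lambda>a b. G a b - G' a b)"
proof -
  have "(\<Sum>a<n. \<Sum>b<n. \<bar>F a b * G a b - F' a b * G' a b\<bar>) \<le>
      (\<Sum>a<n. \<Sum>b<n. D * \<bar>F a b - F' a b\<bar> + C * \<bar>G a b - G' a b\<bar>)"
  proof (intro sum_mono)
    fix a b assume ab: "a \<in> {..<n}" "b \<in> {..<n}"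
    have "F a b * G a b - F' a b * G' a b = G a b * (F a b - F' a b) + F' a b * (G a b - G' a b)"
      by (simp add: algebra_simps)
    also have "\<bar>\<dots>\<bar> \<le> \<bar>G a b\<bar> * \<bar>F a b - F' a b\<bar> + \<bar>F' a b\<bar> * \<bar>G a b - G' a b\<bar>"
      by (rule order_trans[OF abs_triangle_ineq]) (simp add: abs_mult)
    also have "\<dots> \<le> D * \<bar>F a b - F' a b\<bar> + C * \<bar>G a b - G' a b\<bar>"
      using assms ab by (intro add_mono mult_right_mono) auto
    finally show "\<bar>F a b * G a b - F' a b * G' a b\<bar> \<le> D * \<bar>F a b - F' a b\<bar> + C * \<bar>G a b - G' a b\<bar>" .
  qed
  also have "\<dots> = D * (\<Sum>a<n. \<Sum>b<n. \<bar>F a b - F' a b\<bar>) + C * (\<Sum>a<n. \<Sum>b<n. \<bar>G a b - G' a b\<bar>)"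
    by (simp add: sum.distrib sum_distrib_left)
  finally have "mean_abs n (\<lambda>a b. F a b * G a b - F' a b * G' a b) \<le>
      (D * (\<Sum>a<n. \<Sum>b<n. \<bar>F a b - F' a b\<bar>) + C * (\<Sum>a<n. \<Sum>b<n. \<bar>G a b - G' a b\<bar>)) / (real n)\<^sup>2"
    unfolding mean_abs_def by (intro divide_right_mono) auto
  then show ?thesis by (simp add: mean_abs_def add_divide_distrib)
qed

subsection \<open>Approximation by functions of grid cells\<close>

text \<open>\<open>cell N n a = c\<close> iff \<open>(a + 1) / n\<close> lies in \<open>(c / N, (c + 1) / N]\<close>.\<close>

definition cell :: "nat \<Rightarrow> nat \<Rightarrow> nat \<Rightarrow> nat" where
  "cell N n a = (Suc a * N - 1) div n"

lemma cell_eq_iff: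
  assumes "0 < N" "0 < n"
  shows "cell N n a = c \<longleftrightarrow> c * n < Suc a * N \<and> Suc a * N \<le> Suc c * n"
proof -
  have pos: "0 < Suc a * N" using assms by simp
  have "cell N n a = c \<longleftrightarrow> c * n \<le> Suc a * N - 1 \<and> Suc a * N - 1 < Suc c * n"
    unfolding cell_def using assms(2)
    by (metis div_less_iff_less_mult less_Suc_eq_le less_eq_div_iff_mult_less_eq order_antisym_conv order_refl)
  also have "\<dots> \<longleftrightarrow> c * n < Suc a * N \<and> Suc a * N \<le> Suc c * n" using pos by linarith
  finally show ?thesis .
qed

lemma cell_bounds:
  assumes "0 < N" "0 < n"
  shows "real (cell N n a) * real n < real (Suc a) * real N" "real (Suc a) * real N \<le> real (Suc (cell N n a)) * real n"
proof -
  have "cell N n a * n < Suc a * N" "Suc a * N \<le> Suc (cell N n a) * n"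
    using cell_eq_iff[OF assms, of a "cell N n a"] by blast+
  then show "real (cell N n a) * real n < real (Suc a) * real N" "real (Suc a) * real N \<le> real (Suc (cell N n a)) * real n"
    by (metis of_nat_less_iff of_nat_mult, metis of_nat_le_iff of_nat_mult)
qed

lemma cell_less:
  assumes "0 < N" "a < n" shows "cell N n a < N"
proof -
  have "Suc a * N \<le> n * N" using assms by (intro mult_right_mono) auto
  then have "Suc a * N - 1 < N * n" using assms by (simp add: mult.commute)
  then show ?thesis unfolding cell_def using assms by (simp add: div_less_iff_less_mult)
qed

lemma cell_preimage:
  assumes "0 < N" "0 < n" "c < N"
  shows "{a \<in> {..<n}. cell N n a = c} = {c * n div N..<Suc c * n div N}"
proof -
  have *: "(a < n \<and> cell N n a = c) \<longleftrightarrow> c * n div N \<le> a \<and> a < Suc c * n div N" for a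
  proof -
    have "c * n < Suc a * N \<longleftrightarrow> c * n div N \<le> a"
      by (simp only: less_Suc_eq_le[symmetric] div_less_iff_less_mult[OF assms(1)])
    moreover have "Suc a * N \<le> Suc c * n \<longleftrightarrow> a < Suc c * n div N"
      by (simp only: Suc_le_eq[symmetric] less_eq_div_iff_mult_less_eq[OF assms(1)])
    moreover have "a < n" if "Suc a * N \<le> Suc c * n"
    proof -
      have "Suc a * N \<le> N * n" using that mult_right_mono[of "Suc c" N n] assms(3) by linarith
      then have "Suc a * N \<le> n * N" by (simp only: mult.commute[of N n])
      then show ?thesis using assms(1) by (simp only: mult_le_cancel2) simp
    qed
    ultimately show ?thesis using cell_eq_iff[OF assms(1,2), of a c] by blast
  qed
  show ?thesis
    by (rule Set.set_eqI, unfold mem_Collect_eq lessThan_iff atLeastLessThan_iff) (rule *)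
qed

lemma card_cell_preimage:
  assumes "0 < N" "0 < n" "c < N"
  shows "\<bar>real (card {a \<in> {..<n}. cell N n a = c}) - real n / real N\<bar> \<le> 1"
proof -
  have fl: "real (x div N) \<le> real x / real N" "real x / real N < real (x div N) + 1" for x
  proof -
    have "real x = real N * real (x div N) + real (x mod N)" by (metis mult_div_mod_eq of_nat_add of_nat_mult)
    moreover have "real (x mod N) < real N" using assms(1) by simp
    ultimately show "real (x div N) \<le> real x / real N" "real x / real N < real (x div N) + 1"
      using assms(1) by (simp_all add: pos_le_divide_eq pos_divide_less_eq algebra_simps)
  qed
  have le: "c * n div N \<le> Suc c * n div N" by (intro div_le_mono) simp
  have "real (card {a \<in> {..<n}. cell N n a = c}) = real (Suc c * n div N) - real (c * n div N)"
    unfolding cell_preimage[OF assms] using le by (simp add: of_nat_diff)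
  moreover have "real (Suc c * n) / real N - real (c * n) / real N = real n / real N"
    by (simp add: algebra_simps add_divide_distrib)
  ultimately show ?thesis using fl[of "Suc c * n"] fl[of "c * n"] by linarith
qed

lemma sum_cell:
  assumes "0 < N"
  shows "(\<Sum>a<n. h (cell N n a)) = (\<Sum>c<N. real (card {a \<in> {..<n}. cell N n a = c}) * h c)"
proof -
  have "(\<Sum>a<n. h (cell N n a)) = (\<Sum>c<N. \<Sum>a\<in>{a \<in> {..<n}. cell N n a = c}. h (cell N n a))"
    using cell_less[OF assms] by (intro sum.group[symmetric]) auto
  also have "\<dots> = (\<Sum>c<N. real (card {a \<in> {..<n}. cell N n a = c}) * h c)"
    by (intro sum.cong) auto
  finally show ?thesis .
qed

lemma convergent_dens_cell:
  assumes G: "simple_graph V E" and N: "0 < N"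
  shows "convergent (\<lambda>n. dens n V E (\<lambda>e a b. S e (cell N n a) (cell N n b)))"
proof -
  note G = simple_graphD[OF G]
  define cnt where "cnt n c = real (card {a \<in> {..<n}. cell N n a = c})" for n c
  let ?P = "\<lambda>c. \<Prod>e\<in>E. S e (c (Min e)) (c (Max e))"
  have finP: "finite (V \<rightarrow>\<^sub>E {..<m})" for m :: nat using G(1) by (intro finite_PiE) auto
  have eq: "dens n V E (\<lambda>e a b. S e (cell N n a) (cell N n b)) = (\<Sum>c\<in>V \<rightarrow>\<^sub>E {..<N}. ?P c * (\<Prod>v\<in>V. cnt n (c v) / real n))" for n
  proof -
    let ?g = "\<lambda>q. \<lambda>v\<in>V. cell N n (q v)"
    have "(\<Sum>q\<in>V \<rightarrow>\<^sub>E {..<n}. \<Prod>e\<in>E. S e (cell N n (q (Min e))) (cell N n (q (Max e)))) = (\<Sum>q\<in>V \<rightarrow>\<^sub>E {..<n}. ?P (?g q))"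
      using G by (intro sum.cong prod.cong) auto
    also have "\<dots> = (\<Sum>c\<in>V \<rightarrow>\<^sub>E {..<N}. \<Sum>q\<in>{q \<in> V \<rightarrow>\<^sub>E {..<n}. ?g q = c}. ?P (?g q))"
      using cell_less[OF N] by (intro sum.group[symmetric] finP) (auto simp: PiE_def Pi_def)
    also have "\<dots> = (\<Sum>c\<in>V \<rightarrow>\<^sub>E {..<N}. ?P c * (\<Prod>v\<in>V. cnt n (c v)))"
    proof (rule sum.cong[OF refl])
      fix c assume c: "c \<in> V \<rightarrow>\<^sub>E {..<N}"
      have "{q \<in> V \<rightarrow>\<^sub>E {..<n}. ?g q = c} = (\<Pi>\<^sub>E v\<in>V. {a \<in> {..<n}. cell N n a = c v})"
        using c by (auto simp: PiE_def Pi_def extensional_def fun_eq_iff restrict_def)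
      then have "real (card {q \<in> V \<rightarrow>\<^sub>E {..<n}. ?g q = c}) = (\<Prod>v\<in>V. cnt n (c v))"
        using G(1) by (simp add: card_PiE cnt_def)
      moreover have "(\<Sum>q\<in>{q \<in> V \<rightarrow>\<^sub>E {..<n}. ?g q = c}. ?P (?g q)) = (\<Sum>q\<in>{q \<in> V \<rightarrow>\<^sub>E {..<n}. ?g q = c}. ?P c)"
        by (intro sum.cong) auto
      ultimately show "(\<Sum>q\<in>{q \<in> V \<rightarrow>\<^sub>E {..<n}. ?g q = c}. ?P (?g q)) = ?P c * (\<Prod>v\<in>V. cnt n (c v))"
        by simp
    qed
    finally show ?thesis by (simp add: dens_def sum_divide_distrib prod_dividef)
  qed
  have cnt_lim: "(\<lambda>n. cnt n c / real n) \<longlonglongrightarrow> 1 / real N" if c: "c < N" for c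
  proof -
    have "(\<lambda>n. cnt n c / real n - 1 / real N) \<longlonglongrightarrow> 0"
    proof (rule Lim_null_comparison)
      show "\<forall>\<^sub>F n in sequentially. norm (cnt n c / real n - 1 / real N) \<le> 1 / real n"
        using eventually_gt_at_top[of 0]
      proof eventually_elim
        case (elim n)
        have "cnt n c / real n - 1 / real N = (cnt n c - real n / real N) / real n"
          using elim by (simp add: diff_divide_distrib)
        then show ?case using card_cell_preimage[OF N elim c] elim
          by (simp add: cnt_def divide_right_mono)
      qed
      show "(\<lambda>n. 1 / real n) \<longlonglongrightarrow> 0" by (rule lim_1_over_n)
    qed
    then show ?thesis using Lim_null by blast
  qed
  have "(\<lambda>n. \<Sum>c\<in>V \<rightarrow>\<^sub>E {..<N}. ?P c * (\<Prod>v\<in>V. cnt n (c v) / real n)) \<longlonglongrightarrow>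
      (\<Sum>c\<in>V \<rightarrow>\<^sub>E {..<N}. ?P c * (\<Prod>v\<in>V. 1 / real N))"
    by (intro tendsto_sum tendsto_mult tendsto_const tendsto_prod cnt_lim) (auto simp: PiE_def Pi_def)
  then show ?thesis unfolding eq by (rule convergentI)
qed

definition grid_approx :: "real \<Rightarrow> (nat \<Rightarrow> nat \<Rightarrow> nat \<Rightarrow> real) \<Rightarrow> bool" where
  "grid_approx C f \<longleftrightarrow> (\<forall>\<epsilon>>0. \<forall>\<^sub>F N in sequentially. \<exists>S. (\<forall>c d. \<bar>S c d\<bar> \<le> C) \<and>
    (\<forall>\<^sub>F n in sequentially. mean_abs n (\<lambda>a b. f n a b - S (cell N n a) (cell N n b)) \<le> \<epsilon>))"

lemma grid_approx_limit:
  assumes "\<And>\<epsilon>. 0 < \<epsilon> \<Longrightarrow> \<exists>f'. grid_approx C f' \<and> (\<forall>\<^sub>F n in sequentially. mean_abs n (\<lambda>a b. f n a b - f' n a b) \<le> \<epsilon>)"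
  shows "grid_approx C f"
  unfolding grid_approx_def
proof (intro allI impI)
  fix \<epsilon> :: real assume \<epsilon>: "0 < \<epsilon>"
  obtain f' where f': "grid_approx C f'" "\<forall>\<^sub>F n in sequentially. mean_abs n (\<lambda>a b. f n a b - f' n a b) \<le> \<epsilon> / 2"
    using assms[of "\<epsilon> / 2"] \<epsilon> by auto
  have "\<forall>\<^sub>F N in sequentially. \<exists>S. (\<forall>c d. \<bar>S c d\<bar> \<le> C) \<and>
    (\<forall>\<^sub>F n in sequentially. mean_abs n (\<lambda>a b. f' n a b - S (cell N n a) (cell N n b)) \<le> \<epsilon> / 2)"
    by (rule f'(1)[unfolded grid_approx_def, rule_format]) (use \<epsilon> in simp)
  then show "\<forall>\<^sub>F N in sequentially. \<exists>S. (\<forall>c d. \<bar>S c d\<bar> \<le> C) \<and>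
    (\<forall>\<^sub>F n in sequentially. mean_abs n (\<lambda>a b. f n a b - S (cell N n a) (cell N n b)) \<le> \<epsilon>)"
  proof eventually_elim
    case (elim N)
    then obtain S where S: "\<forall>c d. \<bar>S c d\<bar> \<le> C"
      "\<forall>\<^sub>F n in sequentially. mean_abs n (\<lambda>a b. f' n a b - S (cell N n a) (cell N n b)) \<le> \<epsilon> / 2" by blast
    have "\<forall>\<^sub>F n in sequentially. mean_abs n (\<lambda>a b. f n a b - S (cell N n a) (cell N n b)) \<le> \<epsilon>"
      using S(2) f'(2)
    proof eventually_elim
      case (elim n)
      then show ?case
        using mean_abs_triangle[of n "f n" "\<lambda>a b. S (cell N n a) (cell N n b)" "f' n"] by simp
    qed
    then show ?case using S(1) by blast
  qed
qed

lemma grid_approx_mult: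
  assumes f: "grid_approx C f" and g: "grid_approx D g" and CD: "1 \<le> C" "1 \<le> D"
    and gD: "\<forall>\<^sub>F n in sequentially. \<forall>a<n. \<forall>b<n. \<bar>g n a b\<bar> \<le> D"
  shows "grid_approx (C * D) (\<lambda>n a b. f n a b * g n a b)"
  unfolding grid_approx_def
proof (intro allI impI)
  fix \<epsilon> :: real assume \<epsilon>: "0 < \<epsilon>"
  define \<eta> where "\<eta> = \<epsilon> / (C + D)"
  have \<eta>: "0 < \<eta>" "D * \<eta> + C * \<eta> = \<epsilon>"
  proof -
    have "0 < C + D" using CD by simp
    moreover have "D * \<eta> + C * \<eta> = (C + D) * \<eta>" by (simp add: algebra_simps)
    ultimately show "0 < \<eta>" "D * \<eta> + C * \<eta> = \<epsilon>" using \<epsilon> by (simp_all add: \<eta>_def)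
  qed
  have "\<forall>\<^sub>F N in sequentially. \<exists>S. (\<forall>c d. \<bar>S c d\<bar> \<le> C) \<and>
    (\<forall>\<^sub>F n in sequentially. mean_abs n (\<lambda>a b. f n a b - S (cell N n a) (cell N n b)) \<le> \<eta>)"
    using f \<eta>(1) unfolding grid_approx_def by auto
  moreover have "\<forall>\<^sub>F N in sequentially. \<exists>S. (\<forall>c d. \<bar>S c d\<bar> \<le> D) \<and>
    (\<forall>\<^sub>F n in sequentially. mean_abs n (\<lambda>a b. g n a b - S (cell N n a) (cell N n b)) \<le> \<eta>)"
    using g \<eta>(1) unfolding grid_approx_def by auto
  ultimately show "\<forall>\<^sub>F N in sequentially. \<exists>S. (\<forall>c d. \<bar>S c d\<bar> \<le> C * D) \<and>
    (\<forall>\<^sub>F n in sequentially. mean_abs n (\<lambda>a b. f n a b * g n a b - S (cell N n a) (cell N n b)) \<le> \<epsilon>)"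
  proof eventually_elim
    case (elim N)
    then obtain S T where S: "\<And>c d. \<bar>S c d\<bar> \<le> C"
      "\<forall>\<^sub>F n in sequentially. mean_abs n (\<lambda>a b. f n a b - S (cell N n a) (cell N n b)) \<le> \<eta>"
      and T: "\<And>c d. \<bar>T c d\<bar> \<le> D"
      "\<forall>\<^sub>F n in sequentially. mean_abs n (\<lambda>a b. g n a b - T (cell N n a) (cell N n b)) \<le> \<eta>" by blast
    have "\<forall>\<^sub>F n in sequentially. mean_abs n (\<lambda>a b. f n a b * g n a b - S (cell N n a) (cell N n b) * T (cell N n a) (cell N n b)) \<le> \<epsilon>"
      using S(2) T(2) gD
    proof eventually_elim
      case (elim n)
      have "mean_abs n (\<lambda>a b. f n a b * g n a b - S (cell N n a) (cell N n b) * T (cell N n a) (cell N n b))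
        \<le> D * mean_abs n (\<lambda>a b. f n a b - S (cell N n a) (cell N n b)) + C * mean_abs n (\<lambda>a b. g n a b - T (cell N n a) (cell N n b))"
        by (rule mean_abs_mult_diff_le) (use elim S(1) in auto)
      also have "\<dots> \<le> D * \<eta> + C * \<eta>" using elim CD by (intro add_mono mult_left_mono) auto
      finally show ?case using \<eta> by simp
    qed
    moreover have "\<bar>S c d * T c d\<bar> \<le> C * D" for c d
      using S(1)[of c d] T(1)[of c d] unfolding abs_mult by (intro mult_mono) auto
    ultimately show ?case by (intro exI[of _ "\<lambda>c d. S c d * T c d"]) auto
  qed
qed

lemma convergent_of_approximations:
  fixes X :: "nat \<Rightarrow> real"
  assumes "\<And>\<epsilon>. 0 < \<epsilon> \<Longrightarrow> \<exists>Y. convergent Y \<and> (\<forall>\<^sub>F n in sequentially. \<bar>X n - Y n\<bar> \<le> \<epsilon>)"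
  shows "convergent X"
proof (rule Cauchy_convergent, rule metric_CauchyI)
  fix \<epsilon> :: real assume "0 < \<epsilon>"
  then obtain Y where Y: "convergent Y" "\<forall>\<^sub>F n in sequentially. \<bar>X n - Y n\<bar> \<le> \<epsilon> / 4"
    using assms[of "\<epsilon> / 4"] by auto
  obtain N1 where N1: "\<And>m n. N1 \<le> m \<Longrightarrow> N1 \<le> n \<Longrightarrow> dist (Y m) (Y n) < \<epsilon> / 4"
    using metric_CauchyD[OF convergent_Cauchy[OF Y(1)], of "\<epsilon> / 4"] \<open>0 < \<epsilon>\<close> by auto
  obtain N2 where N2: "\<And>n. N2 \<le> n \<Longrightarrow> \<bar>X n - Y n\<bar> \<le> \<epsilon> / 4"
    using Y(2) unfolding eventually_sequentially by blast
  have "dist (X m) (X n) < \<epsilon>" if "max N1 N2 \<le> m" "max N1 N2 \<le> n" for m n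
  proof -
    have "\<bar>Y m - Y n\<bar> < \<epsilon> / 4" using N1[of m n] that by (simp add: dist_real_def)
    moreover have "\<bar>X m - Y m\<bar> \<le> \<epsilon> / 4" "\<bar>X n - Y n\<bar> \<le> \<epsilon> / 4" using N2 that by simp_all
    ultimately show ?thesis using \<open>0 < \<epsilon>\<close> unfolding dist_real_def by linarith
  qed
  then show "\<exists>N. \<forall>m\<ge>N. \<forall>n\<ge>N. dist (X m) (X n) < \<epsilon>" by blast
qed

lemma convergent_dens:
  assumes G: "simple_graph V E" and C: "1 \<le> C"
    and approx: "\<And>e. e \<in> E \<Longrightarrow> grid_approx C (f e)"
    and bound: "\<And>e. e \<in> E \<Longrightarrow> \<forall>\<^sub>F n in sequentially. \<forall>a<n. \<forall>b<n. \<bar>f e n a b\<bar> \<le> C"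
  shows "convergent (\<lambda>n. dens n V E (\<lambda>e. f e n))"
proof (rule convergent_of_approximations)
  fix \<epsilon> :: real assume \<epsilon>: "0 < \<epsilon>"
  have finE: "finite E" using simple_graphD(2)[OF G] .
  define \<eta> where "\<eta> = \<epsilon> / (C ^ card E * (real (card E) + 1))"
  have D0: "0 < C ^ card E * (real (card E) + 1)" using C by (intro mult_pos_pos) auto
  then have \<eta>0: "0 < \<eta>" using \<epsilon> by (simp add: \<eta>_def)
  have \<eta>: "C ^ card E * (real (card E) * \<eta>) \<le> \<epsilon>"
  proof -
    have "C ^ card E * (real (card E) * \<eta>) \<le> C ^ card E * ((real (card E) + 1) * \<eta>)"
      using \<eta>0 C by (intro mult_left_mono mult_right_mono) auto
    also have "\<dots> = (C ^ card E * (real (card E) + 1)) * \<eta>" by simp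
    also have "\<dots> = \<epsilon>"
      unfolding \<eta>_def times_divide_eq_right
      by (rule nonzero_mult_div_cancel_left[OF D0[THEN less_imp_neq, THEN not_sym]])
    finally show ?thesis .
  qed
  have "\<forall>\<^sub>F N in sequentially. \<forall>e\<in>E. \<exists>S. (\<forall>c d. \<bar>S c d\<bar> \<le> C) \<and>
      (\<forall>\<^sub>F n in sequentially. mean_abs n (\<lambda>a b. f e n a b - S (cell N n a) (cell N n b)) \<le> \<eta>)"
    using approx \<eta>0 unfolding grid_approx_def by (intro eventually_ball_finite finE) auto
  then have "\<forall>\<^sub>F N in sequentially. 0 < N \<and> (\<forall>e\<in>E. \<exists>S. (\<forall>c d. \<bar>S c d\<bar> \<le> C) \<and>
      (\<forall>\<^sub>F n in sequentially. mean_abs n (\<lambda>a b. f e n a b - S (cell N n a) (cell N n b)) \<le> \<eta>))"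
    using eventually_gt_at_top[of 0] by eventually_elim simp
  then obtain N where N: "0 < N" and S_ex: "\<forall>e\<in>E. \<exists>S. (\<forall>c d. \<bar>S c d\<bar> \<le> C) \<and>
      (\<forall>\<^sub>F n in sequentially. mean_abs n (\<lambda>a b. f e n a b - S (cell N n a) (cell N n b)) \<le> \<eta>)"
    unfolding eventually_sequentially by blast
  from bchoice[OF S_ex] obtain S where S': "\<forall>e\<in>E. (\<forall>c d. \<bar>S e c d\<bar> \<le> C) \<and>
      (\<forall>\<^sub>F n in sequentially. mean_abs n (\<lambda>a b. f e n a b - S e (cell N n a) (cell N n b)) \<le> \<eta>)" ..
  have S: "\<bar>S e c d\<bar> \<le> C"
    "\<forall>\<^sub>F n in sequentially. mean_abs n (\<lambda>a b. f e n a b - S e (cell N n a) (cell N n b)) \<le> \<eta>"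
    if "e \<in> E" for e c d
    using bspec[OF S' that] by auto
  have "\<forall>\<^sub>F n in sequentially. \<forall>e\<in>E. mean_abs n (\<lambda>a b. f e n a b - S e (cell N n a) (cell N n b)) \<le> \<eta>"
    "\<forall>\<^sub>F n in sequentially. \<forall>e\<in>E. \<forall>a<n. \<forall>b<n. \<bar>f e n a b\<bar> \<le> C"
    using S(2) bound by (auto intro!: eventually_ball_finite finE)
  then have "\<forall>\<^sub>F n in sequentially. \<bar>dens n V E (\<lambda>e. f e n) - dens n V E (\<lambda>e a b. S e (cell N n a) (cell N n b))\<bar> \<le> \<epsilon>"
    using eventually_gt_at_top[of 0]
  proof eventually_elim
    case (elim n)
    have "\<bar>dens n V E (\<lambda>e. f e n) - dens n V E (\<lambda>e a b. S e (cell N n a) (cell N n b))\<bar> \<le>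
       C ^ card E * (\<Sum>e\<in>E. mean_abs n (\<lambda>a b. f e n a b - S e (cell N n a) (cell N n b)))"
      by (rule dens_diff_le[OF G]) (use elim S(1) C in auto)
    also have "\<dots> \<le> C ^ card E * (\<Sum>e\<in>E. \<eta>)"
      using elim C by (intro mult_left_mono sum_mono) auto
    finally show ?case using \<eta> by simp
  qed
  then show "\<exists>Y. convergent Y \<and> (\<forall>\<^sub>F n in sequentially. \<bar>dens n V E (\<lambda>e. f e n) - Y n\<bar> \<le> \<epsilon>)"
    using convergent_dens_cell[OF G N] by blast
qed

lemma dens_diff_tendsto_0:
  assumes G: "simple_graph V E" and C: "1 \<le> C"
    and f: "\<And>e. e \<in> E \<Longrightarrow> \<forall>\<^sub>F n in sequentially. \<forall>a<n. \<forall>b<n. \<bar>f e n a b\<bar> \<le> C"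
    and f': "\<And>e. e \<in> E \<Longrightarrow> \<forall>\<^sub>F n in sequentially. \<forall>a<n. \<forall>b<n. \<bar>f' e n a b\<bar> \<le> C"
    and diff: "\<And>e. e \<in> E \<Longrightarrow> (\<lambda>n. mean_abs n (\<lambda>a b. f e n a b - f' e n a b)) \<longlonglongrightarrow> 0"
  shows "(\<lambda>n. dens n V E (\<lambda>e. f e n) - dens n V E (\<lambda>e. f' e n)) \<longlonglongrightarrow> 0"
proof (rule Lim_null_comparison)
  have finE: "finite E" using simple_graphD(2)[OF G] .
  have "\<forall>\<^sub>F n in sequentially. \<forall>e\<in>E. \<forall>a<n. \<forall>b<n. \<bar>f e n a b\<bar> \<le> C"
    "\<forall>\<^sub>F n in sequentially. \<forall>e\<in>E. \<forall>a<n. \<forall>b<n. \<bar>f' e n a b\<bar> \<le> C"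
    using f f' by (auto intro!: eventually_ball_finite finE)
  then show "\<forall>\<^sub>F n in sequentially. norm (dens n V E (\<lambda>e. f e n) - dens n V E (\<lambda>e. f' e n)) \<le>
      C ^ card E * (\<Sum>e\<in>E. mean_abs n (\<lambda>a b. f e n a b - f' e n a b))"
    using eventually_gt_at_top[of 0]
    by eventually_elim (unfold real_norm_def, rule dens_diff_le[OF G], use C in auto)
  have "(\<lambda>n. C ^ card E * (\<Sum>e\<in>E. mean_abs n (\<lambda>a b. f e n a b - f' e n a b))) \<longlonglongrightarrow> C ^ card E * (\<Sum>e\<in>E. 0)"
    by (intro tendsto_intros diff)
  then show "(\<lambda>n. C ^ card E * (\<Sum>e\<in>E. mean_abs n (\<lambda>a b. f e n a b - f' e n a b))) \<longlonglongrightarrow> 0" by simp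
qed

subsection \<open>The band\<close>

definition band :: "real \<Rightarrow> nat \<Rightarrow> nat \<Rightarrow> nat \<Rightarrow> real" where
  "band \<mu> n a b = of_bool (\<bar>real a - real b\<bar> \<le> \<mu> \<or> \<bar>real a - real b\<bar> \<ge> real n - \<mu>)"

lemma card_nat_interval_le:
  fixes lo hi :: real
  assumes "lo \<le> hi"
  shows "real (card {b \<in> {..<n}. lo \<le> real b \<and> real b \<le> hi}) \<le> hi - lo + 1"
proof -
  have "card {b \<in> {..<n}. lo \<le> real b \<and> real b \<le> hi} = card (int ` {b \<in> {..<n}. lo \<le> real b \<and> real b \<le> hi})"
    by (simp add: card_image)
  also have "\<dots> \<le> card {\<lceil>lo\<rceil>..\<lfloor>hi\<rfloor>}"
    by (intro card_mono) (auto simp: ceiling_le_iff le_floor_iff)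
  also have "\<dots> = nat (\<lfloor>hi\<rfloor> - \<lceil>lo\<rceil> + 1)" by simp
  finally have "real (card {b \<in> {..<n}. lo \<le> real b \<and> real b \<le> hi}) \<le> real (nat (\<lfloor>hi\<rfloor> - \<lceil>lo\<rceil> + 1))" by simp
  also have "\<dots> \<le> hi - lo + 1" using assms by linarith
  finally show ?thesis .
qed

lemma sum_near_diagonals_le:
  fixes \<beta> w :: real
  assumes "0 \<le> w"
  shows "(\<Sum>a<n. \<Sum>b<n. of_bool (\<bar>\<bar>real a - real b\<bar> - \<beta>\<bar> \<le> w)) \<le> real n * (2 * (2 * w + 1))"
proof -
  have "(\<Sum>b<n. of_bool (\<bar>\<bar>real a - real b\<bar> - \<beta>\<bar> \<le> w)) \<le> 2 * (2 * w + 1)" for a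
  proof -
    let ?I = "\<lambda>c. {b \<in> {..<n}. c - w \<le> real b \<and> real b \<le> c + w}"
    have "(\<Sum>b<n. of_bool (\<bar>\<bar>real a - real b\<bar> - \<beta>\<bar> \<le> w)) = real (card {b \<in> {..<n}. \<bar>\<bar>real a - real b\<bar> - \<beta>\<bar> \<le> w})"
      by (simp add: of_bool_def sum.If_cases Int_def)
    also have "\<dots> \<le> real (card (?I (real a - \<beta>) \<union> ?I (real a + \<beta>)))"
      by (intro of_nat_mono card_mono) auto
    also have "\<dots> \<le> real (card (?I (real a - \<beta>)) + card (?I (real a + \<beta>)))"
      by (intro of_nat_mono card_Un_le)
    also have "\<dots> \<le> 2 * (2 * w + 1)"
      using card_nat_interval_le[of "real a - \<beta> - w" "real a - \<beta> + w" n]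
        card_nat_interval_le[of "real a + \<beta> - w" "real a + \<beta> + w" n] assms by simp
    finally show ?thesis .
  qed
  then have "(\<Sum>a<n. \<Sum>b<n. of_bool (\<bar>\<bar>real a - real b\<bar> - \<beta>\<bar> \<le> w)) \<le> (\<Sum>a<n. 2 * (2 * w + 1))"
    by (intro sum_mono) auto
  then show ?thesis by simp
qed

lemma threshold_stable:
  fixes s t \<mu> b w :: real
  assumes "\<bar>t - s\<bar> \<le> w" "\<bar>\<mu> - b\<bar> \<le> w" "\<not> \<bar>s - b\<bar> \<le> w"
  shows "s \<le> \<mu> \<longleftrightarrow> t \<le> b" "\<mu> \<le> s \<longleftrightarrow> b \<le> t"
  using assms by linarith+

lemma band_cell_diff:
  assumes N: "0 < N" and n: "0 < n" and \<mu>: "\<bar>\<mu> - \<alpha> * real n\<bar> \<le> real n / real N"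
  shows "\<bar>band \<mu> n a b - band (\<alpha> * real N) N (cell N n a) (cell N n b)\<bar> \<le>
    of_bool (\<bar>\<bar>real a - real b\<bar> - \<alpha> * real n\<bar> \<le> real n / real N) +
    of_bool (\<bar>\<bar>real a - real b\<bar> - (1 - \<alpha>) * real n\<bar> \<le> real n / real N)"
proof -
  define s where "s = \<bar>real a - real b\<bar>"
  define t where "t = \<bar>real (cell N n a) - real (cell N n b)\<bar> * (real n / real N)"
  have "\<bar>(real (cell N n a) - real (cell N n b)) * real n - (real a - real b) * real N\<bar> \<le> real n"
    using cell_bounds[OF N n, of a] cell_bounds[OF N n, of b] by (simp add: algebra_simps abs_le_iff)
  then have h1: "\<bar>(real (cell N n a) - real (cell N n b)) * real n - (real a - real b) * real N\<bar> / real N \<le> real n / real N"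
    by (intro divide_right_mono) auto
  have h2: "\<bar>(real (cell N n a) - real (cell N n b)) * real n - (real a - real b) * real N\<bar> / real N =
      \<bar>(real (cell N n a) - real (cell N n b)) * (real n / real N) - (real a - real b)\<bar>"
  proof -
    have "((real (cell N n a) - real (cell N n b)) * real n - (real a - real b) * real N) / real N =
        (real (cell N n a) - real (cell N n b)) * (real n / real N) - (real a - real b)"
      using N by (simp add: diff_divide_distrib)
    then show ?thesis by (metis abs_divide abs_of_nat)
  qed
  have h3: "t = \<bar>(real (cell N n a) - real (cell N n b)) * (real n / real N)\<bar>"
    by (simp add: t_def abs_mult)
  have ts: "\<bar>t - s\<bar> \<le> real n / real N"
    unfolding h3 s_def by (rule order_trans[OF abs_triangle_ineq3 h1[unfolded h2]])
  have c0: "0 < real n / real N" using N n by simp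
  have "\<bar>real (cell N n a) - real (cell N n b)\<bar> \<le> \<alpha> * real N \<longleftrightarrow>
      \<bar>real (cell N n a) - real (cell N n b)\<bar> * (real n / real N) \<le> \<alpha> * real N * (real n / real N)"
    using c0 by (subst mult_le_cancel_right_pos) auto
  then have 1: "\<bar>real (cell N n a) - real (cell N n b)\<bar> \<le> \<alpha> * real N \<longleftrightarrow> t \<le> \<alpha> * real n"
    using N by (simp add: t_def)
  have "real N - \<alpha> * real N \<le> \<bar>real (cell N n a) - real (cell N n b)\<bar> \<longleftrightarrow>
      (real N - \<alpha> * real N) * (real n / real N) \<le> \<bar>real (cell N n a) - real (cell N n b)\<bar> * (real n / real N)"
    using c0 by (subst mult_le_cancel_right_pos) auto
  then have 2: "real N - \<alpha> * real N \<le> \<bar>real (cell N n a) - real (cell N n b)\<bar> \<longleftrightarrow> real n - \<alpha> * real n \<le> t"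
  proof -
    have "(real N - \<alpha> * real N) * (real n / real N) = real n - \<alpha> * real n" using N by (simp add: field_simps)
    with \<open>(real N - \<alpha> * real N \<le> \<bar>real (cell N n a) - real (cell N n b)\<bar>) = _\<close> show ?thesis
      unfolding t_def by (simp only:)
  qed
  have eq: "band (\<alpha> * real N) N (cell N n a) (cell N n b) = of_bool (t \<le> \<alpha> * real n \<or> real n - \<alpha> * real n \<le> t)"
    "band \<mu> n a b = of_bool (s \<le> \<mu> \<or> real n - \<mu> \<le> s)"
    unfolding band_def using 1 2 by (simp_all add: s_def)
  show ?thesis
  proof (cases "\<bar>s - \<alpha> * real n\<bar> \<le> real n / real N \<or> \<bar>s - (1 - \<alpha>) * real n\<bar> \<le> real n / real N")
    case True
    then show ?thesis unfolding eq s_def[symmetric] by auto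
  next
    case False
    have "s \<le> \<mu> \<longleftrightarrow> t \<le> \<alpha> * real n" by (rule threshold_stable(1)[OF ts \<mu>]) (use False in blast)
    moreover have "real n - \<mu> \<le> s \<longleftrightarrow> real n - \<alpha> * real n \<le> t"
    proof (rule threshold_stable(2)[OF ts])
      show "\<bar>(real n - \<mu>) - (real n - \<alpha> * real n)\<bar> \<le> real n / real N" using \<mu> by (simp add: abs_minus_commute)
      show "\<not> \<bar>s - (real n - \<alpha> * real n)\<bar> \<le> real n / real N" using False by (simp add: left_diff_distrib)
    qed
    ultimately show ?thesis unfolding eq by simp
  qed
qed

lemma mean_abs_band_cell_diff:
  assumes N: "0 < N" and n: "N \<le> n" and \<mu>: "\<bar>\<mu> - \<alpha> * real n\<bar> \<le> real n / real N"
  shows "mean_abs n (\<lambda>a b. band \<mu> n a b - band (\<alpha> * real N) N (cell N n a) (cell N n b)) \<le> 12 / real N"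
proof -
  have n0: "0 < n" using N n by simp
  let ?w = "real n / real N"
  have "(\<Sum>a<n. \<Sum>b<n. \<bar>band \<mu> n a b - band (\<alpha> * real N) N (cell N n a) (cell N n b)\<bar>) \<le>
    (\<Sum>a<n. \<Sum>b<n. of_bool (\<bar>\<bar>real a - real b\<bar> - \<alpha> * real n\<bar> \<le> ?w) +
      of_bool (\<bar>\<bar>real a - real b\<bar> - (1 - \<alpha>) * real n\<bar> \<le> ?w))"
    by (intro sum_mono band_cell_diff N n0 \<mu>)
  also have "\<dots> \<le> real n * (2 * (2 * ?w + 1)) + real n * (2 * (2 * ?w + 1))"
    unfolding sum.distrib by (intro add_mono sum_near_diagonals_le) auto
  also have "\<dots> \<le> real n * (12 * ?w)"
  proof -
    have "1 \<le> ?w" using N n by simp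
    moreover have "2 * (2 * w + 1) + 2 * (2 * w + 1) \<le> 12 * w" if "1 \<le> w" for w :: real using that by (simp add: distrib_left)
    ultimately have "2 * (2 * ?w + 1) + 2 * (2 * ?w + 1) \<le> 12 * ?w" by blast
    then have "real n * (2 * (2 * ?w + 1) + 2 * (2 * ?w + 1)) \<le> real n * (12 * ?w)"
      by (rule mult_left_mono) simp
    then show ?thesis by (simp only: distrib_left)
  qed
  finally have "mean_abs n (\<lambda>a b. band \<mu> n a b - band (\<alpha> * real N) N (cell N n a) (cell N n b)) \<le>
      real n * (12 * ?w) / (real n)\<^sup>2"
    unfolding mean_abs_def by (rule divide_right_mono) simp
  also have "\<dots> = 12 / real N" using n0 by (simp add: power2_eq_square)
  finally show ?thesis .
qed

lemma abs_band_le: "\<bar>band \<mu> n a b\<bar> \<le> 1"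
  by (simp add: band_def)

lemma eventually_band_close:
  assumes \<mu>: "(\<lambda>n. \<mu> n / real n) \<longlonglongrightarrow> \<alpha>" and N: "0 < N"
  shows "\<forall>\<^sub>F n in sequentially. mean_abs n (\<lambda>a b. band (\<mu> n) n a b - band (\<alpha> * real N) N (cell N n a) (cell N n b)) \<le> 12 / real N"
proof -
  have "\<forall>\<^sub>F n in sequentially. dist (\<mu> n / real n) \<alpha> < 1 / real N"
    using \<mu> N by (intro tendstoD) auto
  then show ?thesis using eventually_ge_at_top[of N]
  proof eventually_elim
    case (elim n)
    have n: "0 < n" using elim N by simp
    have "\<mu> n - \<alpha> * real n = (\<mu> n / real n - \<alpha>) * real n" using n by (simp add: left_diff_distrib)
    then have "\<bar>\<mu> n - \<alpha> * real n\<bar> = \<bar>\<mu> n / real n - \<alpha>\<bar> * real n" by (simp add: abs_mult)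
    also have "\<dots> \<le> 1 / real N * real n" using elim by (intro mult_right_mono) (auto simp: dist_real_def)
    finally show ?case by (intro mean_abs_band_cell_diff N elim) simp
  qed
qed

lemma grid_approx_band:
  assumes "(\<lambda>n. \<mu> n / real n) \<longlonglongrightarrow> \<alpha>"
  shows "grid_approx 1 (\<lambda>n. band (\<mu> n) n)"
  unfolding grid_approx_def
proof (intro allI impI)
  fix \<epsilon> :: real assume \<epsilon>: "0 < \<epsilon>"
  have "(\<lambda>N. 12 / real N) \<longlonglongrightarrow> 0" by real_asymp
  then have "\<forall>\<^sub>F N in sequentially. 12 / real N < \<epsilon>" using \<epsilon> by (rule order_tendstoD)
  then show "\<forall>\<^sub>F N in sequentially. \<exists>S. (\<forall>c d. \<bar>S c d\<bar> \<le> 1) \<and>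
      (\<forall>\<^sub>F n in sequentially. mean_abs n (\<lambda>a b. band (\<mu> n) n a b - S (cell N n a) (cell N n b)) \<le> \<epsilon>)"
    using eventually_gt_at_top[of 0]
  proof eventually_elim
    case (elim N)
    have "\<forall>\<^sub>F n in sequentially. mean_abs n (\<lambda>a b. band (\<mu> n) n a b - band (\<alpha> * real N) N (cell N n a) (cell N n b)) \<le> \<epsilon>"
      using eventually_band_close[OF assms elim(2)] by eventually_elim (use elim in simp)
    then show ?case using abs_band_le by blast
  qed
qed

lemma mean_abs_band_diff_tendsto_0:
  assumes "(\<lambda>n. \<mu> n / real n) \<longlonglongrightarrow> \<alpha>" "(\<lambda>n. \<mu>' n / real n) \<longlonglongrightarrow> \<alpha>"
  shows "(\<lambda>n. mean_abs n (\<lambda>a b. band (\<mu> n) n a b - band (\<mu>' n) n a b)) \<longlonglongrightarrow> 0"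
proof (rule tendstoI)
  fix \<epsilon> :: real assume \<epsilon>: "0 < \<epsilon>"
  have "(\<lambda>N. 24 / real N) \<longlonglongrightarrow> 0" by real_asymp
  then have "\<forall>\<^sub>F N in sequentially. 24 / real N < \<epsilon> \<and> 0 < N"
    using \<epsilon> by (intro eventually_conj order_tendstoD eventually_gt_at_top) auto
  then obtain N where N: "24 / real N < \<epsilon>" "0 < N" unfolding eventually_sequentially by blast
  show "\<forall>\<^sub>F n in sequentially. dist (mean_abs n (\<lambda>a b. band (\<mu> n) n a b - band (\<mu>' n) n a b)) 0 < \<epsilon>"
    using eventually_band_close[OF assms(1) N(2)] eventually_band_close[OF assms(2) N(2)]
  proof eventually_elim
    case (elim n)
    let ?c = "\<lambda>a b. band (\<alpha> * real N) N (cell N n a) (cell N n b)"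
    have "mean_abs n (\<lambda>a b. ?c a b - band (\<mu>' n) n a b) = mean_abs n (\<lambda>a b. band (\<mu>' n) n a b - ?c a b)"
      by (simp add: mean_abs_def abs_minus_commute)
    then have "mean_abs n (\<lambda>a b. band (\<mu> n) n a b - band (\<mu>' n) n a b) \<le> 24 / real N"
      using mean_abs_triangle[of n "band (\<mu> n) n" "band (\<mu>' n) n" ?c] elim by simp
    then show ?case using N mean_abs_nonneg[of n "\<lambda>a b. band (\<mu> n) n a b - band (\<mu>' n) n a b"]
      by (simp add: dist_real_def)
  qed
qed

subsection \<open>Riemann integrable kernels\<close>

definition gridcell :: "nat \<Rightarrow> nat \<Rightarrow> nat \<Rightarrow> (real \<times> real) set" where
  "gridcell N c d = cbox (real c / real N, real d / real N) (real (Suc c) / real N, real (Suc d) / real N)"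

lemma mem_gridcell:
  "(u, v) \<in> gridcell N c d \<longleftrightarrow> real c / real N \<le> u \<and> u \<le> real (Suc c) / real N \<and>
     real d / real N \<le> v \<and> v \<le> real (Suc d) / real N"
  by (auto simp: gridcell_def cbox_Pair_eq)

lemma gridcell_subset: "c < N \<Longrightarrow> d < N \<Longrightarrow> gridcell N c d \<subseteq> unit_square"
proof
  fix z assume *: "c < N" "d < N" "z \<in> gridcell N c d"
  obtain u v where z: "z = (u, v)" by (cases z)
  have "0 \<le> real c / real N" "real (Suc c) / real N \<le> 1" "0 \<le> real d / real N" "real (Suc d) / real N \<le> 1"
    using * by auto
  moreover have "real c / real N \<le> u" "u \<le> real (Suc c) / real N" "real d / real N \<le> v" "v \<le> real (Suc d) / real N"
    using *(3) unfolding z mem_gridcell by blast+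
  ultimately have "0 \<le> u" "u \<le> 1" "0 \<le> v" "v \<le> 1" by linarith+
  then show "z \<in> unit_square" unfolding z by simp
qed

lemma measure_gridcell:
  assumes "0 < N" shows "measure lborel (gridcell N c d) = 1 / (real N)\<^sup>2"
proof -
  have "real (Suc c) / real N - real c / real N = 1 / real N" for c by (simp add: diff_divide_distrib[symmetric])
  then show ?thesis
    by (simp add: gridcell_def content_Pair divide_right_mono power2_eq_square)
qed

lemma grid_tagged_division:
  assumes N: "0 < N" and z: "\<And>c d. c < N \<Longrightarrow> d < N \<Longrightarrow> z c d \<in> gridcell N c d"
  shows "(\<lambda>(c, d). (z c d, gridcell N c d)) ` ({..<N} \<times> {..<N}) tagged_division_of unit_square"
proof (rule tagged_division_ofI)
  let ?P = "(\<lambda>(c, d). (z c d, gridcell N c d)) ` ({..<N} \<times> {..<N})"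
  have mem: "\<exists>c d. c < N \<and> d < N \<and> x = z c d \<and> K = gridcell N c d" if "(x, K) \<in> ?P" for x K
    using that by auto
  show "finite ?P" by simp
  show "x \<in> K" if "(x, K) \<in> ?P" for x K using that z by auto
  show sub: "K \<subseteq> unit_square" if "(x, K) \<in> ?P" for x K
  proof -
    from mem[OF that] obtain c d where cd: "c < N" "d < N" "K = gridcell N c d" by auto
    show ?thesis unfolding cd(3) by (rule gridcell_subset[OF cd(1,2)])
  qed
  show "\<exists>a b. K = cbox a b" if "(x, K) \<in> ?P" for x K
  proof -
    from mem[OF that] obtain c d where "K = gridcell N c d" by auto
    then show ?thesis unfolding gridcell_def by (intro exI)
  qed
  show "interior K1 \<inter> interior K2 = {}" if "(x1, K1) \<in> ?P" "(x2, K2) \<in> ?P" "(x1, K1) \<noteq> (x2, K2)" for x1 K1 x2 K2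
  proof -
    from mem[OF that(1)] obtain c d where cd: "x1 = z c d" "K1 = gridcell N c d" by auto
    from mem[OF that(2)] obtain c' d' where cd': "x2 = z c' d'" "K2 = gridcell N c' d'" by auto
    have "(c, d) \<noteq> (c', d')" using that(3) cd cd' by auto
    note * = cd(2) cd'(2) this
    have eq: "c = c'" if "real c / real N < u" "u < real (Suc c) / real N" "real c' / real N < u" "u < real (Suc c') / real N" for c c' u
    proof -
      have "real c < real (Suc c')" "real c' < real (Suc c)"
        using that N by (metis divide_less_cancel less_trans of_nat_0_less_iff order.asym)+
      then show ?thesis by simp
    qed
    have "False" if "(u, v) \<in> interior K1" "(u, v) \<in> interior K2" for u v
    proof -
      have in_box: "r < u \<and> u < s \<and> r' < v \<and> v < s'" if "(u, v) \<in> box (r, r') (s, s')" for r r' s s' :: real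
        using that by (auto simp: mem_box Basis_prod_def)
      show False
        using in_box[OF that(1)[unfolded * gridcell_def interior_cbox]]
          in_box[OF that(2)[unfolded * gridcell_def interior_cbox]] eq[of c u c'] eq[of d v d'] *(3) by blast
    qed
    then show ?thesis by auto
  qed
  show "\<Union>{K. \<exists>x. (x, K) \<in> ?P} = unit_square"
  proof
    show "\<Union>{K. \<exists>x. (x, K) \<in> ?P} \<subseteq> unit_square"
    proof (rule Union_least)
      fix K assume "K \<in> {K. \<exists>x. (x, K) \<in> ?P}"
      from CollectD[OF this] obtain x where "(x, K) \<in> ?P" ..
      then show "K \<subseteq> unit_square" by (rule sub)
    qed
    have ex: "\<exists>c<N. real c / real N \<le> u \<and> u \<le> real (Suc c) / real N" if "0 \<le> u" "u \<le> 1" for u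
    proof (cases "u = 1")
      case True
      have "real (Suc (N - 1)) = real N" using N by simp
      then show ?thesis using True N by (intro exI[of _ "N - 1"]) (auto simp: divide_le_eq_1)
    next
      case False
      define c where "c = nat \<lfloor>u * real N\<rfloor>"
      have "real c \<le> u * real N" "u * real N < real (Suc c)"
        using that N by (auto simp: c_def of_nat_nat zero_le_mult_iff) linarith+
      moreover have "u * real N < 1 * real N" using False that N by (intro mult_strict_right_mono) auto
      ultimately have "c < N" by linarith
      then show ?thesis using \<open>real c \<le> u * real N\<close> \<open>u * real N < real (Suc c)\<close> N
        by (intro exI[of _ c]) (auto simp: pos_divide_le_eq pos_le_divide_eq)
    qed
    show "unit_square \<subseteq> \<Union>{K. \<exists>x. (x, K) \<in> ?P}"
    proof
      fix w assume "w \<in> unit_square"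
      then obtain u v where uv: "w = (u, v)" "0 \<le> u" "u \<le> 1" "0 \<le> v" "v \<le> 1" by auto
      obtain c d where "c < N" "real c / real N \<le> u" "u \<le> real (Suc c) / real N"
        "d < N" "real d / real N \<le> v" "v \<le> real (Suc d) / real N"
        using ex[OF uv(2,3)] ex[OF uv(4,5)] by blast
      then have "w \<in> gridcell N c d" "(z c d, gridcell N c d) \<in> ?P" by (auto simp: uv(1) mem_gridcell)
      moreover from this(2) have "gridcell N c d \<in> {K. \<exists>x. (x, K) \<in> ?P}" by (intro CollectI exI)
      ultimately show "w \<in> \<Union>{K. \<exists>x. (x, K) \<in> ?P}" by (intro UnionI)
    qed
  qed
qed

lemma inj_gridcell: "0 < N \<Longrightarrow> gridcell N c d = gridcell N c' d' \<Longrightarrow> c = c' \<and> d = d'"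
proof -
  assume N: "0 < N" and eq: "gridcell N c d = gridcell N c' d'"
  have le: "c' \<le> c \<and> d' \<le> d" if "gridcell N c d \<subseteq> gridcell N c' d'" for c d c' d'
  proof -
    have "(real c / real N, real d / real N) \<in> gridcell N c d" by (auto simp: mem_gridcell divide_right_mono)
    then have "(real c / real N, real d / real N) \<in> gridcell N c' d'" using that by blast
    then show ?thesis using N by (simp add: mem_gridcell divide_le_cancel)
  qed
  from le[of c d c' d'] le[of c' d' c d] eq show "c = c' \<and> d = d'" by auto
qed

lemma riemann_grid_sum:
  assumes "riemann_integrable_on f unit_square"
  obtains I where "\<And>\<epsilon>. 0 < \<epsilon> \<Longrightarrow> \<forall>\<^sub>F N in sequentially. \<forall>z. (\<forall>c<N. \<forall>d<N. z c d \<in> gridcell N c d) \<longrightarrow>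
    \<bar>(\<Sum>c<N. \<Sum>d<N. f (z c d)) / (real N)\<^sup>2 - I\<bar> < \<epsilon>"
proof -
  from assms[unfolded riemann_integrable_on_def] obtain I where I: "\<forall>e>0. \<exists>d>0. \<forall>P. P tagged_division_of unit_square \<and> (\<lambda>z. ball z d) fine P \<longrightarrow>
        \<bar>(\<Sum>(z, K)\<in>P. measure lborel K * f z) - I\<bar> < e"
 ..
  show ?thesis
  proof (rule that[of I])
    fix \<epsilon> :: real assume "0 < \<epsilon>"
    from I[rule_format, OF this] obtain \<delta> where "0 < \<delta> \<and> (\<forall>P. P tagged_division_of unit_square \<and> (\<lambda>z. ball z \<delta>) fine P \<longrightarrow>
        \<bar>(\<Sum>(z, K)\<in>P. measure lborel K * f z) - I\<bar> < \<epsilon>)" ..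
    note \<delta> = conjunct1[OF this] conjunct2[OF this, rule_format, OF conjI]
    have "(\<lambda>N. 2 / real N) \<longlonglongrightarrow> 0" by real_asymp
    then have "\<forall>\<^sub>F N in sequentially. 2 / real N < \<delta>" using \<delta>(1) by (rule order_tendstoD)
    then show "\<forall>\<^sub>F N in sequentially. \<forall>z. (\<forall>c<N. \<forall>d<N. z c d \<in> gridcell N c d) \<longrightarrow>
        \<bar>(\<Sum>c<N. \<Sum>d<N. f (z c d)) / (real N)\<^sup>2 - I\<bar> < \<epsilon>"
      using eventually_gt_at_top[of 0]
    proof eventually_elim
      case (elim N)
      show ?case
      proof (intro allI impI)
        fix z assume z: "\<forall>c<N. \<forall>d<N. z c d \<in> gridcell N c d"
        let ?g = "\<lambda>(c, d). (z c d, gridcell N c d)"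
        let ?P = "?g ` ({..<N} \<times> {..<N})"
        have fine: "(\<lambda>z. ball z \<delta>) fine ?P"
        proof (rule fineI)
          fix x K assume "(x, K) \<in> ?P"
          then obtain c d where cd: "c < N" "d < N" "x = z c d" "K = gridcell N c d" by auto
          show "K \<subseteq> ball x \<delta>"
          proof
            fix w assume w: "w \<in> K"
            obtain u v u' v' where uv: "w = (u, v)" "x = (u', v')" by (cases w; cases x)
            have "(u, v) \<in> gridcell N c d" "(u', v') \<in> gridcell N c d" using w cd z uv by auto
            moreover have "real (Suc c) / real N - real c / real N = 1 / real N" for c
              by (simp add: diff_divide_distrib[symmetric])
            ultimately have "\<bar>u' - u\<bar> \<le> 1 / real N" "\<bar>v' - v\<bar> \<le> 1 / real N"
              unfolding mem_gridcell by (smt (verit, best))+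
            moreover have "dist x w \<le> \<bar>u' - u\<bar> + \<bar>v' - v\<bar>"
              unfolding uv dist_Pair_Pair dist_real_def using sqrt_sum_squares_le_sum_abs by auto
            ultimately show "w \<in> ball x \<delta>" using elim(1) by simp
          qed
        qed
        have inj: "inj_on ?g ({..<N} \<times> {..<N})" using inj_gridcell[OF elim(2)] by (auto intro!: inj_onI)
        have "(\<Sum>(x, K)\<in>?P. measure lborel K * f x) = (\<Sum>(c, d)\<in>{..<N} \<times> {..<N}. 1 / (real N)\<^sup>2 * f (z c d))"
          by (subst sum.reindex[OF inj]) (auto intro!: sum.cong simp: measure_gridcell[OF elim(2)])
        also have "\<dots> = (\<Sum>c<N. \<Sum>d<N. f (z c d)) / (real N)\<^sup>2"
          by (simp add: sum.cartesian_product[symmetric] sum_divide_distrib)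
        finally have "(\<Sum>(x, K)\<in>?P. measure lborel K * f x) = (\<Sum>c<N. \<Sum>d<N. f (z c d)) / (real N)\<^sup>2" .
        then show "\<bar>(\<Sum>c<N. \<Sum>d<N. f (z c d)) / (real N)\<^sup>2 - I\<bar> < \<epsilon>"
          using \<delta>(2)[OF grid_tagged_division fine] elim(2) z by simp
      qed
    qed
  qed
qed

definition sample :: "(real \<times> real \<Rightarrow> real) \<Rightarrow> nat \<Rightarrow> nat \<Rightarrow> nat \<Rightarrow> real" where
  "sample f n a b = f (real (Suc a) / real n, real (Suc b) / real n)"

lemma sample_point_in_gridcell:
  assumes "0 < N" "0 < n"
  shows "(real (Suc a) / real n, real (Suc b) / real n) \<in> gridcell N (cell N n a) (cell N n b)"
proof -
  have "real (cell N n a) / real N \<le> real (Suc a) / real n \<and> real (Suc a) / real n \<le> real (Suc (cell N n a)) / real N" for a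
    using cell_bounds[OF assms, of a] assms by (simp add: divide_simps mult_ac less_imp_le)
  then show ?thesis by (simp add: mem_gridcell)
qed

lemma sample_point_in_square:
  assumes "a < n" "b < n"
  shows "(real (Suc a) / real n, real (Suc b) / real n) \<in> unit_square"
  using assms by auto

lemma near_extrema:
  fixes f :: "'a \<Rightarrow> real"
  assumes "K \<noteq> {}" and "\<And>w. w \<in> K \<Longrightarrow> \<bar>f w\<bar> \<le> C" and "0 < \<epsilon>"
  shows "\<exists>x\<in>K. \<forall>w\<in>K. f w \<le> f x + \<epsilon>"
proof -
  have bdd: "bdd_above (f ` K)" using assms(2) by (intro bdd_aboveI[of _ C]) (auto simp: abs_le_iff)
  have "(SUP w\<in>K. f w) - \<epsilon> < (SUP w\<in>K. f w)" using assms(3) by simp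
  then obtain x where x: "x \<in> K" "(SUP w\<in>K. f w) - \<epsilon> < f x"
    using less_cSUP_iff[OF assms(1) bdd] by blast
  have "f w \<le> f x + \<epsilon>" if "w \<in> K" for w using cSUP_upper[OF that bdd] x(2) by simp
  then show ?thesis using x(1) by blast
qed

lemma grid_approx_riemann:
  assumes ri: "riemann_integrable_on f unit_square" and C: "\<And>z. z \<in> unit_square \<Longrightarrow> \<bar>f z\<bar> \<le> C"
  shows "grid_approx C (sample f)"
  unfolding grid_approx_def
proof (intro allI impI)
  fix \<epsilon>' :: real assume \<epsilon>': "0 < \<epsilon>'"
  define \<epsilon> where "\<epsilon> = \<epsilon>' / 16"
  have \<epsilon>: "0 < \<epsilon>" using \<epsilon>' by (simp add: \<epsilon>_def)
  have C0: "0 \<le> C" using C[of "(0, 0)"] by auto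
  obtain I where I: "\<And>\<epsilon>. 0 < \<epsilon> \<Longrightarrow> \<forall>\<^sub>F N in sequentially. \<forall>z. (\<forall>c<N. \<forall>d<N. z c d \<in> gridcell N c d) \<longrightarrow>
    \<bar>(\<Sum>c<N. \<Sum>d<N. f (z c d)) / (real N)\<^sup>2 - I\<bar> < \<epsilon>"
    using riemann_grid_sum[OF ri] by blast
  show "\<forall>\<^sub>F N in sequentially. \<exists>S. (\<forall>c d. \<bar>S c d\<bar> \<le> C) \<and>
      (\<forall>\<^sub>F n in sequentially. mean_abs n (\<lambda>a b. sample f n a b - S (cell N n a) (cell N n b)) \<le> \<epsilon>')"
    using I[OF \<epsilon>] eventually_gt_at_top[of 0]
  proof eventually_elim
    case (elim N)
    note N = elim(2)
    have ne: "gridcell N c d \<noteq> {}" for c d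
      using mem_gridcell[of "real c / real N" "real d / real N" N c d] by (auto simp: divide_right_mono)
    have bd: "\<bar>f w\<bar> \<le> C" if "c < N" "d < N" "w \<in> gridcell N c d" for w c d
      using gridcell_subset[OF that(1,2)] that(3) C by blast
    have "\<exists>x\<in>gridcell N c d. \<forall>w\<in>gridcell N c d. f w \<le> f x + \<epsilon>" if "c < N" "d < N" for c d
      by (rule near_extrema[OF ne bd \<epsilon>]) (use that in auto)
    then obtain z1 where z1: "\<And>c d. c < N \<Longrightarrow> d < N \<Longrightarrow> z1 c d \<in> gridcell N c d"
      "\<And>c d w. c < N \<Longrightarrow> d < N \<Longrightarrow> w \<in> gridcell N c d \<Longrightarrow> f w \<le> f (z1 c d) + \<epsilon>"
      by metis
    have "\<exists>x\<in>gridcell N c d. \<forall>w\<in>gridcell N c d. - f w \<le> - f x + \<epsilon>" if "c < N" "d < N" for c d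
      by (rule near_extrema[OF ne _ \<epsilon>, where C = C]) (use that bd in auto)
    then obtain z2 where z2: "\<And>c d. c < N \<Longrightarrow> d < N \<Longrightarrow> z2 c d \<in> gridcell N c d"
      "\<And>c d w. c < N \<Longrightarrow> d < N \<Longrightarrow> w \<in> gridcell N c d \<Longrightarrow> - f w \<le> - f (z2 c d) + \<epsilon>"
      by metis
    define osc where "osc c d = f (z1 c d) - f (z2 c d) + 2 * \<epsilon>" for c d
    have osc0: "0 \<le> osc c d" if "c < N" "d < N" for c d
      using z1(2)[OF that z2(1)[OF that]] \<epsilon> by (simp add: osc_def)
    have osc_sum: "(\<Sum>c<N. \<Sum>d<N. osc c d) / (real N)\<^sup>2 \<le> 4 * \<epsilon>"
    proof -
      have "(\<Sum>c<N. \<Sum>d<N. osc c d) = (\<Sum>c<N. \<Sum>d<N. f (z1 c d)) - (\<Sum>c<N. \<Sum>d<N. f (z2 c d)) + (real N)\<^sup>2 * (2 * \<epsilon>)"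
        by (simp add: osc_def sum.distrib sum_subtractf power2_eq_square)
      then have "(\<Sum>c<N. \<Sum>d<N. osc c d) / (real N)\<^sup>2 =
          (\<Sum>c<N. \<Sum>d<N. f (z1 c d)) / (real N)\<^sup>2 - (\<Sum>c<N. \<Sum>d<N. f (z2 c d)) / (real N)\<^sup>2 + 2 * \<epsilon>"
        using N by (simp add: add_divide_distrib diff_divide_distrib)
      moreover have "\<bar>(\<Sum>c<N. \<Sum>d<N. f (z1 c d)) / (real N)\<^sup>2 - I\<bar> < \<epsilon>"
        using elim(1) z1(1) by blast
      moreover have "\<bar>(\<Sum>c<N. \<Sum>d<N. f (z2 c d)) / (real N)\<^sup>2 - I\<bar> < \<epsilon>"
        using elim(1) z2(1) by blast
      ultimately show ?thesis by linarith
    qed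
    define S where "S c d = (if c < N \<and> d < N then f (z2 c d) else 0)" for c d
    have "\<bar>S c d\<bar> \<le> C" for c d using bd[OF _ _ z2(1)] C0 by (auto simp: S_def)
    moreover have "\<forall>\<^sub>F n in sequentially. mean_abs n (\<lambda>a b. sample f n a b - S (cell N n a) (cell N n b)) \<le> \<epsilon>'"
      using eventually_ge_at_top[of N]
    proof eventually_elim
      case (elim n)
      have n: "0 < n" using N elim by simp
      let ?k = "\<lambda>c. real (card {a \<in> {..<n}. cell N n a = c})"
      have k: "?k c \<le> 2 * real n / real N" if "c < N" for c
      proof -
        have "1 \<le> real n / real N" using elim N by simp
        then show ?thesis using card_cell_preimage[OF N n that] by linarith
      qed
      have "(\<Sum>a<n. \<Sum>b<n. \<bar>sample f n a b - S (cell N n a) (cell N n b)\<bar>) \<le> (\<Sum>a<n. \<Sum>b<n. osc (cell N n a) (cell N n b))"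
      proof (intro sum_mono)
        fix a b assume ab: "a \<in> {..<n}" "b \<in> {..<n}"
        then have c: "cell N n a < N" "cell N n b < N" using cell_less[OF N] by auto
        let ?w = "(real (Suc a) / real n, real (Suc b) / real n)"
        have w: "?w \<in> gridcell N (cell N n a) (cell N n b)" by (rule sample_point_in_gridcell[OF N n])
        show "\<bar>sample f n a b - S (cell N n a) (cell N n b)\<bar> \<le> osc (cell N n a) (cell N n b)"
          using z1(2)[OF c w] z2(2)[OF c w] z1(2)[OF c z2(1)[OF c]] c \<epsilon> unfolding sample_def S_def osc_def by simp
      qed
      also have "\<dots> = (\<Sum>a<n. (\<lambda>c. \<Sum>d<N. ?k d * osc c d) (cell N n a))"
        by (simp only: sum_cell[OF N, of "osc (cell N n a)" for a])
      also have "\<dots> = (\<Sum>c<N. ?k c * (\<Sum>d<N. ?k d * osc c d))"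
        by (rule sum_cell[OF N])
      also have "\<dots> \<le> (\<Sum>c<N. (2 * real n / real N) * (\<Sum>d<N. (2 * real n / real N) * osc c d))"
        using osc0 k by (intro sum_mono mult_mono sum_nonneg mult_nonneg_nonneg) auto
      also have "\<dots> = 4 * (real n)\<^sup>2 * ((\<Sum>c<N. \<Sum>d<N. osc c d) / (real N)\<^sup>2)"
      proof -
        have "(\<Sum>c<N. (2 * real n / real N) * (\<Sum>d<N. (2 * real n / real N) * osc c d)) =
            (2 * real n / real N) * ((2 * real n / real N) * (\<Sum>c<N. \<Sum>d<N. osc c d))"
          by (simp only: sum_distrib_left)
        then show ?thesis by (simp add: power2_eq_square)
      qed
      also have "\<dots> \<le> 4 * (real n)\<^sup>2 * (4 * \<epsilon>)" by (intro mult_left_mono osc_sum) auto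
      finally have "mean_abs n (\<lambda>a b. sample f n a b - S (cell N n a) (cell N n b)) \<le> 4 * (real n)\<^sup>2 * (4 * \<epsilon>) / (real n)\<^sup>2"
        unfolding mean_abs_def by (rule divide_right_mono) simp
      then show ?case using n by (simp add: \<epsilon>_def)
    qed
    ultimately show ?case by blast
  qed
qed

subsection \<open>Patterns of tree walks\<close>

text \<open>
  A pattern is the canonical representative of all walks with the same coincidences: \<open>p j\<close> is the first
  time at which the vertex visited at time \<open>j\<close> is visited.
\<close>

definition tree_patterns :: "nat \<Rightarrow> (nat \<Rightarrow> nat) set" where
  "tree_patterns k = {p \<in> {..<k} \<rightarrow>\<^sub>E {..<k}. (\<forall>j<k. p j \<le> j \<and> p (p j) = p j) \<and> ctree k p}"

definition relabel :: "nat \<Rightarrow> (nat \<Rightarrow> 'v) \<Rightarrow> (nat \<Rightarrow> nat) \<Rightarrow> nat \<Rightarrow> 'v" where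
  "relabel k q p = (\<lambda>j\<in>{..<k}. q (p j))"

definition pattern :: "nat \<Rightarrow> (nat \<Rightarrow> 'v) \<Rightarrow> nat \<Rightarrow> nat" where
  "pattern k i = (\<lambda>j\<in>{..<k}. LEAST j'. i j' = i j)"

lemma finite_tree_patterns: "finite (tree_patterns k)"
proof -
  have "tree_patterns k \<subseteq> {..<k} \<rightarrow>\<^sub>E {..<k}" by (auto simp: tree_patterns_def)
  then show ?thesis by (rule finite_subset) (intro finite_PiE, auto)
qed

lemma pattern:
  assumes "j < k"
  shows "pattern k i j \<le> j" "i (pattern k i j) = i j"
  using assms Least_le[of "\<lambda>j'. i j' = i j" j] LeastI[of "\<lambda>j'. i j' = i j" j] by (simp_all add: pattern_def)

lemma pattern_eq_iff:
  assumes "j < k" "j' < k"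
  shows "pattern k i j = pattern k i j' \<longleftrightarrow> i j = i j'"
proof
  assume "pattern k i j = pattern k i j'"
  then show "i j = i j'" using pattern(2)[OF assms(1), of i] pattern(2)[OF assms(2), of i] by metis
qed (simp add: pattern_def assms)

lemma cedge_relabel:
  assumes "0 < k" "j < k"
  shows "cedge k (relabel k q p) j = q ` cedge k p j"
  using assms by (simp add: cedge_def relabel_def)

lemma relabel_edges:
  assumes k: "0 < k" and inj: "inj_on q (p ` {..<k})"
  shows "inj_on (image q) (cedges k p)" "cedges k (relabel k q p) = image q ` cedges k p"
    "e \<in> cedges k p \<Longrightarrow> edge_mult k (relabel k q p) (q ` e) = edge_mult k p e"
    "ctree k (relabel k q p) \<longleftrightarrow> ctree k p"
proof -
  have sub: "cedges k p \<subseteq> Pow (p ` {..<k})" using cedges_subset[OF k] by blast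
  show inj': "inj_on (image q) (cedges k p)"
    by (rule inj_on_subset[OF inj_on_image_Pow[OF inj] sub])
  show eq: "cedges k (relabel k q p) = image q ` cedges k p"
    unfolding cedges_def image_image by (intro image_cong refl cedge_relabel k) simp
  show "edge_mult k (relabel k q p) (q ` e) = edge_mult k p e" if e: "e \<in> cedges k p"
  proof -
    have "cedge k (relabel k q p) j = q ` e \<longleftrightarrow> cedge k p j = e" if "j < k" for j
      using inj_onD[OF inj', of "cedge k p j" e] e that by (auto simp: cedge_relabel[OF k] cedges_def)
    then show ?thesis unfolding edge_mult_def by (intro arg_cong[of _ _ card] Collect_cong) blast
  qed
  have "relabel k q p ` {..<k} = q ` p ` {..<k}" by (auto simp: relabel_def)
  then have "card (relabel k q p ` {..<k}) = card (p ` {..<k})" using card_image[OF inj] by simp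
  moreover have "card (cedges k (relabel k q p)) = card (cedges k p)" using card_image[OF inj'] eq by simp
  ultimately show "ctree k (relabel k q p) \<longleftrightarrow> ctree k p" by (simp add: ctree_def)
qed

lemma pattern_relabel:
  assumes p: "p \<in> tree_patterns k" and inj: "inj_on q (p ` {..<k})"
  shows "pattern k (relabel k q p) = p"
proof
  fix j
  show "pattern k (relabel k q p) j = p j"
  proof (cases "j < k")
    case False
    then show ?thesis using p by (auto simp: pattern_def tree_patterns_def PiE_def extensional_def)
  next
    case True
    have pj: "p j \<le> j" "p (p j) = p j" using p True by (auto simp: tree_patterns_def)
    have "(LEAST j'. relabel k q p j' = relabel k q p j) = p j"
    proof (rule Least_equality)
      show "relabel k q p (p j) = relabel k q p j" using pj True by (simp add: relabel_def)
      fix y assume y: "relabel k q p y = relabel k q p j"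
      show "p j \<le> y"
      proof (cases "y < k")
        case False then show ?thesis using pj True by simp
      next
        case yk: True
        then have "p y = p j" using y True inj_onD[OF inj, of "p y" "p j"] by (auto simp: relabel_def)
        then show ?thesis using p yk by (auto simp: tree_patterns_def)
      qed
    qed
    then show ?thesis using True by (simp add: pattern_def)
  qed
qed

lemma relabel_pattern:
  assumes "i \<in> {..<k} \<rightarrow>\<^sub>E A"
  shows "relabel k (restrict i (pattern k i ` {..<k})) (pattern k i) = i"
proof
  fix j
  show "relabel k (restrict i (pattern k i ` {..<k})) (pattern k i) j = i j"
    using assms pattern(2)[of j k i] by (cases "j < k") (auto simp: relabel_def PiE_def extensional_def)
qed

lemma inj_on_pattern: "inj_on i (pattern k i ` {..<k})"
proof (rule inj_onI)
  fix x y assume "x \<in> pattern k i ` {..<k}" "y \<in> pattern k i ` {..<k}" "i x = i y"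
  then obtain j j' where "j < k" "j' < k" "x = pattern k i j" "y = pattern k i j'" by auto
  then show "x = y" using \<open>i x = i y\<close> pattern(2)[of j k i] pattern(2)[of j' k i] pattern_eq_iff[of j k j' i] by simp
qed

lemma pattern_in_tree_patterns:
  assumes k: "0 < k" and i: "i \<in> {..<k} \<rightarrow>\<^sub>E A" "ctree k i"
  shows "pattern k i \<in> tree_patterns k"
proof -
  let ?p = "pattern k i"
  have lt: "?p j < k" if "j < k" for j using pattern(1)[OF that, of i] that by simp
  have "?p (?p j) = ?p j" if "j < k" for j
    using pattern_eq_iff[OF lt[OF that] that, of i] pattern(2)[OF that, of i] by simp
  moreover have "?p \<in> {..<k} \<rightarrow>\<^sub>E {..<k}" using lt by (auto simp: pattern_def PiE_def extensional_def)
  moreover have "ctree k ?p"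
  proof -
    have "inj_on (restrict i (?p ` {..<k})) (?p ` {..<k})" using inj_on_pattern[of i k] by (simp add: inj_on_restrict_eq)
    from relabel_edges(4)[OF k this] show ?thesis using relabel_pattern[OF i(1)] i(2) by simp
  qed
  ultimately show ?thesis using pattern(1)[of _ k i] by (simp add: tree_patterns_def)
qed

abbreviation labelings :: "nat \<Rightarrow> (nat \<Rightarrow> nat) \<Rightarrow> nat \<Rightarrow> (nat \<Rightarrow> nat) set" where
  "labelings k p n \<equiv> {q \<in> p ` {..<k} \<rightarrow>\<^sub>E {..<n}. inj_on q (p ` {..<k})}"

lemma sum_tree_walks:
  assumes k: "0 < k"
  shows "(\<Sum>i\<in>{i \<in> walks k n. ctree k i}. F i) = (\<Sum>p\<in>tree_patterns k. \<Sum>q\<in>labelings k p n. F (relabel k q p) :: real)"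
proof -
  have fin: "finite (labelings k p n)" for p by (rule finite_subset[of _ "p ` {..<k} \<rightarrow>\<^sub>E {..<n}"]) (auto intro: finite_PiE)
  have "(\<Sum>i\<in>{i \<in> walks k n. ctree k i}. F i) = (\<Sum>(p, q)\<in>Sigma (tree_patterns k) (\<lambda>p. labelings k p n). F (relabel k q p))"
  proof (rule sum.reindex_bij_witness[where i = "\<lambda>(p, q). relabel k q p"
        and j = "\<lambda>i. (pattern k i, restrict i (pattern k i ` {..<k}))"])
    fix i assume i: "i \<in> {i \<in> walks k n. ctree k i}"
    then have iw: "i \<in> {..<k} \<rightarrow>\<^sub>E {..<n}" by simp
    show "(case (pattern k i, restrict i (pattern k i ` {..<k})) of (p, q) \<Rightarrow> relabel k q p) = i"
      using relabel_pattern[OF iw] by simp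
    have "restrict i (pattern k i ` {..<k}) \<in> labelings k (pattern k i) n"
    proof -
      have "i (pattern k i j) < n" if "j < k" for j using pattern(2)[OF that, of i] iw that by (auto simp: PiE_def Pi_def)
      then show ?thesis using inj_on_pattern[of i k] by (auto simp: inj_on_restrict_eq)
    qed
    then show "(pattern k i, restrict i (pattern k i ` {..<k})) \<in> Sigma (tree_patterns k) (\<lambda>p. labelings k p n)"
      using pattern_in_tree_patterns[OF k iw] i by simp
    show "(case (pattern k i, restrict i (pattern k i ` {..<k})) of (p, q) \<Rightarrow> F (relabel k q p)) = F i"
      using relabel_pattern[OF iw] by simp
  next
    fix z assume z: "z \<in> Sigma (tree_patterns k) (\<lambda>p. labelings k p n)"
    then obtain p q where pq: "z = (p, q)" "p \<in> tree_patterns k" "q \<in> p ` {..<k} \<rightarrow>\<^sub>E {..<n}" "inj_on q (p ` {..<k})" by auto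
    have pat: "pattern k (relabel k q p) = p" by (rule pattern_relabel[OF pq(2,4)])
    have "restrict (relabel k q p) (p ` {..<k}) = q"
    proof
      fix v
      show "restrict (relabel k q p) (p ` {..<k}) v = q v"
      proof (cases "v \<in> p ` {..<k}")
        case True
        then obtain j where j: "j < k" "v = p j" by auto
        then have "p (p j) = p j" "p j < k" using pq(2) by (auto simp: tree_patterns_def intro: le_less_trans)
        then show ?thesis using j by (simp add: relabel_def)
      next
        case False
        then show ?thesis using pq(3) by (auto simp: PiE_def extensional_def)
      qed
    qed
    then show "(pattern k (case z of (p, q) \<Rightarrow> relabel k q p),
        restrict (case z of (p, q) \<Rightarrow> relabel k q p) (pattern k (case z of (p, q) \<Rightarrow> relabel k q p) ` {..<k})) = z"
      by (simp add: pq(1) pat)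
    have "relabel k q p \<in> walks k n" using pq(3) by (auto simp: relabel_def PiE_def Pi_def extensional_def)
    moreover have "ctree k (relabel k q p)"
      using relabel_edges(4)[OF k pq(4)] pq(2) by (simp add: tree_patterns_def)
    ultimately show "(case z of (p, q) \<Rightarrow> relabel k q p) \<in> {i \<in> walks k n. ctree k i}" by (simp add: pq(1))
  qed
  also have "\<dots> = (\<Sum>p\<in>tree_patterns k. \<Sum>q\<in>labelings k p n. F (relabel k q p))"
    by (rule sum.Sigma[symmetric]) (use finite_tree_patterns fin in auto)
  finally show ?thesis .
qed

lemma simple_graph_tree_pattern:
  assumes "0 < k" "p \<in> tree_patterns k"
  shows "simple_graph (p ` {..<k}) (cedges k p)"
  unfolding simple_graph_def
proof (intro conjI ballI)
  fix e assume e: "e \<in> cedges k p"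
  have ct: "ctree k p" using assms(2) by (simp add: tree_patterns_def)
  obtain a b where ab: "a \<noteq> b" "e = {a, b}" using ctree_even(2)[OF ct e] by blast
  have "e \<subseteq> p ` {..<k}" by (rule cedges_subset[OF assms(1) e])
  then have "a \<in> p ` {..<k}" "b \<in> p ` {..<k}" unfolding ab(2) by simp_all
  then show "\<exists>a\<in>p ` {..<k}. \<exists>b\<in>p ` {..<k}. a \<noteq> b \<and> e = {a, b}" using ab by blast
qed simp

lemma non_injective_labelings:
  assumes V: "finite V" and n: "0 < n"
  shows "(\<Sum>q\<in>V \<rightarrow>\<^sub>E {..<n}. of_bool (\<not> inj_on q V)) / real n ^ card V \<le> (real (card V))\<^sup>2 / real n"
proof -
  let ?D = "{(a, b) \<in> V \<times> V. a \<noteq> b}"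
  have finD: "finite ?D" by (rule finite_subset[of _ "V \<times> V"]) (use V in auto)
  have "(\<Sum>q\<in>V \<rightarrow>\<^sub>E {..<n}. of_bool (\<not> inj_on q V)) \<le> (\<Sum>q\<in>V \<rightarrow>\<^sub>E {..<n}. \<Sum>(a, b)\<in>?D. \<bar>of_bool (q a = q b)\<bar> :: real)"
  proof (rule sum_mono)
    fix q
    show "of_bool (\<not> inj_on q V) \<le> (\<Sum>(a, b)\<in>?D. \<bar>of_bool (q a = q b)\<bar> :: real)"
    proof (cases "inj_on q V")
      case True
      then show ?thesis by (auto intro!: sum_nonneg)
    next
      case False
      then obtain a b where ab: "a \<in> V" "b \<in> V" "a \<noteq> b" "q a = q b" by (auto simp: inj_on_def)
      have "(\<lambda>(a, b). \<bar>of_bool (q a = q b)\<bar> :: real) (a, b) \<le> (\<Sum>(a, b)\<in>?D. \<bar>of_bool (q a = q b)\<bar>)"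
        using ab finD by (intro member_le_sum) auto
      then show ?thesis using False ab by simp
    qed
  qed
  also have "\<dots> = (\<Sum>(a, b)\<in>?D. \<Sum>q\<in>V \<rightarrow>\<^sub>E {..<n}. \<bar>of_bool (q a = q b)\<bar>)"
    by (subst sum.swap) (simp add: case_prod_beta)
  finally have "(\<Sum>q\<in>V \<rightarrow>\<^sub>E {..<n}. of_bool (\<not> inj_on q V)) / real n ^ card V \<le>
      (\<Sum>(a, b)\<in>?D. (\<Sum>q\<in>V \<rightarrow>\<^sub>E {..<n}. \<bar>of_bool (q a = q b)\<bar>) / real n ^ card V)"
    using n by (simp add: divide_right_mono case_prod_beta flip: sum_divide_distrib)
  also have "\<dots> = (\<Sum>(a, b)\<in>?D. 1 / real n)"
  proof (rule sum.cong[OF refl])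
    fix z assume z: "z \<in> ?D"
    obtain a b where ab: "z = (a, b)" "a \<in> V" "b \<in> V" "a \<noteq> b" using z by auto
    have "(\<Sum>q\<in>V \<rightarrow>\<^sub>E {..<n}. \<bar>of_bool (q a = q b)\<bar>) / real n ^ card V = mean_abs n (\<lambda>x y. of_bool (x = y))"
      using mean_over_PiE[OF V ab(2-4) n, of "\<lambda>x y. of_bool (x = y)"] by simp
    also have "\<dots> = 1 / real n" using n by (simp add: mean_abs_def of_bool_def power2_eq_square)
    finally show "(case z of (a, b) \<Rightarrow> (\<Sum>q\<in>V \<rightarrow>\<^sub>E {..<n}. \<bar>of_bool (q a = q b)\<bar>) / real n ^ card V) = (case z of (a, b) \<Rightarrow> 1 / real n)"
      by (simp add: ab(1))
  qed
  also have "\<dots> = real (card ?D) / real n" by (simp add: case_prod_beta)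
  also have "\<dots> \<le> (real (card V))\<^sup>2 / real n"
  proof (rule divide_right_mono)
    have "card ?D \<le> card (V \<times> V)" using V by (intro card_mono) auto
    then show "real (card ?D) \<le> (real (card V))\<^sup>2"
      by (simp add: card_cartesian_product power2_eq_square flip: of_nat_mult)
  qed simp
  finally show ?thesis .
qed

lemma injective_dens_diff:
  assumes G: "simple_graph V E" and n: "0 < n" and C: "0 \<le> C"
    and f: "\<And>e a b. e \<in> E \<Longrightarrow> a < n \<Longrightarrow> b < n \<Longrightarrow> \<bar>f e a b\<bar> \<le> C"
  shows "\<bar>dens n V E f - (\<Sum>q\<in>{q \<in> V \<rightarrow>\<^sub>E {..<n}. inj_on q V}. \<Prod>e\<in>E. f e (q (Min e)) (q (Max e))) / real n ^ card V\<bar>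
    \<le> C ^ card E * ((real (card V))\<^sup>2 / real n)"
proof -
  note G = simple_graphD[OF G]
  let ?Q = "V \<rightarrow>\<^sub>E {..<n}" and ?w = "\<lambda>q. \<Prod>e\<in>E. f e (q (Min e)) (q (Max e))"
  have fin: "finite ?Q" using G(1) by (intro finite_PiE) auto
  have "(\<Sum>q\<in>{q \<in> ?Q. inj_on q V}. ?w q) = (\<Sum>q\<in>?Q. ?w q * of_bool (inj_on q V))"
    using fin by (intro sum.mono_neutral_cong_left) auto
  then have "(\<Sum>q\<in>?Q. ?w q) - (\<Sum>q\<in>{q \<in> ?Q. inj_on q V}. ?w q) = (\<Sum>q\<in>?Q. ?w q * of_bool (\<not> inj_on q V))"
    by (simp add: of_bool_not_iff algebra_simps sum_subtractf[symmetric])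
  also have "\<bar>\<dots>\<bar> \<le> (\<Sum>q\<in>?Q. C ^ card E * of_bool (\<not> inj_on q V))"
  proof (rule order_trans[OF sum_abs sum_mono])
    fix q assume q: "q \<in> ?Q"
    have "\<bar>?w q\<bar> \<le> (\<Prod>e\<in>E. C)"
      unfolding abs_prod using G q by (intro prod_mono conjI abs_ge_zero f) (auto simp: PiE_def Pi_def)
    then show "\<bar>?w q * of_bool (\<not> inj_on q V)\<bar> \<le> C ^ card E * of_bool (\<not> inj_on q V)"
      by (auto simp: abs_mult)
  qed
  finally have "\<bar>(\<Sum>q\<in>?Q. ?w q) - (\<Sum>q\<in>{q \<in> ?Q. inj_on q V}. ?w q)\<bar> / real n ^ card V \<le>
      C ^ card E * ((\<Sum>q\<in>?Q. of_bool (\<not> inj_on q V)) / real n ^ card V)"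
    by (simp add: divide_right_mono flip: sum_distrib_left)
  also have "\<dots> \<le> C ^ card E * ((real (card V))\<^sup>2 / real n)"
    using C by (intro mult_left_mono non_injective_labelings G(1) n) auto
  finally show ?thesis by (simp add: dens_def diff_divide_distrib[symmetric] abs_divide)
qed

subsection \<open>Tree patterns and set partitions\<close>

definition step_partition :: "nat \<Rightarrow> (nat \<Rightarrow> nat) \<Rightarrow> nat set set" where
  "step_partition k p = (\<lambda>e. Suc ` {j. j < k \<and> cedge k p j = e}) ` cedges k p"

lemma step_block_inj: "inj_on (\<lambda>e. Suc ` {j. j < k \<and> cedge k p j = e}) (cedges k p)"
proof (rule inj_onI)
  fix e e' assume e: "e \<in> cedges k p" and eq: "Suc ` {j. j < k \<and> cedge k p j = e} = Suc ` {j. j < k \<and> cedge k p j = e'}"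
  obtain j where j: "j < k" "cedge k p j = e" using e by (auto simp: cedges_def)
  have "{j. j < k \<and> cedge k p j = e} = {j. j < k \<and> cedge k p j = e'}" using eq by (simp add: inj_image_eq_iff)
  then show "e = e'" using j by blast
qed

lemma partition_on_step_partition: "partition_on {1..k} (step_partition k p)"
proof (rule partition_onI)
  show "\<Union>(step_partition k p) = {1..k}"
  proof
    show "{1..k} \<subseteq> \<Union>(step_partition k p)"
    proof
      fix x assume "x \<in> {1..k}"
      then obtain j where j: "x = Suc j" "j < k" by (cases x) auto
      then show "x \<in> \<Union>(step_partition k p)"
        unfolding step_partition_def cedges_def by (intro UnionI[OF imageI[of "cedge k p j"]]) auto
    qed
  qed (auto simp: step_partition_def)
  show "disjnt P Q" if "P \<in> step_partition k p" "Q \<in> step_partition k p" "P \<noteq> Q" for P Q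
    using that by (auto simp: step_partition_def disjnt_def)
  show "{} \<notin> step_partition k p" by (auto simp: step_partition_def cedges_def)
qed

lemma prod_step_partition: "(\<Prod>V\<in>step_partition k p. c (card V)) = (\<Prod>e\<in>cedges k p. c (edge_mult k p e))"
  unfolding step_partition_def edge_mult_def by (simp add: prod.reindex[OF step_block_inj] card_image)

lemma step_partition_same_block:
  assumes "j < k" "j' < k"
  shows "(\<exists>V\<in>step_partition k p. Suc j \<in> V \<and> Suc j' \<in> V) \<longleftrightarrow> cedge k p j = cedge k p j'"
  using assms by (auto simp: step_partition_def cedges_def)

text \<open>
  The partition of the steps determines the walk: a step in a new block leads to a new vertex, since the
  walk traces a tree, and a step in an old block goes to the other end of a known edge.
\<close>

lemma inj_on_step_partition:
  assumes k: "0 < k"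
  shows "inj_on (step_partition k) (tree_patterns k)"
proof (rule inj_onI)
  fix p p' assume p: "p \<in> tree_patterns k" and p': "p' \<in> tree_patterns k" and eq: "step_partition k p = step_partition k p'"
  have same: "cedge k p j = cedge k p j' \<longleftrightarrow> cedge k p' j = cedge k p' j'" if "j < k" "j' < k" for j j'
    using step_partition_same_block[OF that, of p] step_partition_same_block[OF that, of p'] eq by simp
  have step: "cedge k r j = {r j, r (Suc j)}" if "Suc j < k" for r :: "nat \<Rightarrow> nat" and j
    using that by (simp add: cedge_def)
  have new: "r (Suc j) = Suc j"
    if r: "r \<in> tree_patterns k" and j: "Suc j < k" and fresh: "\<And>s. s < j \<Longrightarrow> cedge k r s \<noteq> cedge k r j" for r j
  proof -
    let ?w = "\<lambda>t. r (t mod k)"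
    have w: "?w t = r t" if "t < k" for t using that by simp
    have "tree_walk ?w k" using r ctree_tree_walk[OF k, of r] by (simp add: tree_patterns_def)
    then have tw: "tree_walk ?w (Suc j)" by (rule tree_walk_le) (use j in simp)
    have "{?w j, ?w (Suc j)} \<notin> walk_edges ?w j"
    proof
      assume "{?w j, ?w (Suc j)} \<in> walk_edges ?w j"
      then obtain s where s: "s < j" "{?w j, ?w (Suc j)} = {?w s, ?w (Suc s)}" by auto
      then have "cedge k r j = cedge k r s" using j step[of j r] step[of s r] by simp
      then show False using fresh[OF s(1)] by simp
    qed
    from tree_walk_SucD(2)[OF tw this] have "?w (Suc j) \<notin> ?w ` {..j}" .
    then have nin: "r (Suc j) \<noteq> r t" if "t \<le> j" for t using that j by (auto simp: image_iff)
    have "r (Suc j) \<le> Suc j" "r (r (Suc j)) = r (Suc j)" using r j by (auto simp: tree_patterns_def)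
    then show ?thesis using nin[of "r (Suc j)"] by (metis le_SucE)
  qed
  have "j < k \<Longrightarrow> p j = p' j" for j
  proof (induction j rule: less_induct)
    case (less j)
    show ?case
    proof (cases j)
      case 0
      have "p 0 \<le> 0" "p' 0 \<le> 0" using p p' k by (auto simp: tree_patterns_def)
      then show ?thesis using 0 by simp
    next
      case (Suc j0)
      have j0: "Suc j0 < k" "j0 < k" using less.prems Suc by auto
      show ?thesis
      proof (cases "\<exists>s<j0. cedge k p s = cedge k p j0")
        case False
        then have "p (Suc j0) = Suc j0" using new[OF p j0(1)] by blast
        moreover have "p' (Suc j0) = Suc j0"
        proof (rule new[OF p' j0(1)])
          fix s assume "s < j0"
          then show "cedge k p' s \<noteq> cedge k p' j0" using False same[of s j0] j0 by auto
        qed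
        ultimately show ?thesis using Suc by simp
      next
        case True
        then obtain s where s: "s < j0" "cedge k p s = cedge k p j0" by blast
        have s': "cedge k p' s = cedge k p' j0" using same[of s j0] s j0 by simp
        have e: "{p s, p (Suc s)} = {p j0, p (Suc j0)}" "{p' s, p' (Suc s)} = {p' j0, p' (Suc j0)}"
          using s s' j0 step[of s] step[of j0] by auto
        have "p s = p' s" "p (Suc s) = p' (Suc s)" "p j0 = p' j0"
          using less.IH[of s] less.IH[of "Suc s"] less.IH[of j0] s(1) Suc j0 by auto
        then have "{p j0, p (Suc j0)} = {p j0, p' (Suc j0)}" using e by simp
        then show ?thesis using Suc by (auto simp: doubleton_eq_iff)
      qed
    qed
  qed
  moreover have "p j = p' j" if "\<not> j < k" for j
    using p p' that by (auto simp: tree_patterns_def PiE_def extensional_def)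
  ultimately show "p = p'" by (intro ext) blast
qed

lemma sum_tree_patterns_le_partition_sum:
  assumes k: "0 < k" and c: "\<And>j. 0 < j \<Longrightarrow> 0 \<le> c j"
  shows "(\<Sum>p\<in>tree_patterns k. \<Prod>e\<in>cedges k p. c (edge_mult k p e)) \<le> partition_sum c k"
proof -
  have "(\<Sum>p\<in>tree_patterns k. \<Prod>e\<in>cedges k p. c (edge_mult k p e)) =
      (\<Sum>\<sigma>\<in>step_partition k ` tree_patterns k. \<Prod>V\<in>\<sigma>. c (card V))"
    by (simp add: sum.reindex[OF inj_on_step_partition[OF k]] prod_step_partition)
  also have "\<dots> \<le> (\<Sum>\<sigma> | partition_on {1..k} \<sigma>. \<Prod>V\<in>\<sigma>. c (card V))"
  proof (rule sum_mono2)
    show "finite {\<sigma>. partition_on {1..k} \<sigma>}" by (rule finitely_many_partition_on) simp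
    show "step_partition k ` tree_patterns k \<subseteq> {\<sigma>. partition_on {1..k} \<sigma>}"
      using partition_on_step_partition by blast
    fix \<sigma> assume "\<sigma> \<in> {\<sigma>. partition_on {1..k} \<sigma>} - step_partition k ` tree_patterns k"
    then have \<sigma>: "partition_on {1..k} \<sigma>" by simp
    show "0 \<le> (\<Prod>V\<in>\<sigma>. c (card V))"
    proof (intro prod_nonneg c)
      fix V assume V: "V \<in> \<sigma>"
      have "V \<noteq> {}" using partition_onD3[OF \<sigma>] V by blast
      moreover have "finite V" using partition_onD1[OF \<sigma>] V by (metis Union_upper finite_atLeastAtMost finite_subset)
      ultimately show "0 < card V" by (simp add: card_gt_0_iff)
    qed
  qed
  finally show ?thesis by (simp add: partition_sum_def)
qed

subsection \<open>The limiting moments\<close>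

definition limit_kernel :: "(nat \<Rightarrow> real \<times> real \<Rightarrow> real) \<Rightarrow> real \<Rightarrow> nat \<Rightarrow> nat \<Rightarrow> nat \<Rightarrow> nat \<Rightarrow> real" where
  "limit_kernel D \<alpha> s n a b = sample (D s) n a b * band (\<alpha> * real n) n a b"

definition tree_dens :: "(nat \<Rightarrow> real \<times> real \<Rightarrow> real) \<Rightarrow> real \<Rightarrow> nat \<Rightarrow> (nat \<Rightarrow> nat) \<Rightarrow> nat \<Rightarrow> real" where
  "tree_dens D \<alpha> k p n = dens n (p ` {..<k}) (cedges k p) (\<lambda>e. limit_kernel D \<alpha> (edge_mult k p e div 2) n)"

definition limit_moment :: "(nat \<Rightarrow> real \<times> real \<Rightarrow> real) \<Rightarrow> real \<Rightarrow> nat \<Rightarrow> real" where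
  "limit_moment D \<alpha> k = (if k = 0 then 1 else \<Sum>p\<in>tree_patterns k. lim (tree_dens D \<alpha> k p))"

lemma dens_cong:
  assumes "simple_graph V E" and "\<And>e a b. e \<in> E \<Longrightarrow> a < n \<Longrightarrow> b < n \<Longrightarrow> f e a b = f' e a b"
  shows "dens n V E f = dens n V E f'"
proof -
  note G = simple_graphD[OF assms(1)]
  have "(\<Prod>e\<in>E. f e (q (Min e)) (q (Max e))) = (\<Prod>e\<in>E. f' e (q (Min e)) (q (Max e)))" if "q \<in> V \<rightarrow>\<^sub>E {..<n}" for q
    using that G by (intro prod.cong refl assms(2)) (auto simp: PiE_def Pi_def)
  then show ?thesis by (simp add: dens_def)
qed

lemma edge_mult_le: "edge_mult k p e \<le> k"
proof -
  have "edge_mult k p e \<le> card {..<k}" unfolding edge_mult_def by (intro card_mono) auto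
  then show ?thesis by simp
qed

lemma tree_pattern_edge_mult:
  assumes "p \<in> tree_patterns k" "e \<in> cedges k p"
  shows "2 * (edge_mult k p e div 2) = edge_mult k p e" "1 \<le> edge_mult k p e div 2" "edge_mult k p e div 2 \<le> k"
  using assms ctree_even(1,3)[of k p e] edge_mult_le[of k p e] by (auto simp: tree_patterns_def)

lemma tree_dens_limit_data:
  assumes "0 < k" "p \<in> tree_patterns k"
  shows "tree_dens (limit_data g) \<alpha> k p = tree_dens g \<alpha> k p"
proof
  fix n
  show "tree_dens (limit_data g) \<alpha> k p n = tree_dens g \<alpha> k p n"
    unfolding tree_dens_def
  proof (rule dens_cong[OF simple_graph_tree_pattern[OF assms]])
    fix e a b assume *: "e \<in> cedges k p" "a < n" "b < n"
    then show "limit_kernel (limit_data g) \<alpha> (edge_mult k p e div 2) n a b = limit_kernel g \<alpha> (edge_mult k p e div 2) n a b"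
      using tree_pattern_edge_mult(2)[OF assms(2) *(1)] sample_point_in_square[OF *(2,3)]
      by (simp add: limit_kernel_def sample_def limit_data_def)
  qed
qed

lemma limit_moment_limit_data: "limit_moment (limit_data g) \<alpha> k = limit_moment g \<alpha> k"
  by (auto simp: limit_moment_def tree_dens_limit_data intro!: sum.cong)

lemma tree_patterns_odd:
  assumes "odd k" shows "tree_patterns k = {}"
proof (rule ccontr)
  assume "tree_patterns k \<noteq> {}"
  then obtain p where p: "p \<in> tree_patterns k" by blast
  have "k = (\<Sum>j<k. 1)" by simp
  also have "\<dots> = (\<Sum>e\<in>cedges k p. \<Sum>j\<in>{j \<in> {..<k}. cedge k p j = e}. 1)"
    unfolding cedges_def by (rule sum.image_gen) simp
  also have "\<dots> = (\<Sum>e\<in>cedges k p. edge_mult k p e)" by (simp add: edge_mult_def)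
  also have "even \<dots>"
    using p ctree_even(1)[of k p] by (intro dvd_sum) (auto simp: tree_patterns_def)
  finally show False using assms by simp
qed

lemma limit_moment_odd: "odd k \<Longrightarrow> limit_moment D \<alpha> k = 0"
  by (cases "k = 0") (auto simp: limit_moment_def tree_patterns_odd)

lemma sup_on_square_upper:
  assumes "\<And>z. z \<in> unit_square \<Longrightarrow> \<bar>f z\<bar> \<le> C" "z \<in> unit_square"
  shows "\<bar>f z\<bar> \<le> sup_on_square f"
  unfolding sup_on_square_def using assms by (intro cSUP_upper bdd_aboveI[of _ C]) auto

lemma (in prob_space) indep_vars_reindex:
  assumes "indep_vars (\<lambda>_. N) X (f ` I)" and inj: "inj_on f I"
  shows "indep_vars (\<lambda>_. N) (\<lambda>i. X (f i)) I"
proof -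
  let ?F = "\<lambda>j. {X j -` A \<inter> space M | A. A \<in> sets N}"
  have rv: "\<And>i. i \<in> f ` I \<Longrightarrow> random_variable N (X i)" and ind: "indep_sets ?F (f ` I)"
    using assms(1) by (auto simp: indep_vars_def2)
  have "indep_sets (\<lambda>i. ?F (f i)) I"
  proof (rule indep_setsI)
    show "?F (f i) \<subseteq> events" if "i \<in> I" for i using rv[of "f i"] that by (auto intro: measurable_sets)
    fix A J assume J: "J \<noteq> {}" "J \<subseteq> I" "finite J" and A: "\<forall>j\<in>J. A j \<in> ?F (f j)"
    have injJ: "inj_on f J" by (rule inj_on_subset[OF inj J(2)])
    let ?B = "\<lambda>i. A (the_inv_into J f i)"
    have B: "?B (f j) = A j" if "j \<in> J" for j using the_inv_into_f_f[OF injJ that] by simp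
    have "prob (\<Inter>i\<in>f ` J. ?B i) = (\<Prod>i\<in>f ` J. prob (?B i))"
      by (rule indep_setsD[OF ind]) (use J A B in auto)
    then show "prob (\<Inter>(A ` J)) = (\<Prod>j\<in>J. prob (A j))"
      by (simp add: prod.reindex[OF injJ] B)
  qed
  then show ?thesis using rv by (auto simp: indep_vars_def2)
qed

lemma uniform_limit_bound:
  fixes gn :: "nat \<Rightarrow> 'z \<Rightarrow> real"
  assumes lim: "uniform_limit S gn g sequentially" and bd: "\<And>n. 1 \<le> n \<Longrightarrow> bounded (gn n ` S)"
  shows "\<exists>C\<ge>1. (\<forall>z\<in>S. \<bar>g z\<bar> \<le> C) \<and> (\<forall>\<^sub>F n in sequentially. \<forall>z\<in>S. \<bar>gn n z\<bar> \<le> C)"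
proof -
  have ev: "\<forall>\<^sub>F n in sequentially. \<forall>z\<in>S. dist (gn n z) (g z) < 1"
    using lim by (rule uniform_limitD) simp
  then have "\<forall>\<^sub>F n in sequentially. (\<forall>z\<in>S. dist (gn n z) (g z) < 1) \<and> 1 \<le> n"
    using eventually_ge_at_top[of 1] by eventually_elim simp
  then obtain n where n: "\<forall>z\<in>S. dist (gn n z) (g z) < 1" "1 \<le> n" unfolding eventually_sequentially by blast
  obtain B where B: "\<And>z. z \<in> S \<Longrightarrow> \<bar>gn n z\<bar> \<le> B" using bd[OF n(2)] unfolding bounded_iff by auto
  have g: "\<bar>g z\<bar> \<le> \<bar>B\<bar> + 1" if "z \<in> S" for z
    using B[OF that] bspec[OF n(1) that] by (simp add: dist_real_def)
  have "\<forall>\<^sub>F n in sequentially. \<forall>z\<in>S. \<bar>gn n z\<bar> \<le> \<bar>B\<bar> + 2"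
    using ev
  proof eventually_elim
    case (elim n)
    show ?case
    proof
      fix z assume z: "z \<in> S"
      show "\<bar>gn n z\<bar> \<le> \<bar>B\<bar> + 2" using bspec[OF elim z] g[OF z] by (simp add: dist_real_def)
    qed
  qed
  moreover have "\<forall>z\<in>S. \<bar>g z\<bar> \<le> \<bar>B\<bar> + 2"
  proof
    fix z assume "z \<in> S"
    from g[OF this] show "\<bar>g z\<bar> \<le> \<bar>B\<bar> + 2" by simp
  qed
  ultimately show ?thesis by (intro exI[of _ "\<bar>B\<bar> + 2"]) simp
qed

locale banded_model = prob_space M for M :: "'a measure" +
  fixes x :: "nat \<Rightarrow> nat \<Rightarrow> nat \<Rightarrow> 'a \<Rightarrow> real" and t :: "nat \<Rightarrow> ennreal"
    and gn :: "nat \<Rightarrow> nat \<Rightarrow> real \<times> real \<Rightarrow> real" and g :: "nat \<Rightarrow> real \<times> real \<Rightarrow> real"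
    and m :: "nat \<Rightarrow> nat" and \<alpha> :: real
  assumes array: "indep_symmetric_array M x" and assmA: "assumption_A M x t gn g"
    and m_lim: "(\<lambda>n. real (m n) / real n) \<longlonglongrightarrow> \<alpha>"
begin

lemma gn_bounded: "1 \<le> k \<Longrightarrow> 1 \<le> n \<Longrightarrow> bounded (gn k n ` unit_square)"
  and gn_riemann: "1 \<le> k \<Longrightarrow> 1 \<le> n \<Longrightarrow> riemann_integrable_on (gn k n) unit_square"
  and gn_sym: "1 \<le> k \<Longrightarrow> 1 \<le> n \<Longrightarrow> u \<in> {0..1} \<Longrightarrow> v \<in> {0..1} \<Longrightarrow> gn k n (u, v) = gn k n (v, u)"
  and trunc_int: "1 \<le> p \<Longrightarrow> 1 \<le> n \<Longrightarrow> (i, j) \<in> upper_indices n \<Longrightarrow> integrable M (\<lambda>\<omega>. trunc_pow (t n) p (x n i j \<omega>))"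
  and trunc_even: "1 \<le> k \<Longrightarrow> 1 \<le> n \<Longrightarrow> (i, j) \<in> upper_indices n \<Longrightarrow>
    real n * expectation (\<lambda>\<omega>. trunc_pow (t n) (2 * k) (x n i j \<omega>)) = gn k n (real i / real n, real j / real n)"
  and trunc_odd: "1 \<le> k \<Longrightarrow> \<gamma> < 1 \<Longrightarrow> (\<lambda>n. real n powr \<gamma> *
    (SUP (i, j)\<in>upper_indices n. \<bar>expectation (\<lambda>\<omega>. trunc_pow (t n) (2 * k - 1) (x n i j \<omega>))\<bar>)) \<longlonglongrightarrow> 0"
  and gn_lim: "1 \<le> k \<Longrightarrow> uniform_limit unit_square (gn k) (g k) sequentially"
  and carl: "carleman (partition_sum (bound_seq g))"
proof -
  note A1 = assmA[unfolded assumption_A_def, THEN conjunct1]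
  note R1 = assmA[unfolded assumption_A_def, THEN conjunct2]
  note A2 = R1[THEN conjunct1] and R2 = R1[THEN conjunct2]
  note A3 = R2[THEN conjunct1] and R3 = R2[THEN conjunct2]
  note A4 = R3[THEN conjunct1] and R4 = R3[THEN conjunct2]
  show "bounded (gn k n ` unit_square)" if "1 \<le> k" "1 \<le> n"
    by (rule A1[rule_format, OF that, THEN conjunct1])
  show "riemann_integrable_on (gn k n) unit_square" if "1 \<le> k" "1 \<le> n"
    by (rule A1[rule_format, OF that, THEN conjunct2, THEN conjunct1])
  show "gn k n (u, v) = gn k n (v, u)" if "1 \<le> k" "1 \<le> n" "u \<in> {0..1}" "v \<in> {0..1}"
    by (rule A1[rule_format, OF that(1,2), THEN conjunct2, THEN conjunct2, rule_format, OF that(3,4)])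
  show "integrable M (\<lambda>\<omega>. trunc_pow (t n) p (x n i j \<omega>))" if "1 \<le> p" "1 \<le> n" "(i, j) \<in> upper_indices n"
    using A2[rule_format, OF that] by simp
  show "real n * expectation (\<lambda>\<omega>. trunc_pow (t n) (2 * k) (x n i j \<omega>)) = gn k n (real i / real n, real j / real n)"
    if "1 \<le> k" "1 \<le> n" "(i, j) \<in> upper_indices n"
    using A3[rule_format, OF that] by simp
  show "(\<lambda>n. real n powr \<gamma> *
      (SUP (i, j)\<in>upper_indices n. \<bar>expectation (\<lambda>\<omega>. trunc_pow (t n) (2 * k - 1) (x n i j \<omega>))\<bar>)) \<longlonglongrightarrow> 0"
    if "1 \<le> k" "\<gamma> < 1"
    by (rule A4[rule_format, OF that])
  show "uniform_limit unit_square (gn k) (g k) sequentially" if "1 \<le> k"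
    by (rule R4[THEN conjunct1, rule_format, OF that])
  show "carleman (partition_sum (bound_seq g))" by (rule R4[THEN conjunct2])
qed

definition Z :: "nat \<Rightarrow> nat set \<Rightarrow> 'a \<Rightarrow> real" where
  "Z n e \<omega> = band (real (m n)) n (Min e) (Max e) * trunc_pow (t n) 1 (x n (Suc (Min e)) (Suc (Max e)) \<omega>)"

lemma trunc_pow_measurable [measurable]: "trunc_pow \<tau> p \<in> borel_measurable borel"
  unfolding trunc_pow_def by measurable

lemma pairs_upper: "e \<in> pairs n \<Longrightarrow> (Suc (Min e), Suc (Max e)) \<in> upper_indices n"
  by (auto simp: pairs_def upper_indices_def)

lemma Z_indep:
  assumes "1 \<le> n" shows "indep_vars (\<lambda>_. borel) (Z n) (pairs n)"
proof -
  let ?f = "\<lambda>e. (Suc (Min e), Suc (Max e))"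
  have inj: "inj_on ?f (pairs n)"
  proof (rule inj_onI)
    fix e e' assume "e \<in> pairs n" "e' \<in> pairs n" and eq: "?f e = ?f e'"
    then obtain a b a' b' where "e = {a, b}" "e' = {a', b'}" by (auto simp: pairs_def)
    moreover have "{a, b} = {Min {a, b}, Max {a, b}}" for a b :: nat by (auto simp: min_def max_def)
    ultimately show "e = e'" using eq by (metis Suc_inject prod.inject)
  qed
  have "indep_vars (\<lambda>_. borel) (\<lambda>(i, j). x n i j) (upper_indices n)"
    using array assms by (simp add: indep_symmetric_array_def)
  then have "indep_vars (\<lambda>_. borel) (\<lambda>(i, j). x n i j) (?f ` pairs n)"
    by (rule indep_vars_subset) (use pairs_upper in auto)
  from indep_vars_reindex[OF this inj]
  have "indep_vars (\<lambda>_. borel) (\<lambda>e. x n (Suc (Min e)) (Suc (Max e))) (pairs n)" by simp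
  from indep_vars_compose2[OF this, of "\<lambda>e u. band (real (m n)) n (Min e) (Max e) * trunc_pow (t n) 1 u" "\<lambda>_. borel"]
  show ?thesis unfolding Z_def by simp
qed

lemma Z_power:
  assumes "1 \<le> p"
  shows "Z n e \<omega> ^ p = band (real (m n)) n (Min e) (Max e) * trunc_pow (t n) p (x n (Suc (Min e)) (Suc (Max e)) \<omega>)"
  using assms by (auto simp: Z_def band_def trunc_pow_def power_mult_distrib zero_power)

lemma Z_integrable:
  assumes "1 \<le> n" "e \<in> pairs n"
  shows "integrable M (\<lambda>\<omega>. Z n e \<omega> ^ p)"
proof (cases "p = 0")
  case False
  then show ?thesis using trunc_int[OF _ assms(1) pairs_upper[OF assms(2)], of p] by (simp add: Z_power)
qed simp

lemma Z_moment_le: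
  assumes "1 \<le> p"
  shows "\<bar>expectation (\<lambda>\<omega>. Z n e \<omega> ^ p)\<bar> \<le> \<bar>expectation (\<lambda>\<omega>. trunc_pow (t n) p (x n (Suc (Min e)) (Suc (Max e)) \<omega>))\<bar>"
  using assms by (simp add: Z_power abs_mult band_def)

lemma kernel_bound:
  "\<exists>C\<ge>1. \<forall>s\<in>{1..k}. (\<forall>z\<in>unit_square. \<bar>g s z\<bar> \<le> C) \<and> (\<forall>\<^sub>F n in sequentially. \<forall>z\<in>unit_square. \<bar>gn s n z\<bar> \<le> C)"
proof -
  have "\<forall>s\<in>{1..k}. \<exists>C\<ge>1. (\<forall>z\<in>unit_square. \<bar>g s z\<bar> \<le> C) \<and> (\<forall>\<^sub>F n in sequentially. \<forall>z\<in>unit_square. \<bar>gn s n z\<bar> \<le> C)"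
    using uniform_limit_bound[OF gn_lim gn_bounded] by auto
  from bchoice[OF this] obtain C where C: "\<forall>s\<in>{1..k}. C s \<ge> 1 \<and> (\<forall>z\<in>unit_square. \<bar>g s z\<bar> \<le> C s) \<and>
    (\<forall>\<^sub>F n in sequentially. \<forall>z\<in>unit_square. \<bar>gn s n z\<bar> \<le> C s)" ..
  define D where "D = 1 + (\<Sum>s\<in>{1..k}. C s)"
  have C0: "0 \<le> C s" if "s \<in> {1..k}" for s using bspec[OF C that, THEN conjunct1] by simp
  have le: "C s \<le> D" if "s \<in> {1..k}" for s
    using member_le_sum[of s "{1..k}" C] C0 that by (auto simp: D_def)
  have "1 \<le> D" using sum_nonneg[of "{1..k}" C] C0 by (auto simp: D_def)
  moreover have "(\<forall>z\<in>unit_square. \<bar>g s z\<bar> \<le> D) \<and> (\<forall>\<^sub>F n in sequentially. \<forall>z\<in>unit_square. \<bar>gn s n z\<bar> \<le> D)"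
    if s: "s \<in> {1..k}" for s
  proof
    note C2 = bspec[OF C s, THEN conjunct2]
    show "\<forall>z\<in>unit_square. \<bar>g s z\<bar> \<le> D"
      by (intro ballI order_trans[OF bspec[OF C2[THEN conjunct1]] le[OF s]])
    from C2[THEN conjunct2] show "\<forall>\<^sub>F n in sequentially. \<forall>z\<in>unit_square. \<bar>gn s n z\<bar> \<le> D"
    proof eventually_elim
      case (elim n)
      show ?case by (intro ballI order_trans[OF bspec[OF elim] le[OF s]])
    qed
  qed
  ultimately show ?thesis by blast
qed

lemma Z_moments_small:
  assumes \<gamma>: "\<gamma> < 1"
  shows "\<forall>\<^sub>F n in sequentially. \<forall>p\<in>{1..K}. \<forall>e\<in>pairs n. \<bar>expectation (\<lambda>\<omega>. Z n e \<omega> ^ p)\<bar> \<le> real n powr - \<gamma>"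
proof (rule eventually_ball_finite)
  show "\<forall>p\<in>{1..K}. \<forall>\<^sub>F n in sequentially. \<forall>e\<in>pairs n. \<bar>expectation (\<lambda>\<omega>. Z n e \<omega> ^ p)\<bar> \<le> real n powr - \<gamma>"
  proof
    fix p assume p: "p \<in> {1..K}"
    show "\<forall>\<^sub>F n in sequentially. \<forall>e\<in>pairs n. \<bar>expectation (\<lambda>\<omega>. Z n e \<omega> ^ p)\<bar> \<le> real n powr - \<gamma>"
    proof (cases "even p")
      case True
      then obtain s where s: "p = 2 * s" by (elim evenE)
      have s1: "1 \<le> s" using p s by auto
      obtain C where C: "\<forall>\<^sub>F n in sequentially. \<forall>z\<in>unit_square. \<bar>gn s n z\<bar> \<le> C"
        using uniform_limit_bound[OF gn_lim[OF s1] gn_bounded[OF s1]] by blast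
      have "(\<lambda>n. C * real n powr (\<gamma> - 1)) \<longlonglongrightarrow> 0"
        using \<gamma> by (intro tendsto_mult_right_zero tendsto_neg_powr filterlim_real_sequentially) auto
      then have "\<forall>\<^sub>F n in sequentially. C * real n powr (\<gamma> - 1) < 1" by (rule order_tendstoD) simp
      then show ?thesis using C eventually_gt_at_top[of 0]
      proof eventually_elim
        case (elim n)
        show ?case
        proof
          fix e assume e: "e \<in> pairs n"
          note u = pairs_upper[OF e]
          let ?E = "expectation (\<lambda>\<omega>. trunc_pow (t n) p (x n (Suc (Min e)) (Suc (Max e)) \<omega>))"
          let ?z = "(real (Suc (Min e)) / real n, real (Suc (Max e)) / real n)"
          have "?z \<in> unit_square" using u elim(3) by (auto simp: upper_indices_def)
          then have "\<bar>real n * ?E\<bar> \<le> C"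
            using trunc_even[OF s1 _ u] elim unfolding s by simp
          then have "\<bar>?E\<bar> \<le> C / real n" using elim(3) by (simp add: abs_mult pos_le_divide_eq mult.commute)
          also have "\<dots> = (C * real n powr (\<gamma> - 1)) * real n powr - \<gamma>"
            using elim(3) by (simp add: powr_diff powr_minus field_simps)
          also have "\<dots> \<le> 1 * real n powr - \<gamma>" using elim(1) by (intro mult_right_mono) auto
          finally show "\<bar>expectation (\<lambda>\<omega>. Z n e \<omega> ^ p)\<bar> \<le> real n powr - \<gamma>"
            using Z_moment_le[of p n e] p by simp
        qed
      qed
    next
      case False
      then have s: "p = 2 * ((p + 1) div 2) - 1" "1 \<le> (p + 1) div 2" by (auto elim!: oddE)
      let ?S = "\<lambda>n. SUP (i, j)\<in>upper_indices n. \<bar>expectation (\<lambda>\<omega>. trunc_pow (t n) p (x n i j \<omega>))\<bar>"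
      have "(\<lambda>n. real n powr \<gamma> * ?S n) \<longlonglongrightarrow> 0" using trunc_odd[OF s(2) \<gamma>] s(1) by simp
      then have "\<forall>\<^sub>F n in sequentially. real n powr \<gamma> * ?S n < 1" by (rule order_tendstoD) simp
      then show ?thesis using eventually_gt_at_top[of 0]
      proof eventually_elim
        case (elim n)
        show ?case
        proof
          fix e assume e: "e \<in> pairs n"
          note u = pairs_upper[OF e]
          have fin: "finite (upper_indices n)"
            by (rule finite_subset[of _ "{1..n} \<times> {1..n}"]) (auto simp: upper_indices_def)
          have "\<bar>expectation (\<lambda>\<omega>. Z n e \<omega> ^ p)\<bar> \<le> \<bar>expectation (\<lambda>\<omega>. trunc_pow (t n) p (x n (Suc (Min e)) (Suc (Max e)) \<omega>))\<bar>"
            by (rule Z_moment_le) (use p in simp)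
          also have "\<dots> \<le> ?S n"
            using cSUP_upper[OF u, of "\<lambda>(i, j). \<bar>expectation (\<lambda>\<omega>. trunc_pow (t n) p (x n i j \<omega>))\<bar>"] fin by simp
          also have "\<dots> = (real n powr \<gamma> * ?S n) * real n powr - \<gamma>"
            using elim(2) by (simp add: powr_minus)
          also have "\<dots> \<le> 1 * real n powr - \<gamma>" using elim(1) by (intro mult_right_mono) auto
          finally show "\<bar>expectation (\<lambda>\<omega>. Z n e \<omega> ^ p)\<bar> \<le> real n powr - \<gamma>" by simp
        qed
      qed
    qed
  qed
qed simp

lemma eventually_sparse_symmetric:
  assumes k: "0 < k"
  shows "\<forall>\<^sub>F n in sequentially. sparse_symmetric M (Z n) n k (1 - 1 / (8 * real k))"
proof -
  have "1 - 1 / (8 * real k) < 1" using k by simp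
  from Z_moments_small[OF this, of "4 * k"] eventually_gt_at_top[of 0]
  show ?thesis
  proof eventually_elim
    case (elim n)
    show ?case
    proof
      show "indep_vars (\<lambda>_. borel) (Z n) (pairs n)" using elim by (intro Z_indep) simp
      show "integrable M (\<lambda>\<omega>. Z n e \<omega> ^ p)" if "e \<in> pairs n" for e p
        using elim that by (intro Z_integrable) simp
      show "\<bar>expectation (\<lambda>\<omega>. Z n e \<omega> ^ p)\<bar> \<le> real n powr - (1 - 1 / (8 * real k))"
        if "e \<in> pairs n" "1 \<le> p" "p \<le> 4 * k" for e p using elim(1) that by simp
      have "1 / (8 * real k) \<le> 1" using k by simp
      then show "0 \<le> 1 - 1 / (8 * real k)" by simp
    qed (use elim k in simp_all)
  qed
qed

definition spectral_moment :: "nat \<Rightarrow> nat \<Rightarrow> 'a \<Rightarrow> real" where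
  "spectral_moment k n \<omega> = closed_walk_sum (Z n) k n \<omega> / real n"

lemma Z_measurable: "1 \<le> n \<Longrightarrow> e \<in> pairs n \<Longrightarrow> Z n e \<in> borel_measurable M"
  using Z_indep[of n] by (auto simp: indep_vars_def2)

lemma AE_spectral_moment_centered:
  assumes k: "0 < k"
  shows "AE \<omega> in M. (\<lambda>n. spectral_moment k n \<omega> - expectation (spectral_moment k n)) \<longlonglongrightarrow> 0"
proof (rule AE_tendsto_zero_of_fourth_moments)
  let ?C = "16 * (real (((4 * k) ^ k) ^ 4) * real (Suc (4 * k)))"
  have meas: "spectral_moment k n \<in> borel_measurable M" for n
  proof (cases "n = 0")
    case True
    then have "spectral_moment k n = (\<lambda>_. 0)" by (simp add: spectral_moment_def fun_eq_iff)
    then show ?thesis by simp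
  next
    case False
    then have "(\<lambda>\<omega>. Z n (cedge k i j) \<omega>) \<in> borel_measurable M" if "i \<in> walks k n" "j < k" for i j
      using Z_measurable[OF _ cedge_pairs[OF that]] by simp
    then show ?thesis unfolding spectral_moment_def closed_walk_sum_def
      by (intro borel_measurable_divide borel_measurable_sum borel_measurable_prod) auto
  qed
  then show "(\<lambda>\<omega>. spectral_moment k n \<omega> - expectation (spectral_moment k n)) \<in> borel_measurable M" for n by simp
  show "\<forall>\<^sub>F n in sequentially.
      integrable M (\<lambda>\<omega>. (spectral_moment k n \<omega> - expectation (spectral_moment k n)) ^ 4) \<and>
      expectation (\<lambda>\<omega>. (spectral_moment k n \<omega> - expectation (spectral_moment k n)) ^ 4) \<le> ?C * real n powr (- 3 / 2)"
    using eventually_sparse_symmetric[OF k] eventually_gt_at_top[of 0]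
  proof eventually_elim
    case (elim n)
    interpret s: sparse_symmetric M "Z n" n k "1 - 1 / (8 * real k)" by (rule elim(1))
    let ?X = "closed_walk_sum (Z n) k n"
    have eq: "(spectral_moment k n \<omega> - expectation (spectral_moment k n)) ^ 4 = (?X \<omega> - expectation ?X) ^ 4 / real n ^ 4" for \<omega>
      by (simp add: spectral_moment_def[abs_def] diff_divide_distrib[symmetric] power_divide)
    have "(1 - (1 - 1 / (8 * real k))) * real (4 * k) = 1 / 2" using k by simp
    then have "expectation (\<lambda>\<omega>. (?X \<omega> - expectation ?X) ^ 4) \<le> ?C * real n powr (2 + 1 / 2)"
      using s.fourth_moment_closed_walk_sum(2) by (simp only: mult.assoc)
    then have "expectation (\<lambda>\<omega>. (?X \<omega> - expectation ?X) ^ 4) / real n ^ 4 \<le> ?C * real n powr (2 + 1 / 2) / real n ^ 4"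
      by (rule divide_right_mono) simp
    also have "\<dots> = ?C * (real n powr (2 + 1 / 2) / real n powr 4)"
      using elim(2) powr_realpow[of "real n" 4] by simp
    also have "real n powr (2 + 1 / 2) / real n powr 4 = real n powr (2 + 1 / 2 - 4)"
      by (simp only: powr_diff)
    also have "(2 + 1 / 2 - 4 :: real) = - 3 / 2" by simp
    finally show ?case unfolding eq using s.fourth_moment_closed_walk_sum(1) by simp
  qed
qed

lemma moment_kernel:
  assumes n: "1 \<le> n" and s: "1 \<le> s" and ab: "a < n" "b < n"
  shows "real n * expectation (\<lambda>\<omega>. Z n {a, b} \<omega> ^ (2 * s)) = sample (gn s n) n a b * band (real (m n)) n a b"
proof -
  have *: "real n * expectation (\<lambda>\<omega>. Z n {a, b} \<omega> ^ (2 * s)) = sample (gn s n) n a b * band (real (m n)) n a b"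
    if "a \<le> b" "b < n" for a b
  proof -
    have mm: "Min {a, b} = a" "Max {a, b} = b" using that by auto
    have "(Suc a, Suc b) \<in> upper_indices n" using that by (simp add: upper_indices_def)
    from trunc_even[OF s n this] show ?thesis
      using s by (simp add: Z_power mm sample_def mult.assoc[symmetric] mult.commute)
  qed
  show ?thesis
  proof (cases "a \<le> b")
    case True then show ?thesis using * ab by simp
  next
    case False
    have "{a, b} = {b, a}" by auto
    moreover have "sample (gn s n) n b a = sample (gn s n) n a b"
      unfolding sample_def using ab n by (intro gn_sym s) auto
    moreover have "band (real (m n)) n b a = band (real (m n)) n a b"
      by (simp add: band_def abs_minus_commute)
    ultimately show ?thesis using *[of b a] False ab by simp
  qed
qed

lemma tree_sum_eq:
  assumes k: "0 < k" and n: "1 \<le> n"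
  shows "(\<Sum>i\<in>{i \<in> walks k n. ctree k i}. \<Prod>e\<in>cedges k i. expectation (\<lambda>\<omega>. Z n e \<omega> ^ edge_mult k i e)) / real n =
    (\<Sum>p\<in>tree_patterns k. (\<Sum>q\<in>labelings k p n. \<Prod>e\<in>cedges k p.
      sample (gn (edge_mult k p e div 2) n) n (q (Min e)) (q (Max e)) * band (real (m n)) n (q (Min e)) (q (Max e)))
      / real n ^ card (p ` {..<k}))"
proof -
  have "(\<Prod>e\<in>cedges k (relabel k q p). expectation (\<lambda>\<omega>. Z n e \<omega> ^ edge_mult k (relabel k q p) e)) / real n =
     (\<Prod>e\<in>cedges k p. sample (gn (edge_mult k p e div 2) n) n (q (Min e)) (q (Max e)) * band (real (m n)) n (q (Min e)) (q (Max e)))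
      / real n ^ card (p ` {..<k})"
    if p: "p \<in> tree_patterns k" and q: "q \<in> labelings k p n" for p q
  proof -
    have inj: "inj_on q (p ` {..<k})" using q by simp
    note r = relabel_edges[OF k inj]
    note G = simple_graphD[OF simple_graph_tree_pattern[OF k p]]
    have "(\<Prod>e\<in>cedges k (relabel k q p). expectation (\<lambda>\<omega>. Z n e \<omega> ^ edge_mult k (relabel k q p) e)) =
        (\<Prod>e\<in>cedges k p. expectation (\<lambda>\<omega>. Z n (q ` e) \<omega> ^ edge_mult k p e))"
      unfolding r(2) by (simp add: prod.reindex[OF r(1)] r(3))
    also have "\<dots> = (\<Prod>e\<in>cedges k p. (sample (gn (edge_mult k p e div 2) n) n (q (Min e)) (q (Max e)) *
        band (real (m n)) n (q (Min e)) (q (Max e))) / real n)"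
    proof (rule prod.cong[OF refl])
      fix e assume e: "e \<in> cedges k p"
      note em = tree_pattern_edge_mult[OF p e]
      have "ctree k p" using p by (simp add: tree_patterns_def)
      from ctree_even(2)[OF this e] obtain a b where ab: "e = {a, b}" by blast
      have "{a, b} = {Min {a, b}, Max {a, b}}" for a b :: nat by (auto simp: min_def max_def)
      then have "q ` e = {q (Min e), q (Max e)}" unfolding ab by (metis image_empty image_insert)
      moreover have "q (Min e) < n" "q (Max e) < n" using q G(3,4)[OF e] by (auto simp: PiE_def Pi_def)
      ultimately have "real n * expectation (\<lambda>\<omega>. Z n (q ` e) \<omega> ^ (2 * (edge_mult k p e div 2))) =
          sample (gn (edge_mult k p e div 2) n) n (q (Min e)) (q (Max e)) * band (real (m n)) n (q (Min e)) (q (Max e))"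
        using moment_kernel[OF n em(2)] by simp
      then show "expectation (\<lambda>\<omega>. Z n (q ` e) \<omega> ^ edge_mult k p e) =
          sample (gn (edge_mult k p e div 2) n) n (q (Min e)) (q (Max e)) * band (real (m n)) n (q (Min e)) (q (Max e)) / real n"
        unfolding em(1) using n by (simp add: field_simps)
    qed
    also have "\<dots> = (\<Prod>e\<in>cedges k p. sample (gn (edge_mult k p e div 2) n) n (q (Min e)) (q (Max e)) *
        band (real (m n)) n (q (Min e)) (q (Max e))) / real n ^ card (cedges k p)"
      by (simp add: prod_dividef)
    moreover have "card (p ` {..<k}) = Suc (card (cedges k p))" using p by (simp add: tree_patterns_def ctree_def)
    ultimately show ?thesis by simp
  qed
  then show ?thesis unfolding sum_tree_walks[OF k] sum_divide_distrib by (intro sum.cong refl) blast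
qed

end

context banded_model
begin

lemma kernel_boundE:
  obtains C where "1 \<le> C" "\<And>s z. s \<in> {1..k} \<Longrightarrow> z \<in> unit_square \<Longrightarrow> \<bar>g s z\<bar> \<le> C"
    "\<And>s. s \<in> {1..k} \<Longrightarrow> \<forall>\<^sub>F n in sequentially. \<forall>z\<in>unit_square. \<bar>gn s n z\<bar> \<le> C"
proof -
  from kernel_bound[of k] obtain C where C: "1 \<le> C \<and> (\<forall>s\<in>{1..k}. (\<forall>z\<in>unit_square. \<bar>g s z\<bar> \<le> C) \<and>
    (\<forall>\<^sub>F n in sequentially. \<forall>z\<in>unit_square. \<bar>gn s n z\<bar> \<le> C))" ..
  note C' = bspec[OF conjunct2[OF C]]
  show ?thesis
    by (rule that[OF conjunct1[OF C] bspec[OF conjunct1[OF C']] conjunct2[OF C']])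
qed

lemma sample_diff_tendsto_0:
  assumes "1 \<le> s"
  shows "(\<lambda>n. mean_abs n (\<lambda>a b. sample (gn s n) n a b - sample (g s) n a b)) \<longlonglongrightarrow> 0"
proof (rule tendstoI)
  fix \<epsilon> :: real assume \<epsilon>: "0 < \<epsilon>"
  have "\<forall>\<^sub>F n in sequentially. \<forall>z\<in>unit_square. dist (gn s n z) (g s z) < \<epsilon> / 2"
    using gn_lim[OF assms] \<epsilon> by (intro uniform_limitD) auto
  then show "\<forall>\<^sub>F n in sequentially. dist (mean_abs n (\<lambda>a b. sample (gn s n) n a b - sample (g s) n a b)) 0 < \<epsilon>"
  proof eventually_elim
    case (elim n)
    have "mean_abs n (\<lambda>a b. sample (gn s n) n a b - sample (g s) n a b) \<le> \<epsilon> / 2"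
    proof (rule mean_abs_le)
      fix a b assume "a < n" "b < n"
      from bspec[OF elim sample_point_in_square[OF this]]
      show "\<bar>sample (gn s n) n a b - sample (g s) n a b\<bar> \<le> \<epsilon> / 2"
        unfolding sample_def dist_real_def by simp
    qed (use \<epsilon> in simp)
    then show ?case
      using \<epsilon> mean_abs_nonneg[of n "\<lambda>a b. sample (gn s n) n a b - sample (g s) n a b"] by (simp add: dist_real_def)
  qed
qed

lemma kernel_diff_tendsto_0:
  assumes s: "1 \<le> s" and C: "\<And>z. z \<in> unit_square \<Longrightarrow> \<bar>g s z\<bar> \<le> C"
  shows "(\<lambda>n. mean_abs n (\<lambda>a b. sample (gn s n) n a b * band (real (m n)) n a b - limit_kernel g \<alpha> s n a b)) \<longlonglongrightarrow> 0"
proof (rule Lim_null_comparison)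
  let ?u = "\<lambda>n. 1 * mean_abs n (\<lambda>a b. sample (gn s n) n a b - sample (g s) n a b) +
    C * mean_abs n (\<lambda>a b. band (real (m n)) n a b - band (\<alpha> * real n) n a b)"
  show "\<forall>\<^sub>F n in sequentially. norm (mean_abs n (\<lambda>a b. sample (gn s n) n a b * band (real (m n)) n a b - limit_kernel g \<alpha> s n a b)) \<le> ?u n"
  proof (rule always_eventually, rule allI)
    fix n
    have "mean_abs n (\<lambda>a b. sample (gn s n) n a b * band (real (m n)) n a b - sample (g s) n a b * band (\<alpha> * real n) n a b) \<le> ?u n"
    proof (rule mean_abs_mult_diff_le)
      show "\<bar>band (real (m n)) n a b\<bar> \<le> 1" for a b by (rule abs_band_le)
      show "\<bar>sample (g s) n a b\<bar> \<le> C" if "a < n" "b < n" for a b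
        unfolding sample_def by (rule C[OF sample_point_in_square[OF that]])
    qed
    then show "norm (mean_abs n (\<lambda>a b. sample (gn s n) n a b * band (real (m n)) n a b - limit_kernel g \<alpha> s n a b)) \<le> ?u n"
      unfolding limit_kernel_def real_norm_def by (simp only: abs_of_nonneg[OF mean_abs_nonneg])
  qed
  have "(\<lambda>n. \<alpha> * real n / real n) \<longlonglongrightarrow> \<alpha>"
    by (rule tendsto_eventually) (use eventually_gt_at_top[of 0] in eventually_elim, simp)
  then have "?u \<longlonglongrightarrow> 1 * 0 + C * 0"
    by (intro tendsto_intros sample_diff_tendsto_0 s mean_abs_band_diff_tendsto_0[OF m_lim])
  then show "?u \<longlonglongrightarrow> 0" by simp
qed

lemma grid_approx_limit_kernel:
  assumes s: "1 \<le> s" and C: "1 \<le> C" "\<forall>\<^sub>F n in sequentially. \<forall>z\<in>unit_square. \<bar>gn s n z\<bar> \<le> C"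
  shows "grid_approx C (\<lambda>n. limit_kernel g \<alpha> s n)"
proof -
  have "grid_approx C (sample (g s))"
  proof (rule grid_approx_limit)
    fix \<epsilon> :: real assume \<epsilon>: "0 < \<epsilon>"
    have "\<forall>\<^sub>F n in sequentially. \<forall>z\<in>unit_square. dist (gn s n z) (g s z) < \<epsilon>"
      using gn_lim[OF s] \<epsilon> by (intro uniform_limitD)
    then have "\<forall>\<^sub>F n in sequentially. (\<forall>z\<in>unit_square. dist (gn s n z) (g s z) < \<epsilon>) \<and>
        (\<forall>z\<in>unit_square. \<bar>gn s n z\<bar> \<le> C) \<and> 1 \<le> n"
      using C(2) eventually_ge_at_top[of 1] by eventually_elim simp
    then obtain N where N: "\<forall>z\<in>unit_square. dist (gn s N z) (g s z) < \<epsilon>" "\<forall>z\<in>unit_square. \<bar>gn s N z\<bar> \<le> C" "1 \<le> N"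
      unfolding eventually_sequentially by blast
    have "grid_approx C (sample (gn s N))"
      by (rule grid_approx_riemann[OF gn_riemann[OF s N(3)]]) (rule bspec[OF N(2)])
    moreover have "mean_abs n (\<lambda>a b. sample (g s) n a b - sample (gn s N) n a b) \<le> \<epsilon>" for n
    proof (rule mean_abs_le)
      fix a b assume "a < n" "b < n"
      from bspec[OF N(1) sample_point_in_square[OF this]]
      show "\<bar>sample (g s) n a b - sample (gn s N) n a b\<bar> \<le> \<epsilon>"
        unfolding sample_def dist_real_def by (simp add: abs_minus_commute)
    qed (use \<epsilon> in simp)
    ultimately show "\<exists>f'. grid_approx C f' \<and> (\<forall>\<^sub>F n in sequentially. mean_abs n (\<lambda>a b. sample (g s) n a b - f' n a b) \<le> \<epsilon>)"
      by (intro exI[of _ "sample (gn s N)"]) simp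
  qed
  moreover have "(\<lambda>n. \<alpha> * real n / real n) \<longlonglongrightarrow> \<alpha>"
    by (rule tendsto_eventually) (use eventually_gt_at_top[of 0] in eventually_elim, simp)
  then have "grid_approx 1 (\<lambda>n. band (\<alpha> * real n) n)" by (rule grid_approx_band)
  ultimately have "grid_approx (C * 1) (\<lambda>n a b. sample (g s) n a b * band (\<alpha> * real n) n a b)"
    using C(1) by (rule grid_approx_mult) (simp_all add: abs_band_le)
  then show ?thesis by (simp add: limit_kernel_def[abs_def])
qed

lemma abs_limit_kernel_le:
  assumes "\<And>z. z \<in> unit_square \<Longrightarrow> \<bar>g s z\<bar> \<le> C" "a < n" "b < n"
  shows "\<bar>limit_kernel g \<alpha> s n a b\<bar> \<le> C"
proof -
  have "\<bar>sample (g s) n a b\<bar> * \<bar>band (\<alpha> * real n) n a b\<bar> \<le> C * 1"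
    using assms(1)[OF sample_point_in_square[OF assms(2,3)]] abs_band_le
    unfolding sample_def by (intro mult_mono) auto
  then show ?thesis by (simp add: limit_kernel_def abs_mult)
qed

lemma tree_dens_tendsto:
  assumes k: "0 < k" and p: "p \<in> tree_patterns k"
  shows "tree_dens g \<alpha> k p \<longlonglongrightarrow> lim (tree_dens g \<alpha> k p)"
proof -
  note em = tree_pattern_edge_mult(2,3)[OF p]
  obtain C where C: "1 \<le> C" "\<And>s z. s \<in> {1..k} \<Longrightarrow> z \<in> unit_square \<Longrightarrow> \<bar>g s z\<bar> \<le> C"
    "\<And>s. s \<in> {1..k} \<Longrightarrow> \<forall>\<^sub>F n in sequentially. \<forall>z\<in>unit_square. \<bar>gn s n z\<bar> \<le> C"
    by (rule kernel_boundE[of k]) (rule that; simp)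
  have "convergent (\<lambda>n. dens n (p ` {..<k}) (cedges k p) (\<lambda>e. limit_kernel g \<alpha> (edge_mult k p e div 2) n))"
  proof (rule convergent_dens[OF simple_graph_tree_pattern[OF k p] C(1)])
    fix e assume e: "e \<in> cedges k p"
    show "grid_approx C (\<lambda>n. limit_kernel g \<alpha> (edge_mult k p e div 2) n)"
      using em[OF e] C by (intro grid_approx_limit_kernel) auto
    show "\<forall>\<^sub>F n in sequentially. \<forall>a<n. \<forall>b<n. \<bar>limit_kernel g \<alpha> (edge_mult k p e div 2) n a b\<bar> \<le> C"
      using em[OF e] C(2)[of "edge_mult k p e div 2"] by (intro always_eventually allI impI abs_limit_kernel_le) auto
  qed
  then show ?thesis unfolding tree_dens_def[abs_def] by (simp add: convergent_LIMSEQ_iff)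
qed

lemma tree_pattern_sum_tendsto:
  assumes k: "0 < k" and p: "p \<in> tree_patterns k"
  shows "(\<lambda>n. (\<Sum>q\<in>labelings k p n. \<Prod>e\<in>cedges k p.
      sample (gn (edge_mult k p e div 2) n) n (q (Min e)) (q (Max e)) * band (real (m n)) n (q (Min e)) (q (Max e)))
      / real n ^ card (p ` {..<k})) \<longlonglongrightarrow> lim (tree_dens g \<alpha> k p)"
proof -
  let ?V = "p ` {..<k}" and ?E = "cedges k p" and ?h = "\<lambda>e. edge_mult k p e div 2"
  define H where "H e n a b = sample (gn (?h e) n) n a b * band (real (m n)) n a b" for e n a b
  note G = simple_graph_tree_pattern[OF k p]
  note em = tree_pattern_edge_mult(2,3)[OF p]
  obtain C where C: "1 \<le> C" "\<And>s z. s \<in> {1..k} \<Longrightarrow> z \<in> unit_square \<Longrightarrow> \<bar>g s z\<bar> \<le> C"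
    "\<And>s. s \<in> {1..k} \<Longrightarrow> \<forall>\<^sub>F n in sequentially. \<forall>z\<in>unit_square. \<bar>gn s n z\<bar> \<le> C"
    by (rule kernel_boundE[of k]) (rule that; simp)
  have H_le: "\<forall>\<^sub>F n in sequentially. \<forall>a<n. \<forall>b<n. \<bar>H e n a b\<bar> \<le> C" if e: "e \<in> ?E" for e
  proof -
    have "?h e \<in> {1..k}" using em[OF e] by simp
    from C(3)[OF this] show ?thesis
    proof eventually_elim
      case (elim n)
      show ?case
      proof (intro allI impI)
        fix a b assume ab: "a < n" "b < n"
        have "\<bar>sample (gn (?h e) n) n a b\<bar> * \<bar>band (real (m n)) n a b\<bar> \<le> C * 1"
          using bspec[OF elim sample_point_in_square[OF ab]] abs_band_le C(1)
          unfolding sample_def by (intro mult_mono) auto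
        then show "\<bar>H e n a b\<bar> \<le> C" by (simp add: H_def abs_mult)
      qed
    qed
  qed
  note conv = tree_dens_tendsto[OF k p]
  have 1: "(\<lambda>n. dens n ?V ?E (\<lambda>e. H e n) - tree_dens g \<alpha> k p n) \<longlonglongrightarrow> 0"
    unfolding tree_dens_def
  proof (rule dens_diff_tendsto_0[OF G C(1)])
    fix e assume e: "e \<in> ?E"
    show "\<forall>\<^sub>F n in sequentially. \<forall>a<n. \<forall>b<n. \<bar>H e n a b\<bar> \<le> C" by (rule H_le[OF e])
    show "\<forall>\<^sub>F n in sequentially. \<forall>a<n. \<forall>b<n. \<bar>limit_kernel g \<alpha> (?h e) n a b\<bar> \<le> C"
      using em[OF e] C(2)[of "?h e"] by (intro always_eventually allI impI abs_limit_kernel_le) auto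
    show "(\<lambda>n. mean_abs n (\<lambda>a b. H e n a b - limit_kernel g \<alpha> (?h e) n a b)) \<longlonglongrightarrow> 0"
      unfolding H_def using em[OF e] C(2)[of "?h e"] by (intro kernel_diff_tendsto_0) auto
  qed
  define I where "I n = (\<Sum>q\<in>labelings k p n. \<Prod>e\<in>?E. H e n (q (Min e)) (q (Max e))) / real n ^ card ?V" for n
  have 2: "(\<lambda>n. dens n ?V ?E (\<lambda>e. H e n) - I n) \<longlonglongrightarrow> 0"
  proof (rule Lim_null_comparison)
    have "\<forall>\<^sub>F n in sequentially. \<forall>e\<in>?E. \<forall>a<n. \<forall>b<n. \<bar>H e n a b\<bar> \<le> C"
      using H_le by (intro eventually_ball_finite) auto
    then show "\<forall>\<^sub>F n in sequentially. norm (dens n ?V ?E (\<lambda>e. H e n) - I n) \<le> C ^ card ?E * ((real (card ?V))\<^sup>2 / real n)"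
      using eventually_gt_at_top[of 0]
    proof eventually_elim
      case (elim n)
      show ?case unfolding I_def real_norm_def
        by (rule injective_dens_diff[OF G elim(2)]) (use elim C(1) in auto)
    qed
    show "(\<lambda>n. C ^ card ?E * ((real (card ?V))\<^sup>2 / real n)) \<longlonglongrightarrow> 0"
      by (intro tendsto_mult_right_zero lim_const_over_n)
  qed
  have "(\<lambda>n. tree_dens g \<alpha> k p n + (dens n ?V ?E (\<lambda>e. H e n) - tree_dens g \<alpha> k p n) - (dens n ?V ?E (\<lambda>e. H e n) - I n))
      \<longlonglongrightarrow> lim (tree_dens g \<alpha> k p) + 0 - 0"
    by (intro tendsto_intros conv 1 2)
  then have "I \<longlonglongrightarrow> lim (tree_dens g \<alpha> k p)" by simp
  then show ?thesis unfolding I_def[abs_def] H_def .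
qed

lemma expectation_spectral_moment_tendsto:
  assumes k: "0 < k"
  shows "(\<lambda>n. expectation (spectral_moment k n)) \<longlonglongrightarrow> limit_moment g \<alpha> k"
proof -
  let ?T = "\<lambda>n. \<Sum>i\<in>{i \<in> walks k n. ctree k i}. \<Prod>e\<in>cedges k i. expectation (\<lambda>\<omega>. Z n e \<omega> ^ edge_mult k i e)"
  have 1: "(\<lambda>n. ?T n / real n) \<longlonglongrightarrow> limit_moment g \<alpha> k"
  proof (rule Lim_transform_eventually)
    show "(\<lambda>n. \<Sum>p\<in>tree_patterns k. (\<Sum>q\<in>labelings k p n. \<Prod>e\<in>cedges k p.
      sample (gn (edge_mult k p e div 2) n) n (q (Min e)) (q (Max e)) * band (real (m n)) n (q (Min e)) (q (Max e)))
      / real n ^ card (p ` {..<k})) \<longlonglongrightarrow> limit_moment g \<alpha> k"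
    proof -
      have "limit_moment g \<alpha> k = (\<Sum>p\<in>tree_patterns k. lim (tree_dens g \<alpha> k p))"
        using k by (simp add: limit_moment_def)
      then show ?thesis by (simp only:) (intro tendsto_sum tree_pattern_sum_tendsto k)
    qed
    show "\<forall>\<^sub>F n in sequentially. (\<Sum>p\<in>tree_patterns k. (\<Sum>q\<in>labelings k p n. \<Prod>e\<in>cedges k p.
      sample (gn (edge_mult k p e div 2) n) n (q (Min e)) (q (Max e)) * band (real (m n)) n (q (Min e)) (q (Max e)))
      / real n ^ card (p ` {..<k})) = ?T n / real n"
      using eventually_ge_at_top[of 1] by eventually_elim (rule tree_sum_eq[OF k, symmetric])
  qed
  let ?c = "real (k ^ k) * real (Suc k)"
  have 2: "(\<lambda>n. expectation (spectral_moment k n) - ?T n / real n) \<longlonglongrightarrow> 0"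
  proof (rule Lim_null_comparison)
    show "\<forall>\<^sub>F n in sequentially. norm (expectation (spectral_moment k n) - ?T n / real n) \<le> ?c * real n powr (1 / 8 - 1)"
      using eventually_sparse_symmetric[OF k] eventually_gt_at_top[of 0]
    proof eventually_elim
      case (elim n)
      interpret s: sparse_symmetric M "Z n" n k "1 - 1 / (8 * real k)" by (rule elim(1))
      have "(1 - (1 - 1 / (8 * real k))) * real k = 1 / 8" using k by simp
      then have "\<bar>expectation (closed_walk_sum (Z n) k n) - ?T n\<bar> \<le> ?c * real n powr (1 / 8)"
        using s.non_tree_walks_negligible by (simp only:)
      then have "\<bar>expectation (closed_walk_sum (Z n) k n) - ?T n\<bar> / real n \<le> ?c * real n powr (1 / 8) / real n"
        by (rule divide_right_mono) simp
      also have "\<dots> = ?c * real n powr (1 / 8 - 1)"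
        using elim(2) by (simp only: powr_diff) simp
      finally show ?case
        by (simp add: spectral_moment_def[abs_def] diff_divide_distrib[symmetric])
    qed
    show "(\<lambda>n. ?c * real n powr (1 / 8 - 1)) \<longlonglongrightarrow> 0"
      by (intro tendsto_mult_right_zero tendsto_neg_powr filterlim_real_sequentially) auto
  qed
  have "(\<lambda>n. (expectation (spectral_moment k n) - ?T n / real n) + ?T n / real n) \<longlonglongrightarrow> 0 + limit_moment g \<alpha> k"
    by (intro tendsto_add 1 2)
  then show ?thesis by simp
qed

lemma abs_limit_moment_le:
  assumes k: "0 < k"
  shows "\<bar>limit_moment g \<alpha> k\<bar> \<le> partition_sum (bound_seq g) k"
proof -
  have gb: "\<bar>g s z\<bar> \<le> sup_on_square (g s)" if s: "1 \<le> s" and z: "z \<in> unit_square" for s z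
  proof -
    obtain C where "\<forall>z\<in>unit_square. \<bar>g s z\<bar> \<le> C"
      using uniform_limit_bound[OF gn_lim[OF s] gn_bounded[OF s]] by blast
    then show ?thesis using z by (intro sup_on_square_upper[of _ C]) auto
  qed
  have b0: "0 \<le> bound_seq g j" if "0 < j" for j
  proof (cases "even j")
    case True
    then have "1 \<le> j div 2" using that by auto
    from gb[OF this, of "(0, 0)"] show ?thesis using True by (simp add: bound_seq_def)
  qed (simp add: bound_seq_def)
  have "\<bar>lim (tree_dens g \<alpha> k p)\<bar> \<le> (\<Prod>e\<in>cedges k p. bound_seq g (edge_mult k p e))" if p: "p \<in> tree_patterns k" for p
  proof (rule LIMSEQ_le_const2[OF tendsto_rabs[OF tree_dens_tendsto[OF k p]]], intro exI allI impI)
    fix n :: nat assume n: "1 \<le> n"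
    show "\<bar>tree_dens g \<alpha> k p n\<bar> \<le> (\<Prod>e\<in>cedges k p. bound_seq g (edge_mult k p e))"
      unfolding tree_dens_def
    proof (rule abs_dens_le[OF simple_graph_tree_pattern[OF k p]])
      fix e a b assume e: "e \<in> cedges k p" and ab: "a < n" "b < n"
      note em = tree_pattern_edge_mult[OF p e]
      have "even (edge_mult k p e)" using em(1) by (metis dvd_triv_left)
      then have "bound_seq g (edge_mult k p e) = sup_on_square (g (edge_mult k p e div 2))"
        by (simp add: bound_seq_def)
      then show "\<bar>limit_kernel g \<alpha> (edge_mult k p e div 2) n a b\<bar> \<le> bound_seq g (edge_mult k p e)"
        using abs_limit_kernel_le[OF gb[OF em(2)] ab] by simp
    qed (use n in simp)
  qed
  then have "\<bar>limit_moment g \<alpha> k\<bar> \<le> (\<Sum>p\<in>tree_patterns k. \<Prod>e\<in>cedges k p. bound_seq g (edge_mult k p e))"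
    using k unfolding limit_moment_def by (auto intro!: order_trans[OF sum_abs sum_mono])
  also have "\<dots> \<le> partition_sum (bound_seq g) k" by (rule sum_tree_patterns_le_partition_sum[OF k b0])
  finally show ?thesis .
qed

end

subsection \<open>Weak convergence of the spectral distributions\<close>

lemma iexp_lipschitz: "norm (iexp (s * u) - iexp (s * v)) \<le> \<bar>s\<bar> * \<bar>u - v\<bar>"
proof -
  have "iexp (s * u) - iexp (s * v) = iexp (s * v) * (iexp (s * (u - v)) - 1)"
    by (simp add: right_diff_distrib exp_diff)
  also have "norm \<dots> = norm (iexp (s * (u - v)) - 1)" by (simp add: norm_mult del: of_real_mult)
  also have "\<dots> \<le> \<bar>s * (u - v)\<bar>" using iexp_approx1[of "s * (u - v)" 0] by simp
  finally show ?thesis by (simp add: abs_mult)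
qed

lemma weak_conv_m_Suc: "weak_conv_m (\<lambda>n. \<mu> (Suc n)) \<nu> \<Longrightarrow> weak_conv_m \<mu> \<nu>"
  unfolding weak_conv_m_def weak_conv_def by (auto intro: LIMSEQ_imp_Suc)

lemma symmetric_of_odd_moments_zero:
  assumes \<mu>: "real_distribution \<mu>" "\<And>k. integrable \<mu> (\<lambda>u. u ^ k)"
    and odd: "\<And>k. odd k \<Longrightarrow> (\<integral>u. u ^ k \<partial>\<mu>) = 0" and carl: "carleman (\<lambda>k. \<integral>u. u ^ k \<partial>\<mu>)"
  shows "distr \<mu> borel uminus = \<mu>"
proof -
  interpret real_distribution \<mu> by (rule \<mu>(1))
  have minus: "(\<lambda>u :: real. (- u) ^ k) = (\<lambda>u. (- 1) ^ k * u ^ k)" for k by (rule ext) (rule power_minus)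
  have "\<mu> = distr \<mu> borel uminus"
  proof (rule carleman_moment_unique[OF \<mu>])
    show "real_distribution (distr \<mu> borel uminus)"
      by (intro real_distribution_distr) simp
    show "integrable (distr \<mu> borel uminus) (\<lambda>u. u ^ k)" for k
    proof -
      have "integrable (distr \<mu> borel uminus) (\<lambda>u. u ^ k) \<longleftrightarrow> integrable \<mu> (\<lambda>u. (- u) ^ k)"
        by (rule integrable_distr_eq) auto
      moreover have "integrable \<mu> (\<lambda>u. (- u) ^ k)"
        unfolding minus by (rule integrable_mult_right) (rule \<mu>(2))
      ultimately show ?thesis by simp
    qed
    show "(\<integral>u. u ^ k \<partial>\<mu>) = (\<integral>u. u ^ k \<partial>distr \<mu> borel uminus)" for k
    proof -
      have "(\<integral>u. u ^ k \<partial>distr \<mu> borel uminus) = (\<integral>u. (- u) ^ k \<partial>\<mu>)"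
        by (subst integral_distr) auto
      also have "\<dots> = (- 1) ^ k * (\<integral>u. u ^ k \<partial>\<mu>)" unfolding minus by (rule integral_mult_right_zero)
      also have "\<dots> = (\<integral>u. u ^ k \<partial>\<mu>)" using odd[of k] by (cases "even k") auto
      finally show ?thesis ..
    qed
  qed (rule carl)
  then show ?thesis ..
qed

context banded_model
begin

definition W :: "nat \<Rightarrow> 'a \<Rightarrow> real mat" where
  "W n \<omega> = array_mat (banded m x) n \<omega>"

definition T :: "nat \<Rightarrow> 'a \<Rightarrow> real mat" where
  "T n \<omega> = array_mat (\<lambda>n i j \<omega>. trunc_pow (t n) 1 (banded m x n i j \<omega>)) n \<omega>"

lemma banded_sym: "1 \<le> n \<Longrightarrow> i \<in> {1..n} \<Longrightarrow> j \<in> {1..n} \<Longrightarrow> banded m x n i j \<omega> = banded m x n j i \<omega>"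
  using array by (auto simp: banded_def indep_symmetric_array_def abs_minus_commute)

lemma W_carrier: "W n \<omega> \<in> carrier_mat n n" and T_carrier: "T n \<omega> \<in> carrier_mat n n"
  by (simp_all add: W_def T_def array_mat_def)

lemma W_sym: "transpose_mat (W n \<omega>) = W n \<omega>"
  unfolding W_def array_mat_def using banded_sym[of n] by (intro eq_matI) auto

lemma T_sym: "transpose_mat (T n \<omega>) = T n \<omega>"
  unfolding T_def array_mat_def using banded_sym[of n] by (intro eq_matI) auto

lemma T_entry:
  assumes "a < n" "b < n"
  shows "T n \<omega> $$ (a, b) = Z n {a, b} \<omega>"
proof -
  have *: "trunc_pow (t n) 1 (banded m x n (Suc a) (Suc b) \<omega>) = Z n {a, b} \<omega>" if "a \<le> b" for a b
  proof -
    have mm: "Min {a, b} = a" "Max {a, b} = b" using that by auto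
    have "(\<bar>int (Suc a) - int (Suc b)\<bar> \<le> int (m n) \<or> int n - int (m n) \<le> \<bar>int (Suc a) - int (Suc b)\<bar>) \<longleftrightarrow>
      (\<bar>real a - real b\<bar> \<le> real (m n) \<or> real n - real (m n) \<le> \<bar>real a - real b\<bar>)" by linarith
    then show ?thesis by (simp add: banded_def Z_def mm band_def trunc_pow_def)
  qed
  have "T n \<omega> $$ (a, b) = trunc_pow (t n) 1 (banded m x n (Suc a) (Suc b) \<omega>)"
    using assms by (simp add: T_def array_mat_def)
  also have "\<dots> = Z n {a, b} \<omega>"
  proof (cases "a \<le> b")
    case False
    have "banded m x n (Suc a) (Suc b) \<omega> = banded m x n (Suc b) (Suc a) \<omega>"
      using assms by (intro banded_sym) auto
    moreover have "{a, b} = {b, a}" by auto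
    ultimately show ?thesis using *[of b a] False by simp
  qed (rule *)
  finally show ?thesis .
qed

lemma T_moment:
  assumes "0 < k" "1 \<le> n"
  shows "(\<integral>u. u ^ k \<partial>esd (T n \<omega>)) = spectral_moment k n \<omega>"
proof -
  have "(\<Sum>i\<in>walks k n. \<Prod>j<k. T n \<omega> $$ (i j, i (Suc j mod k))) = closed_walk_sum (Z n) k n \<omega>"
    unfolding closed_walk_sum_def
  proof (intro sum.cong prod.cong refl)
    fix i j assume "i \<in> walks k n" "j \<in> {..<k}"
    then have "i j < n" "i (Suc j mod k) < n" using assms(1) by (auto simp: PiE_def Pi_def)
    then show "T n \<omega> $$ (i j, i (Suc j mod k)) = Z n (cedge k i j) \<omega>" by (simp add: T_entry cedge_def)
  qed
  then show ?thesis
    using esd_moment(2)[OF T_carrier T_sym _ assms(1), of n \<omega>] assms(2) by (simp add: spectral_moment_def)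
qed

lemma AE_moments:
  "AE \<omega> in M. \<forall>k. (\<lambda>n. \<integral>u. u ^ k \<partial>esd (T (Suc n) \<omega>)) \<longlonglongrightarrow> limit_moment g \<alpha> k"
proof (subst AE_all_countable, rule allI)
  fix k
  show "AE \<omega> in M. (\<lambda>n. \<integral>u. u ^ k \<partial>esd (T (Suc n) \<omega>)) \<longlonglongrightarrow> limit_moment g \<alpha> k"
  proof (cases "k = 0")
    case True
    have "(\<integral>u. u ^ 0 \<partial>esd (T (Suc n) \<omega>)) = 1" for n \<omega>
      using real_distribution.axioms(1)[OF real_distribution_esd] by (simp add: prob_space.prob_space)
    then show ?thesis by (simp add: True limit_moment_def)
  next
    case False
    then have k: "0 < k" by simp
    show ?thesis using AE_spectral_moment_centered[OF k]
    proof eventually_elim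
      case (elim \<omega>)
      have "(\<lambda>n. (spectral_moment k n \<omega> - expectation (spectral_moment k n)) + expectation (spectral_moment k n))
          \<longlonglongrightarrow> 0 + limit_moment g \<alpha> k"
        by (intro tendsto_add elim expectation_spectral_moment_tendsto k)
      then have "(\<lambda>n. spectral_moment k n \<omega>) \<longlonglongrightarrow> limit_moment g \<alpha> k" by simp
      then have "(\<lambda>n. spectral_moment k (Suc n) \<omega>) \<longlonglongrightarrow> limit_moment g \<alpha> k" by (rule LIMSEQ_Suc)
      then show ?case using T_moment[OF k] by simp
    qed
  qed
qed

lemma truncation_error:
  assumes "1 \<le> n"
  shows "(\<Sum>a<n. \<Sum>b<n. (W n \<omega> $$ (a, b) - T n \<omega> $$ (a, b))\<^sup>2) =
    (\<Sum>i=1..n. \<Sum>j=1..n. (banded m x n i j \<omega>)\<^sup>2 * of_bool (t n < ennreal \<bar>banded m x n i j \<omega>\<bar>))"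
proof -
  have "(u - trunc_pow (t n) 1 u)\<^sup>2 = u\<^sup>2 * of_bool (t n < ennreal \<bar>u\<bar>)" for u
    by (auto simp: trunc_pow_def not_le)
  then show ?thesis
    unfolding One_nat_def sum.atLeast1_atMost_eq
    by (intro sum.cong refl) (simp add: W_def T_def array_mat_def)
qed

lemma weak_conv_of_truncated:
  assumes conv: "weak_conv_m (\<lambda>n. esd (T (Suc n) \<omega>)) \<mu>" and \<mu>: "real_distribution \<mu>"
    and tail: "(\<lambda>n. (\<Sum>i=1..n. \<Sum>j=1..n. (banded m x n i j \<omega>)\<^sup>2 * of_bool (t n < ennreal \<bar>banded m x n i j \<omega>\<bar>)) / real n) \<longlonglongrightarrow> 0"
  shows "weak_conv_m (\<lambda>n. esd (W n \<omega>)) \<mu>"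
proof (rule weak_conv_m_Suc, rule levy_continuity[OF real_distribution_esd \<mu>])
  fix s
  let ?R = "\<lambda>n. (\<Sum>i=1..n. \<Sum>j=1..n. (banded m x n i j \<omega>)\<^sup>2 * of_bool (t n < ennreal \<bar>banded m x n i j \<omega>\<bar>)) / real n"
  have T: "(\<lambda>n. char (esd (T (Suc n) \<omega>)) s) \<longlonglongrightarrow> char \<mu> s"
    by (rule levy_continuity1[OF real_distribution_esd \<mu> conv])
  have "(\<lambda>n. char (esd (W (Suc n) \<omega>)) s - char (esd (T (Suc n) \<omega>)) s) \<longlonglongrightarrow> 0"
  proof (rule Lim_null_comparison)
    show "\<forall>\<^sub>F n in sequentially. norm (char (esd (W (Suc n) \<omega>)) s - char (esd (T (Suc n) \<omega>)) s) \<le> \<bar>s\<bar> * sqrt (?R (Suc n))"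
    proof (rule always_eventually, rule allI)
      fix n
      have "norm (char (esd (W (Suc n) \<omega>)) s - char (esd (T (Suc n) \<omega>)) s) \<le>
        \<bar>s\<bar> * sqrt ((\<Sum>a<Suc n. \<Sum>b<Suc n. (W (Suc n) \<omega> $$ (a, b) - T (Suc n) \<omega> $$ (a, b))\<^sup>2) / real (Suc n))"
        unfolding char_def
        by (rule esd_integral_diff_le[OF W_carrier W_sym T_carrier T_sym])
          (use iexp_lipschitz in auto)
      then show "norm (char (esd (W (Suc n) \<omega>)) s - char (esd (T (Suc n) \<omega>)) s) \<le> \<bar>s\<bar> * sqrt (?R (Suc n))"
        by (simp only: truncation_error le_numeral_extra Suc_le_mono le0 One_nat_def)
    qed
    have "(\<lambda>n. \<bar>s\<bar> * sqrt (?R (Suc n))) \<longlonglongrightarrow> \<bar>s\<bar> * sqrt 0"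
      by (intro tendsto_mult tendsto_const tendsto_real_sqrt LIMSEQ_Suc tail)
    then show "(\<lambda>n. \<bar>s\<bar> * sqrt (?R (Suc n))) \<longlonglongrightarrow> 0" by simp
  qed
  from tendsto_add[OF this T] show "(\<lambda>n. char (esd (W (Suc n) \<omega>)) s) \<longlonglongrightarrow> char \<mu> s" by simp
qed

lemma esd_weak_limit:
  assumes tail: "negligible_tail M (banded m x) t"
  shows "\<exists>\<mu>. real_distribution \<mu> \<and> distr \<mu> borel uminus = \<mu> \<and>
    (\<forall>k. integrable \<mu> (\<lambda>u. u ^ k) \<and> (\<integral>u. u ^ k \<partial>\<mu>) = limit_moment g \<alpha> k) \<and>
    (AE \<omega> in M. weak_conv_m (\<lambda>n. esd (array_mat (banded m x) n \<omega>)) \<mu>)"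
proof -
  let ?good = "\<lambda>\<omega>. \<forall>k. (\<lambda>n. \<integral>u. u ^ k \<partial>esd (T (Suc n) \<omega>)) \<longlonglongrightarrow> limit_moment g \<alpha> k"
  have int: "integrable (esd (T (Suc n) \<omega>)) (\<lambda>u. u ^ k)" for n \<omega> k
    by (rule esd_moment(1)[OF T_carrier T_sym]) simp
  obtain \<omega>0 where \<omega>0: "?good \<omega>0"
  proof -
    have "\<not> (\<forall>\<omega>. \<not> ?good \<omega>)"
    proof
      assume "\<forall>\<omega>. \<not> ?good \<omega>"
      with AE_moments have "AE \<omega> in M. False" by (auto elim: eventually_mono)
      then show False by (simp add: AE_False)
    qed
    then show ?thesis using that by blast
  qed
  have carl_lim: "carleman (limit_moment g \<alpha>)"
  proof (rule carleman_mono[OF carl])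
    fix k :: nat assume k: "0 < k"
    show "0 \<le> limit_moment g \<alpha> (2 * k)"
      by (rule LIMSEQ_le_const[OF \<omega>0[rule_format]]) auto
    show "limit_moment g \<alpha> (2 * k) \<le> partition_sum (bound_seq g) (2 * k)"
      using abs_limit_moment_le[of "2 * k"] k by simp
  qed
  have lim: "\<exists>\<nu>. real_distribution \<nu> \<and> (\<forall>k. integrable \<nu> (\<lambda>u. u ^ k)) \<and> (\<forall>k. (\<integral>u. u ^ k \<partial>\<nu>) = limit_moment g \<alpha> k) \<and>
      weak_conv_m (\<lambda>n. esd (T (Suc n) \<omega>)) \<nu>" if good: "?good \<omega>" for \<omega>
  proof -
    obtain \<nu> where "real_distribution \<nu>" "\<And>k. integrable \<nu> (\<lambda>u. u ^ k)" "\<And>k. (\<integral>u. u ^ k \<partial>\<nu>) = limit_moment g \<alpha> k"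
      "weak_conv_m (\<lambda>n. esd (T (Suc n) \<omega>)) \<nu>"
      by (rule method_of_moments[OF real_distribution_esd int good[rule_format] carl_lim]) (rule that; simp)
    then show ?thesis by (intro exI[of _ \<nu>] conjI allI)
  qed
  obtain \<mu> where \<mu>: "real_distribution \<mu>" "\<And>k. integrable \<mu> (\<lambda>u. u ^ k)" "\<And>k. (\<integral>u. u ^ k \<partial>\<mu>) = limit_moment g \<alpha> k"
    using lim[OF \<omega>0] by blast
  have carl_\<mu>: "carleman (\<lambda>k. \<integral>u. u ^ k \<partial>\<mu>)" using carl_lim by (simp add: \<mu>(3))
  have "distr \<mu> borel uminus = \<mu>"
    by (rule symmetric_of_odd_moments_zero[OF \<mu>(1,2) _ carl_\<mu>]) (simp add: \<mu>(3) limit_moment_odd)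
  moreover have "AE \<omega> in M. weak_conv_m (\<lambda>n. esd (W n \<omega>)) \<mu>"
    using AE_moments tail[unfolded negligible_tail_def]
  proof eventually_elim
    case (elim \<omega>)
    obtain \<nu> where \<nu>: "real_distribution \<nu>" "\<And>k. integrable \<nu> (\<lambda>u. u ^ k)" "\<And>k. (\<integral>u. u ^ k \<partial>\<nu>) = limit_moment g \<alpha> k"
      "weak_conv_m (\<lambda>n. esd (T (Suc n) \<omega>)) \<nu>" using lim[OF elim(1)] by blast
    have "\<mu> = \<nu>" by (rule carleman_moment_unique[OF \<mu>(1,2) \<nu>(1,2) _ carl_\<mu>]) (simp add: \<mu>(3) \<nu>(3))
    then show ?case using weak_conv_of_truncated[OF _ \<mu>(1) elim(2)] \<nu>(4) by simp
  qed
  ultimately show ?thesis using \<mu> unfolding W_def by blast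
qed

end

theorem mainTheorem6:
  shows "\<exists>\<Phi> :: (nat \<Rightarrow> real \<times> real \<Rightarrow> real) \<Rightarrow> real \<Rightarrow> nat \<Rightarrow> real.
    \<forall>(M :: 'a measure) (x :: nat \<Rightarrow> nat \<Rightarrow> nat \<Rightarrow> 'a \<Rightarrow> real) (t :: nat \<Rightarrow> ennreal)
     (gn :: nat \<Rightarrow> nat \<Rightarrow> real \<times> real \<Rightarrow> real) (g :: nat \<Rightarrow> real \<times> real \<Rightarrow> real)
     (m :: nat \<Rightarrow> nat) (\<alpha> :: real).
      prob_space M \<longrightarrow>
      indep_symmetric_array M x \<longrightarrow>
      assumption_A M x t gn g \<longrightarrow>
      negligible_tail M (banded m x) t \<longrightarrow>
      (\<forall>n\<ge>2. 0 < m n \<and> real (m n) \<le> real n / 2) \<longrightarrow>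
      filterlim m at_top sequentially \<longrightarrow>
      (\<lambda>n. real (m n) / real n) \<longlonglongrightarrow> \<alpha> \<longrightarrow>
      0 < \<alpha> \<longrightarrow>
      (\<exists>\<mu> :: real measure.
         real_distribution \<mu> \<and>
         distr \<mu> borel uminus = \<mu> \<and>
         (\<forall>k. integrable \<mu> (\<lambda>u. u ^ k) \<and> (\<integral>u. u ^ k \<partial>\<mu>) = \<Phi> (limit_data g) \<alpha> k) \<and>
         (AE \<omega> in M. weak_conv_m (\<lambda>n. esd (array_mat (banded m x) n \<omega>)) \<mu>))"
proof (rule exI[of _ limit_moment], intro allI impI)
  fix M :: "'a measure" and x t gn g m \<alpha>
  assume "prob_space M" "indep_symmetric_array M x" "assumption_A M x t gn g"
    and tail: "negligible_tail M (banded m x) t" and "(\<lambda>n. real (m n) / real n) \<longlonglongrightarrow> \<alpha>"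
  then interpret banded_model M x t gn g m \<alpha>
    by (intro banded_model.intro banded_model_axioms.intro)
  show "\<exists>\<mu> :: real measure. real_distribution \<mu> \<and> distr \<mu> borel uminus = \<mu> \<and>
         (\<forall>k. integrable \<mu> (\<lambda>u. u ^ k) \<and> (\<integral>u. u ^ k \<partial>\<mu>) = limit_moment (limit_data g) \<alpha> k) \<and>
         (AE \<omega> in M. weak_conv_m (\<lambda>n. esd (array_mat (banded m x) n \<omega>)) \<mu>)"
    unfolding limit_moment_limit_data by (rule esd_weak_limit[OF tail])
qed

end
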